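(* Assume Condition A holds and a bandwidth $h$ of exact order $n^{-\delta/(2p+3)}$ is used for the $p$-order local polynomial kernel (LPK) reconstructions $\hat f_i(t)$. Let $$\hat\eta(t)=n^{-1}\sum_{i=1}^n\hat f_i(t),\qquad \hat\gamma(s,t)=(n-1)^{-1}\sum_{i=1}^n\{\hat f_i(s)-\hat\eta(s)\}\{\hat f_i(t)-\hat\eta(t)\},$$ $$\tilde\eta(t)=n^{-1}\sum_{i=1}^n f_i(t),\qquad \tilde\gamma(s,t)=(n-1)^{-1}\sum_{i=1}^n\{f_i(s)-\tilde\eta(s)\}\{f_i(t)-\tilde\eta(t)\}.$$ Then as $n\to\infty$, $$\hat\eta(t)=\tilde\eta(t)+n^{-(p+1)\delta/(2p+3)}O_{\mathrm{UP}}(1),\qquad \hat\gamma(s,t)=\tilde\gamma(s,t)+n^{-(p+1)\delta/(2p+3)}O_{\mathrm{UP}}(1).$$ In addition, assume $\delta>1+1/[2(p+1)]$. Then as $n\to\infty$, $$\sqrt n\{\hat\eta(t)-\eta(t)\}\sim\mathrm{AGP}(0,\gamma),\qquad \sqrt n\{\hat\gamma(s,t)-\gamma(s,t)\}\sim\mathrm{AGP}(0,\gamma^* ),$$ where $$\gamma^*\{(s_1,t_1),(s_2,t_2)\}=\mathrm E\{v_1(s_1)v_1(t_1)v_1(s_2)v_1(t_2)\}-\gamma(s_1,t_1)\gamma(s_2,t_2).$$ When the subject-effect process $v(t)$ is Gaussian, $$\gamma^*\{(s_1,t_1),(s_2,t_2)\}=\gamma(s_1,t_2)\gamma(s_2,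t_1)+\gamma(s_1,s_2)\gamma(t_1,t_2).$$
   Context: Model. $\mathcal T=[a,b]$ with $-\infty<a<b<\infty$. Functional data: $y_i(t)=\eta(t)+v_i(t)+\varepsilon_i(t)$, $i=1,\dots,n$, where the subject effects $v_i$ are i.i.d. copies of a stochastic process $v$ on $\mathcal T$ with mean $0$ and covariance function $\gamma(s,t)$, the $\varepsilon_i$ are i.i.d. copies of a process with mean $0$ and covariance function $\gamma_\varepsilon(s,t)=\sigma^2(t)1_{\{s=t\}}$, and $v_i$, $\varepsilon_i$ are independent. The individual functions are $f_i(t)=\eta(t)+v_i(t)$. One observes $y_{ij}=f_i(t_{ij})+\varepsilon_{ij}$, $\varepsilon_{ij}=\varepsilon_i(t_{ij})$, at design time points $t_{ij}$, $j=1,\dots,n_i$, $i=1,\dots,n$. LPK reconstruction. $p$ is a fixed odd positive integer, $K$ a kernel, $h>0$ a bandwidth (common to all $i$), $K_h(\cdot)=K(\cdot/h)/h$. Put $\mathbf z_{ij}=[1,t_{ij}-t,\dots,(t_{ij}-t)^p]^T$, $\mathbf Z_i=[\mathbf z_{i1},\dots,\mathbf z_{in_i}]^T$, $\mathbf K_{ih}=\mathrm{diag}(K_h(t_{i1}-t),\dots,K_h(t_{in_i}-t))$, $\mathbf y_i=[y_{i1},\dots,y_{in_i}]^T$. Then $\hat f_i(t)=\mathbf e_{1,p+1}^T(\mathbf Z_i^T\mathbf K_{ih}\mathbf Z_i)^{-1}\mathbf Z_i^T\mathbf K_{ih}\mathbf y_i$, with $\mathbf e_{1,p+1}$ the first unit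 vector of $\mathbb R^{p+1}$. Notation. $O_{\mathrm{UP}}(1)$ means bounded in probability, as $n\to\infty$, uniformly for any $t$ (respectively $s,t$) within the interior of $\mathcal T$ and all $i=1,\dots,n$. $\mathrm{AGP}(\eta,\gamma)$ denotes an asymptotic Gaussian process with mean function $\eta$ and covariance function $\gamma$. Condition A. (1) The $t_{ij}$ are i.i.d. with p.d.f. $\pi$ with bounded support $\mathcal T$; for any $t$ in the interior of $\mathcal T$, $\pi'(t)$ exists and is continuous over $\mathcal T$. (2) For any interior points $s,t$ of $\mathcal T$: the $f_i$ and $\eta$ have up to $(p+1)$-times continuous derivatives; $\gamma(s,t)$ has up to $(p+1)$-times continuous derivatives for both $s$ and $t$; $\sigma^2$ is continuous at $t$. (3) $K$ is a bounded symmetric p.d.f. with bounded support $[-1,1]$. (4) There are constants $C,\delta>0$ with $n_i\ge Cn^\delta$ for all $i=1,\dots,n$; as $n\to\infty$, $h\to0$ and $n^\delta h\to\infty$.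
   Formalization: O_UP is uniform on compact subsets of the interior of T, and on the whole interior only if π is bounded below and σ and the derivatives of η, γ are bounded there; π>0 inside T; finite fourth moments of v for the γ̂ limit; AGP means finite-dimensional convergence. *)

theory Defs
  imports
    "HOL-Probability.Probability"
    "HOL-Library.Landau_Symbols"
    "Jordan_Normal_Form.Gauss_Jordan_Elimination"
begin

section \<open>Smoothness on an open set\<close>

definition has_derivs_upto :: "nat \<Rightarrow> real set \<Rightarrow> (real \<Rightarrow> real) \<Rightarrow> (nat \<Rightarrow> real \<Rightarrow> real) \<Rightarrow> bool" where
  "has_derivs_upto q U f D \<longleftrightarrow>
     (\<forall>x\<in>U. D 0 x = f x) \<and>
     (\<forall>j<q. \<forall>x\<in>U. (D j has_real_derivative D (Suc j) x) (at x)) \<and>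
     (\<forall>j\<le>q. continuous_on U (D j))"

text \<open>\<open>G j k\<close> is the partial derivative of order \<open>j\<close> in the first and order \<open>k\<close> in the second
  argument; orders up to \<open>q\<close> are taken in each of the two arguments.\<close>

definition has_mixed_derivs_upto ::
    "nat \<Rightarrow> real set \<Rightarrow> (real \<Rightarrow> real \<Rightarrow> real) \<Rightarrow> (nat \<Rightarrow> nat \<Rightarrow> real \<Rightarrow> real \<Rightarrow> real) \<Rightarrow> bool" where
  "has_mixed_derivs_upto q U g G \<longleftrightarrow>
     (\<forall>s\<in>U. \<forall>t\<in>U. G 0 0 s t = g s t) \<and>
     (\<forall>j<q. \<forall>k\<le>q. \<forall>s\<in>U. \<forall>t\<in>U.
        ((\<lambda>x. G j k x t) has_real_derivative G (Suc j) k s t) (at s)) \<and>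
     (\<forall>j\<le>q. \<forall>k<q. \<forall>s\<in>U. \<forall>t\<in>U.
        (G j k s has_real_derivative G j (Suc k) s t) (at t)) \<and>
     (\<forall>j\<le>q. \<forall>k\<le>q. continuous_on (U \<times> U) (\<lambda>(s, t). G j k s t))"


section \<open>Subject effects, measurement errors and random design\<close>

definition sample_path :: "real set \<Rightarrow> (real \<Rightarrow> 'a \<Rightarrow> real) \<Rightarrow> 'a \<Rightarrow> real \<Rightarrow> real" where
  "sample_path I X \<omega> = (\<lambda>t\<in>I. X t \<omega>)"

abbreviation path_space :: "real set \<Rightarrow> (real \<Rightarrow> real) measure" where
  "path_space I \<equiv> Pi\<^sub>M I (\<lambda>_. borel)"

text \<open>Subjects are numbered from \<open>0\<close>, so subject \<open>1\<close> of the usual notation is subject \<open>0\<close> here.\<close>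

definition subject_effect_error_model ::
    "'a measure \<Rightarrow> real set \<Rightarrow> (nat \<Rightarrow> real \<Rightarrow> 'a \<Rightarrow> real) \<Rightarrow> (nat \<Rightarrow> real \<Rightarrow> 'a \<Rightarrow> real) \<Rightarrow>
     (real \<Rightarrow> real \<Rightarrow> real) \<Rightarrow> (real \<Rightarrow> real) \<Rightarrow> bool" where
  "subject_effect_error_model M I v e \<gamma> \<sigma> \<longleftrightarrow>
     prob_space.indep_vars M (\<lambda>_. path_space I)
       (\<lambda>k. case k of Inl i \<Rightarrow> sample_path I (v i) | Inr i \<Rightarrow> sample_path I (e i))
       (UNIV :: (nat + nat) set) \<and>
     (\<forall>i. distr M (path_space I) (sample_path I (v i)) = distr M (path_space I) (sample_path I (v 0))) \<and>
     (\<forall>i. distr M (path_space I) (sample_path I (e i)) = distr M (path_space I) (sample_path I (e 0))) \<and>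
     (\<forall>t\<in>I. has_bochner_integral M (v 0 t) 0 \<and> has_bochner_integral M (e 0 t) 0) \<and>
     (\<forall>s\<in>I. \<forall>t\<in>I. has_bochner_integral M (\<lambda>\<omega>. v 0 s \<omega> * v 0 t \<omega>) (\<gamma> s t)) \<and>
     (\<forall>s\<in>I. \<forall>t\<in>I. has_bochner_integral M (\<lambda>\<omega>. e 0 s \<omega> * e 0 t \<omega>) (if s = t then (\<sigma> t)\<^sup>2 else 0))"

text \<open>Independence of the design \<open>(T i j)\<close>, \<open>(i, j) \<in> J\<close>, from the processes \<open>v\<close> and \<open>e\<close>.

  A process with covariance \<open>\<sigma>\<^sup>2(t) 1{s = t}\<close> and \<open>\<sigma> \<noteq> 0\<close> has no jointly measurable version, and its
  finite-dimensional laws together with sigma-algebra independence do not determine the law of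
  \<open>\<omega> \<mapsto> e i (T i j \<omega>) \<omega>\<close>. Independence therefore has to say that, given the design, evaluating
  the processes at the design points amounts to evaluating them at fixed times: expectations do not
  change when the design is frozen at an independent realization \<open>\<omega>'\<close>. Test functions that ignore
  their third argument give ordinary independence of the design from the two families.\<close>

definition processes_at :: "(nat \<times> nat) set \<Rightarrow> (nat \<Rightarrow> real \<Rightarrow> 'a \<Rightarrow> real) \<Rightarrow> (nat \<Rightarrow> real \<Rightarrow> 'a \<Rightarrow> real) \<Rightarrow>
    (nat \<times> nat \<Rightarrow> real) \<Rightarrow> 'a \<Rightarrow> nat \<times> nat \<Rightarrow> real \<times> real" where
  "processes_at J v e \<tau> \<omega> = (\<lambda>(i, j)\<in>J. (v i (\<tau> (i, j)) \<omega>, e i (\<tau> (i, j)) \<omega>))"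

definition design_independent ::
    "'a measure \<Rightarrow> real set \<Rightarrow> (nat \<Rightarrow> real \<Rightarrow> 'a \<Rightarrow> real) \<Rightarrow> (nat \<Rightarrow> real \<Rightarrow> 'a \<Rightarrow> real) \<Rightarrow>
     (nat \<times> nat) set \<Rightarrow> (nat \<Rightarrow> nat \<Rightarrow> 'a \<Rightarrow> real) \<Rightarrow> bool" where
  "design_independent M I v e J T \<longleftrightarrow>
     (let design = (\<lambda>\<omega>. \<lambda>(i, j)\<in>J. T i j \<omega>);
          paths = (\<lambda>\<omega>. \<lambda>(i, t)\<in>(UNIV :: nat set) \<times> I. (v i t \<omega>, e i t \<omega>))
      in \<forall>g \<in> borel_measurable (Pi\<^sub>M J (\<lambda>_. borel) \<Otimes>\<^sub>M
              (Pi\<^sub>M (UNIV \<times> I) (\<lambda>_. borel) \<Otimes>\<^sub>M Pi\<^sub>M J (\<lambda>_. borel))).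
          (\<integral>\<^sup>+ \<omega>. (g (design \<omega>, paths \<omega>, processes_at J v e (design \<omega>) \<omega>) :: ennreal) \<partial>M) =
          (\<integral>\<^sup>+ \<omega>'. (\<integral>\<^sup>+ \<omega>. g (design \<omega>', paths \<omega>, processes_at J v e (design \<omega>') \<omega>) \<partial>M) \<partial>M))"


section \<open>Local polynomial kernel reconstruction and sample moments\<close>

text \<open>The value \<open>0\<close> for a singular normal matrix is a convention; under the usual conditions the
  probability that it is used for some subject tends to \<open>0\<close>.\<close>

definition lpk :: "nat \<Rightarrow> (real \<Rightarrow> real) \<Rightarrow> real \<Rightarrow> nat \<Rightarrow> (nat \<Rightarrow> real) \<Rightarrow> (nat \<Rightarrow> real) \<Rightarrow> real \<Rightarrow> real" where
  "lpk p K h m \<tau> y t =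
     (let Z = mat m (p + 1) (\<lambda>(j, r). (\<tau> j - t) ^ r);
          W = mat m m (\<lambda>(j, l). if j = l then K ((\<tau> j - t) / h) / h else 0)
      in case mat_inverse (transpose_mat Z * W * Z) of
           None \<Rightarrow> 0
         | Some B \<Rightarrow> scalar_prod (unit_vec (p + 1) 0) (B *\<^sub>v ((transpose_mat Z * W) *\<^sub>v vec m y)))"

definition sample_mean :: "nat \<Rightarrow> (nat \<Rightarrow> real \<Rightarrow> 'a \<Rightarrow> real) \<Rightarrow> real \<Rightarrow> 'a \<Rightarrow> real" where
  "sample_mean n F t \<omega> = (\<Sum>i<n. F i t \<omega>) / real n"

definition sample_cov :: "nat \<Rightarrow> (nat \<Rightarrow> real \<Rightarrow> 'a \<Rightarrow> real) \<Rightarrow> real \<Rightarrow> real \<Rightarrow> 'a \<Rightarrow> real" where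
  "sample_cov n F s t \<omega> =
     (\<Sum>i<n. (F i s \<omega> - sample_mean n F s \<omega>) * (F i t \<omega> - sample_mean n F t \<omega>)) / (real n - 1)"


section \<open>Stochastic boundedness and Gaussian limits\<close>

text \<open>The bound is uniform over the index set, with the index outside the probability.\<close>

definition O_UP :: "'a measure \<Rightarrow> 'i set \<Rightarrow> (nat \<Rightarrow> 'i \<Rightarrow> 'a \<Rightarrow> real) \<Rightarrow> bool" where
  "O_UP M S X \<longleftrightarrow>
     (\<forall>\<epsilon>>0. \<exists>B N. \<forall>n\<ge>N. \<forall>x\<in>S. measure M {\<omega>\<in>space M. \<bar>X n x \<omega>\<bar> > B} < \<epsilon>)"

text \<open>Univariate normal law with mean \<open>\<mu>\<close> and variance \<open>w\<close>, degenerate for \<open>w = 0\<close>.\<close>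

definition normal_law :: "real \<Rightarrow> real \<Rightarrow> real measure" where
  "normal_law \<mu> w =
     (if w > 0 then density lborel (\<lambda>x. ennreal (normal_density \<mu> (sqrt w) x)) else return borel \<mu>)"

text \<open>Multivariate normal law on \<open>\<real>\<^sup>k\<close> (realized as \<open>Pi\<^sub>M {..<k}\<close>) with mean \<open>\<mu>\<close> and possibly singular
  covariance matrix \<open>c\<close>: all linear functionals are normal.\<close>

definition multivariate_normal ::
    "nat \<Rightarrow> (nat \<Rightarrow> real) \<Rightarrow> (nat \<Rightarrow> nat \<Rightarrow> real) \<Rightarrow> (nat \<Rightarrow> real) measure \<Rightarrow> bool" where
  "multivariate_normal k \<mu> c N \<longleftrightarrow>
     prob_space N \<and> sets N = sets (Pi\<^sub>M {..<k} (\<lambda>_. borel :: real measure)) \<and>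
     (\<forall>u. distr N borel (\<lambda>x. \<Sum>j<k. u j * x j) =
        normal_law (\<Sum>j<k. u j * \<mu> j) (\<Sum>j<k. \<Sum>l<k. u j * u l * c j l))"

definition gaussian_process ::
    "'a measure \<Rightarrow> 'i set \<Rightarrow> ('i \<Rightarrow> 'a \<Rightarrow> real) \<Rightarrow> ('i \<Rightarrow> real) \<Rightarrow> ('i \<Rightarrow> 'i \<Rightarrow> real) \<Rightarrow> bool" where
  "gaussian_process M S X \<mu> c \<longleftrightarrow>
     (\<forall>k. \<forall>\<tau> \<in> {..<k} \<rightarrow> S.
        (\<lambda>\<omega>. \<lambda>j\<in>{..<k}. X (\<tau> j) \<omega>) \<in> measurable M (Pi\<^sub>M {..<k} (\<lambda>_. borel)) \<and>
        multivariate_normal k (\<lambda>j. \<mu> (\<tau> j)) (\<lambda>j l. c (\<tau> j) (\<tau> l))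
          (distr M (Pi\<^sub>M {..<k} (\<lambda>_. borel)) (\<lambda>\<omega>. \<lambda>j\<in>{..<k}. X (\<tau> j) \<omega>)))"

text \<open>Weak convergence of random vectors in \<open>\<real>\<^sup>k\<close>; continuity refers to the product topology on
  functions.\<close>

definition weak_conv_vec ::
    "'a measure \<Rightarrow> nat \<Rightarrow> (nat \<Rightarrow> nat \<Rightarrow> 'a \<Rightarrow> real) \<Rightarrow> (nat \<Rightarrow> real) measure \<Rightarrow> bool" where
  "weak_conv_vec M k Y N \<longleftrightarrow>
     (\<forall>g :: (nat \<Rightarrow> real) \<Rightarrow> real.
        continuous_on (PiE {..<k} (\<lambda>_. UNIV)) g \<and> bounded (g ` PiE {..<k} (\<lambda>_. UNIV)) \<longrightarrow>
        (\<lambda>n. \<integral>\<omega>. g (\<lambda>j\<in>{..<k}. Y n j \<omega>) \<partial>M) \<longlonglongrightarrow> (\<integral>x. g x \<partial>N))"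

text \<open>Asymptotic Gaussian process: the finite-dimensional distributions converge weakly to those of
  the Gaussian process with mean function \<open>\<mu>\<close> and covariance function \<open>c\<close>.\<close>

definition AGP ::
    "'a measure \<Rightarrow> 'i set \<Rightarrow> (nat \<Rightarrow> 'i \<Rightarrow> 'a \<Rightarrow> real) \<Rightarrow> ('i \<Rightarrow> real) \<Rightarrow> ('i \<Rightarrow> 'i \<Rightarrow> real) \<Rightarrow> bool" where
  "AGP M S X \<mu> c \<longleftrightarrow>
     (\<forall>k. \<forall>\<tau> \<in> {..<k} \<rightarrow> S. \<exists>N.
        multivariate_normal k (\<lambda>j. \<mu> (\<tau> j)) (\<lambda>j l. c (\<tau> j) (\<tau> l)) N \<and>
        weak_conv_vec M k (\<lambda>n j. X n (\<tau> j)) N)"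


section \<open>Standing conditions\<close>

text \<open>Assumptions on the design density and on smoothness are made at interior points only. The
  density is positive in the interior of its support, and \<open>\<pi>'\<close>, which exists at interior points, is
  the restriction of a continuous function on the closed interval.\<close>

definition design_density :: "real \<Rightarrow> real \<Rightarrow> (real \<Rightarrow> real) \<Rightarrow> bool" where
  "design_density a b \<pi> \<longleftrightarrow>
     \<pi> \<in> borel_measurable borel \<and> (\<forall>x. \<pi> x \<ge> 0) \<and>
     (\<forall>x\<in>{a<..<b}. \<pi> x > 0) \<and> (\<forall>x. x \<notin> {a..b} \<longrightarrow> \<pi> x = 0) \<and>
     (\<exists>\<pi>'. continuous_on {a..b} \<pi>' \<and> (\<forall>x\<in>{a<..<b}. (\<pi> has_real_derivative \<pi>' x) (at x)))"

definition random_design ::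
    "'a measure \<Rightarrow> (real \<Rightarrow> real) \<Rightarrow> (nat \<times> nat) set \<Rightarrow> (nat \<Rightarrow> nat \<Rightarrow> 'a \<Rightarrow> real) \<Rightarrow> bool" where
  "random_design M \<pi> J T \<longleftrightarrow>
     prob_space.indep_vars M (\<lambda>_. borel) (\<lambda>(i, j). T i j) J \<and>
     (\<forall>(i, j)\<in>J. distributed M lborel (T i j) (\<lambda>x. ennreal (\<pi> x)))"

definition kernel_condition :: "(real \<Rightarrow> real) \<Rightarrow> bool" where
  "kernel_condition K \<longleftrightarrow>
     K \<in> borel_measurable borel \<and> (\<forall>u. K u \<ge> 0) \<and> has_bochner_integral lborel K 1 \<and>
     (\<exists>B. \<forall>u. K u \<le> B) \<and> (\<forall>u. K (- u) = K u) \<and> (\<forall>u. \<bar>u\<bar> > 1 \<longrightarrow> K u = 0)"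

text \<open>Interior conditions allow \<open>\<pi>\<close> to vanish and derivatives to blow up at \<open>a\<close> and \<open>b\<close>. The
  following excludes this; it is what uniformity up to the end points requires.\<close>

definition regular_at_boundary ::
    "nat \<Rightarrow> real \<Rightarrow> real \<Rightarrow> (real \<Rightarrow> real) \<Rightarrow> (real \<Rightarrow> real) \<Rightarrow> (real \<Rightarrow> real \<Rightarrow> real) \<Rightarrow> (real \<Rightarrow> real) \<Rightarrow> bool" where
  "regular_at_boundary q a b \<pi> \<eta> \<gamma> \<sigma> \<longleftrightarrow>
     (\<exists>c>0. \<forall>x\<in>{a<..<b}. c \<le> \<pi> x) \<and>
     (\<exists>D. has_derivs_upto q {a<..<b} \<eta> D \<and> (\<forall>j\<le>q. bounded (D j ` {a<..<b}))) \<and>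
     (\<exists>G. has_mixed_derivs_upto q {a<..<b} \<gamma> G \<and>
        (\<forall>j\<le>q. \<forall>k\<le>q. bounded ((\<lambda>(s, t). G j k s t) ` ({a<..<b} \<times> {a<..<b})))) \<and>
     bounded (\<sigma> ` {a<..<b})"

end

theory Submission
  imports Defs "Jordan_Normal_Form.Determinant" "HOL-Real_Asymp.Real_Asymp"
begin

text \<open>
  Fix \<open>t\<close> and one subject. Where the weighted design has its expected spread, the local polynomial
  estimate is a linear combination \<open>\<Sum>\<^sub>j w\<^sub>j y\<^sub>j\<close> of the observations within distance \<open>h\<close> of \<open>t\<close>; the
  weights reproduce polynomials of degree at most \<open>p\<close>, have bounded absolute sum, and their squares sum
  to \<open>O(1 / (m h))\<close> for \<open>m\<close> observations (\<open>lpk_weights\<close>). The functional \<open>\<Sum>\<^sub>j w\<^sub>j f(\<tau>\<^sub>j) - f(t)\<close> kills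
  polynomials of degree \<open>p\<close>, so Taylor's formula makes it \<open>O(h\<^bsup>p+1\<^esup>)\<close>. Applied to \<open>\<eta>\<close> this bounds the
  deterministic bias. Applied once in each argument of \<open>\<gamma>\<close> it bounds the second moment of the
  smoothing error of \<open>v\<^sub>i\<close>, because that moment is the tensor square of the functional evaluated at
  \<open>\<gamma>\<close>. The errors at distinct design points are uncorrelated and contribute \<open>O(1 / (m h))\<close>. With
  \<open>h\<close> of order \<open>n\<^bsup>-\<delta>/(2p+3)\<^esup>\<close> all three are of order \<open>n\<^bsup>-2(p+1)\<delta>/(2p+3)\<^esup>\<close>, the squared rate
  (\<open>fixed_design_mse\<close>, \<open>mse_rate\<close>).

  Two points make this uniform. First, all \<open>n\<close> subjects must have well-spread designs simultaneously:
  the normalized entries of the normal matrices are means of bounded variables, and Hoeffding's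
  inequality bounds the probability of a deviation by \<open>exp(- c m h\<^sup>2)\<close>, where \<open>m h\<^sup>2\<close> grows like a
  power of \<open>n\<close>, so a union bound over the subjects is harmless (\<open>bad_rate\<close>). Second, the population
  normal matrix is bounded below uniformly in \<open>t\<close>, even near an end point, because half of the kernel
  window lies inside the interval and the kernel restricted to a half line still has a positive
  definite moment matrix (\<open>half_kernel_form\<close>).

  On the good event the average over the subjects of the squared errors is \<open>O\<^sub>P\<close> of the squared rate
  by Markov's inequality. Both uniform expansions follow by the Cauchy-Schwarz inequality:
  the difference of the means is at most the root mean squared error, and the difference of the
  covariances is bilinear in errors and effects.

  If \<open>\<delta> > 1 + 1/(2(p+1))\<close>, then \<open>\<surd>n\<close> times the rate vanishes, and the limits are those of
  \<open>\<surd>n (\<eta>\<^sub>n - \<eta>)\<close> and \<open>\<surd>n (\<gamma>\<^sub>n - \<gamma>)\<close> for the sample moments \<open>\<eta>\<^sub>n\<close>, \<open>\<gamma>\<^sub>n\<close> of the true curves. These are, up to a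
  vanishing term, normalized sums of the i.i.d. variables \<open>v\<^sub>i(t)\<close> and \<open>v\<^sub>i(s) v\<^sub>i(t) - \<gamma>(s, t)\<close>, and
  the central limit theorem for all linear combinations, combined with a continuity theorem for
  random vectors (\<open>weak_conv_vecI\<close>), yields the finite-dimensional limits. In the Gaussian case,
  the fourth moments of linear combinations determine the mixed moments by polarization.
\<close>


section \<open>Weak convergence of random vectors\<close>

text \<open>Normalizing the density \<open>W\<close>, which is bounded away from \<open>0\<close>, gives probability measures. Under them
  the characteristic functions of \<open>X\<close> converge, and Levy's theorem on the line applies.\<close>

lemma weighted_levy:
  fixes Q :: "nat \<Rightarrow> 'b measure" and Q' :: "'b measure" and W X :: "'b \<Rightarrow> real" and g :: "real \<Rightarrow> real"
  assumes Q: "\<And>n. prob_space (Q n)" "\<And>n. sets (Q n) = sets Q'" and Q': "prob_space Q'"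
    and [measurable]: "W \<in> borel_measurable Q'" "X \<in> borel_measurable Q'"
    and W: "\<And>x. 1 \<le> W x" "\<And>x. W x \<le> C"
    and c: "\<And>t. (\<lambda>n. \<integral>x. W x * cos (t * X x) \<partial>Q n) \<longlonglongrightarrow> (\<integral>x. W x * cos (t * X x) \<partial>Q')"
    and s: "\<And>t. (\<lambda>n. \<integral>x. W x * sin (t * X x) \<partial>Q n) \<longlonglongrightarrow> (\<integral>x. W x * sin (t * X x) \<partial>Q')"
    and g: "continuous_on UNIV g" "\<And>x. \<bar>g x\<bar> \<le> B"
  shows "(\<lambda>n. \<integral>x. W x * g (X x) \<partial>Q n) \<longlonglongrightarrow> (\<integral>x. W x * g (X x) \<partial>Q')"
proof -
  have gm[measurable]: "g \<in> borel_measurable borel"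
    using g(1) by (rule borel_measurable_continuous_onI)
  define mass where "mass R = (\<integral>x. W x \<partial>R)" for R
  define D where "D R = distr (density R (\<lambda>x. ennreal (W x / mass R))) borel X" for R :: "'b measure"
  have main: "mass R \<ge> 1 \<and> real_distribution (D R) \<and>
      (\<forall>t. char (D R) t = Complex (\<integral>x. W x * cos (t * X x) \<partial>R) (\<integral>x. W x * sin (t * X x) \<partial>R) / mass R) \<and>
      (\<integral>x. g x \<partial>D R) = (\<integral>x. W x * g (X x) \<partial>R) / mass R"
    if R: "prob_space R" "sets R = sets Q'" for R
  proof -
    interpret prob_space R by fact
    have [measurable_cong]: "sets R = sets Q'" by fact
    have [measurable]: "W \<in> borel_measurable R" "X \<in> borel_measurable R" by measurable
    have W0: "0 \<le> W x" for x using W(1)[of x] by linarith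
    have C0: "0 \<le> C" using W0[of undefined] W(2)[of undefined] by linarith
    have intW: "integrable R (\<lambda>x. W x * f x)" if [measurable]: "f \<in> borel_measurable R" and "\<And>x. \<bar>f x\<bar> \<le> b" for f b
    proof (rule integrable_const_bound[where B="C * b"])
      show "AE x in R. norm (W x * f x) \<le> C * b"
        using W0 W(2) C0 that(2) by (auto simp: abs_mult intro!: mult_mono)
    qed simp
    have iW: "integrable R W" using intW[of "\<lambda>_. 1" 1] by simp
    have m1: "mass R \<ge> 1"
    proof -
      have "(\<integral>x. 1 \<partial>R) \<le> (\<integral>x. W x \<partial>R)" by (rule integral_mono) (use iW W in auto)
      then show ?thesis by (simp add: mass_def prob_space)
    qed
    let ?P = "density R (\<lambda>x. ennreal (W x / mass R))"
    have nn: "0 \<le> W x / mass R" for x using W0 m1 by simp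
    have P: "prob_space ?P"
    proof
      have "emeasure ?P (space ?P) = (\<integral>\<^sup>+x. ennreal (W x / mass R) \<partial>R)"
        by (simp add: emeasure_density cong: nn_integral_cong)
      also have "\<dots> = ennreal (\<integral>x. W x / mass R \<partial>R)"
        by (rule nn_integral_eq_integral) (use iW nn in auto)
      also have "\<dots> = 1" using m1 by (simp add: mass_def)
      finally show "emeasure ?P (space ?P) = 1" .
    qed
    have rd: "real_distribution (D R)"
      unfolding D_def by (rule prob_space.real_distribution_distr[OF P]) simp
    have int: "(\<integral>x. f x \<partial>D R) = (\<integral>x. W x * f (X x) \<partial>R) / mass R"
      if [measurable]: "f \<in> borel_measurable borel" for f :: "real \<Rightarrow> real"
    proof -
      have "(\<integral>x. f x \<partial>D R) = (\<integral>x. f (X x) \<partial>?P)" unfolding D_def by (rule integral_distr) simp_all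
      also have "\<dots> = (\<integral>x. W x / mass R * f (X x) \<partial>R)"
        by (subst integral_density) (use nn in auto)
      finally show ?thesis by simp
    qed
    have char: "char (D R) t = Complex (\<integral>x. W x * cos (t * X x) \<partial>R) (\<integral>x. W x * sin (t * X x) \<partial>R) / mass R" for t
    proof -
      interpret D: real_distribution "D R" by (rule rd)
      have i: "integrable (D R) (\<lambda>x. iexp (t * x))"
        by (rule D.integrable_const_bound[where B=1]) (auto)
      have "Re (char (D R) t) = (\<integral>x. cos (t * x) \<partial>D R)" "Im (char (D R) t) = (\<integral>x. sin (t * x) \<partial>D R)"
        unfolding char_def using integral_Re[OF i] integral_Im[OF i] by (simp_all add: Re_exp Im_exp)
      then show ?thesis
        by (subst (asm) (1 2) int) (auto simp: complex_eq_iff)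
    qed
    show ?thesis using m1 rd char int[OF gm] by auto
  qed
  note m = main[OF Q] main[OF Q' refl]
  have mc: "(\<lambda>n. mass (Q n)) \<longlonglongrightarrow> mass Q'"
    using c[of 0] by (simp add: mass_def)
  have "weak_conv_m (\<lambda>n. D (Q n)) (D Q')"
  proof (rule levy_continuity)
    show "(\<lambda>n. char (D (Q n)) t) \<longlonglongrightarrow> char (D Q') t" for t
      using m(2) by (subst m(1)[THEN conjunct2, THEN conjunct2, THEN conjunct1, rule_format],
        subst m(2)[THEN conjunct2, THEN conjunct2, THEN conjunct1, rule_format])
        (intro tendsto_intros c s mc, auto)
  qed (use m in auto)
  then have "(\<lambda>n. \<integral>x. g x \<partial>D (Q n)) \<longlonglongrightarrow> (\<integral>x. g x \<partial>D Q')"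
    by (rule weak_conv_imp_integral_bdd_continuous_conv[rotated 2])
      (use m g in \<open>auto simp: continuous_on_eq_continuous_at\<close>)
  then have "(\<lambda>n. (\<integral>x. g x \<partial>D (Q n)) * mass (Q n)) \<longlonglongrightarrow> (\<integral>x. g x \<partial>D Q') * mass Q'"
    by (intro tendsto_intros mc)
  moreover have "mass (Q n) \<noteq> 0" "mass Q' \<noteq> 0" for n using m(1)[of n] m(2) by auto
  ultimately show ?thesis using m by simp
qed

context
  fixes k :: nat and Q :: "nat \<Rightarrow> (nat \<Rightarrow> real) measure" and Q' :: "(nat \<Rightarrow> real) measure"
  assumes Q: "\<And>n. prob_space (Q n)" "\<And>n. sets (Q n) = sets borel"
    and Q': "prob_space Q'" "sets Q' = sets borel"
begin

interpretation Q: prob_space "Q n" for n by (rule Q)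
interpretation Q': prob_space Q' by (rule Q')

lemma meas_Q[simp]: "borel_measurable (Q n) = borel_measurable borel" "borel_measurable Q' = borel_measurable borel"
  using Q Q' by (auto intro!: measurable_cong_sets)

definition convergent_mean :: "((nat \<Rightarrow> real) \<Rightarrow> real) \<Rightarrow> bool" where
  "convergent_mean f \<longleftrightarrow> f \<in> borel_measurable borel \<and> (\<exists>B. \<forall>x. \<bar>f x\<bar> \<le> B) \<and>
     (\<lambda>n. \<integral>x. f x \<partial>Q n) \<longlonglongrightarrow> (\<integral>x. f x \<partial>Q')"

lemma integrable_bdd:
  assumes "f \<in> borel_measurable borel" "\<And>x. \<bar>f x\<bar> \<le> (B::real)"
  shows "integrable (Q n) f" "integrable Q' f"
  by (rule Q.integrable_const_bound[where B=B] Q'.integrable_const_bound[where B=B]; use assms in simp)+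

lemma convergent_mean_integrable:
  assumes "convergent_mean f"
  shows "integrable (Q n) f" "integrable Q' f"
  using assms integrable_bdd unfolding convergent_mean_def by blast+

lemma convergent_mean_add:
  assumes "convergent_mean f" "convergent_mean g"
  shows "convergent_mean (\<lambda>x. f x + g x)"
  unfolding convergent_mean_def
proof (intro conjI)
  from assms obtain B1 B2 where "\<And>x. \<bar>f x\<bar> \<le> B1" "\<And>x. \<bar>g x\<bar> \<le> B2" unfolding convergent_mean_def by blast
  then have "\<bar>f x + g x\<bar> \<le> B1 + B2" for x by (intro order_trans[OF abs_triangle_ineq] add_mono)
  then show "\<exists>B. \<forall>x. \<bar>f x + g x\<bar> \<le> B" by blast
  show "(\<lambda>n. \<integral>x. f x + g x \<partial>Q n) \<longlonglongrightarrow> (\<integral>x. f x + g x \<partial>Q')"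
    using assms convergent_mean_integrable[OF assms(1)] convergent_mean_integrable[OF assms(2)]
    by (simp add: convergent_mean_def tendsto_add)
  show "(\<lambda>x. f x + g x) \<in> borel_measurable borel"
    using assms unfolding convergent_mean_def by (intro borel_measurable_add) auto
qed

lemma convergent_mean_scale:
  assumes "convergent_mean f"
  shows "convergent_mean (\<lambda>x. c * f x)"
  unfolding convergent_mean_def
proof (intro conjI)
  from assms obtain B where "\<And>x. \<bar>f x\<bar> \<le> B" unfolding convergent_mean_def by blast
  then have "\<bar>c * f x\<bar> \<le> \<bar>c\<bar> * B" for x by (simp add: abs_mult mult_left_mono)
  then show "\<exists>B. \<forall>x. \<bar>c * f x\<bar> \<le> B" by blast
  show "(\<lambda>n. \<integral>x. c * f x \<partial>Q n) \<longlonglongrightarrow> (\<integral>x. c * f x \<partial>Q')"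
    using assms by (simp add: convergent_mean_def tendsto_mult_left)
  show "(\<lambda>x. c * f x) \<in> borel_measurable borel"
    using assms unfolding convergent_mean_def by (intro borel_measurable_times borel_measurable_const) auto
qed

lemma convergent_mean_const: "convergent_mean (\<lambda>x. c)"
  unfolding convergent_mean_def by (auto simp: Q.prob_space Q'.prob_space)

text \<open>A signed weight \<open>f\<close> is made positive by adding a constant; the constant's own contribution is
  removed at the end by the case of weight \<open>1\<close>.\<close>

lemma convergent_mean_coord:
  assumes f: "convergent_mean f"
    and fc: "\<And>t. convergent_mean (\<lambda>x. f x * cos (t * x j))" "\<And>t. convergent_mean (\<lambda>x. f x * sin (t * x j))"
    and c: "\<And>t. convergent_mean (\<lambda>x. cos (t * x j))" "\<And>t. convergent_mean (\<lambda>x. sin (t * x j))"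
    and g: "continuous_on UNIV (g :: real \<Rightarrow> real)" "\<And>x. \<bar>g x\<bar> \<le> B"
  shows "convergent_mean (\<lambda>x. f x * g (x j))"
proof -
  have [measurable]: "g \<in> borel_measurable borel"
    using g(1) by (rule borel_measurable_continuous_onI)
  have [measurable]: "(\<lambda>x::nat\<Rightarrow>real. x j) \<in> borel_measurable borel"
    by (intro borel_measurable_continuous_onI continuous_on_product_coordinates)
  obtain A where A: "\<And>x. \<bar>f x\<bar> \<le> A" using f unfolding convergent_mean_def by blast
  have [measurable]: "f \<in> borel_measurable borel" using f unfolding convergent_mean_def by simp
  have A0: "0 \<le> A" using A[of undefined] by linarith
  have B0: "0 \<le> B" using g(2)[of undefined] by linarith
  have *: "(\<lambda>n. \<integral>x. W x * g (x j) \<partial>Q n) \<longlonglongrightarrow> (\<integral>x. W x * g (x j) \<partial>Q')"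
    if W: "W = (\<lambda>x. A + 1 + f x) \<or> W = (\<lambda>x. 1)" for W
  proof (rule weighted_levy[where W=W and X="\<lambda>x. x j" and g=g and C="2 * A + 1" and B=B])
    fix t
    have "convergent_mean (\<lambda>x. W x * cos (t * x j)) \<and> convergent_mean (\<lambda>x. W x * sin (t * x j))"
      using W
    proof
      assume W: "W = (\<lambda>x. A + 1 + f x)"
      show ?thesis unfolding W
        using convergent_mean_add[OF convergent_mean_scale[OF c(1), of "A + 1" t] fc(1)[of t]]
          convergent_mean_add[OF convergent_mean_scale[OF c(2), of "A + 1" t] fc(2)[of t]]
        by (simp add: algebra_simps)
    qed (use c in auto)
    then show "(\<lambda>n. \<integral>x. W x * cos (t * x j) \<partial>Q n) \<longlonglongrightarrow> (\<integral>x. W x * cos (t * x j) \<partial>Q')"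
      "(\<lambda>n. \<integral>x. W x * sin (t * x j) \<partial>Q n) \<longlonglongrightarrow> (\<integral>x. W x * sin (t * x j) \<partial>Q')"
      unfolding convergent_mean_def by auto
  next
    fix x show "1 \<le> W x" "W x \<le> 2 * A + 1" using W A[of x] A0 by auto
  qed (use W Q Q' g in auto)
  have "convergent_mean (\<lambda>x. (A + 1 + f x) * g (x j))"
    unfolding convergent_mean_def
  proof (intro conjI)
    have "\<bar>(A + 1 + f x) * g (x j)\<bar> \<le> (2 * A + 1) * B" for x
      unfolding abs_mult by (rule mult_mono) (use A[of x] A0 g(2) in auto)
    then show "\<exists>B. \<forall>x. \<bar>(A + 1 + f x) * g (x j)\<bar> \<le> B" by blast
  qed (use *[of "\<lambda>x. A + 1 + f x"] in auto)
  moreover have "convergent_mean (\<lambda>x. g (x j))"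
    unfolding convergent_mean_def
  proof (intro conjI)
    show "\<exists>B. \<forall>x::nat\<Rightarrow>real. \<bar>g (x j)\<bar> \<le> B" using g(2) by blast
  qed (use *[of "\<lambda>x. 1"] in auto)
  ultimately have "convergent_mean (\<lambda>x. (A + 1 + f x) * g (x j) + (- (A + 1)) * g (x j))"
    by (intro convergent_mean_add convergent_mean_scale)
  then show ?thesis by (simp add: algebra_simps)
qed

text \<open>Convergence of all characteristic functions of the signed measures with density \<open>w\<close>. Multiplication
  by a function of one coordinate preserves this property, which reduces statements about \<open>k\<close>
  coordinates to Levy's theorem on the line.\<close>

definition good_weight :: "((nat \<Rightarrow> real) \<Rightarrow> real) \<Rightarrow> bool" where
  "good_weight w \<longleftrightarrow> (\<forall>u. convergent_mean (\<lambda>x. w x * cos (\<Sum>j<k. u j * x j)) \<and>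
     convergent_mean (\<lambda>x. w x * sin (\<Sum>j<k. u j * x j)))"

lemma good_weight_convergent: "good_weight w \<Longrightarrow> convergent_mean w"
  unfolding good_weight_def by (drule spec[where x="\<lambda>_. 0"]) simp

lemma good_weight_add: "good_weight v \<Longrightarrow> good_weight w \<Longrightarrow> good_weight (\<lambda>x. v x + w x)"
  unfolding good_weight_def using convergent_mean_add by (fastforce simp: distrib_right)

lemma good_weight_scale: "good_weight w \<Longrightarrow> good_weight (\<lambda>x. c * w x)"
  unfolding good_weight_def using convergent_mean_scale[of _ c] by (fastforce simp: mult.assoc)

text \<open>A function of a single coordinate has to be integrated against the weight \<open>w(x) cos(u \<bullet> x)\<close>. The
  characteristic function of that weight along the coordinate is again a combination of
  trigonometric integrals of \<open>w\<close>, by the product formulas.\<close>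

lemma good_weight_coord:
  assumes one: "good_weight (\<lambda>_. 1)" and w: "good_weight w" and j: "j < k"
    and g: "continuous_on UNIV (g :: real \<Rightarrow> real)" "\<And>x. \<bar>g x\<bar> \<le> B"
  shows "good_weight (\<lambda>x. w x * g (x j))"
proof -
  have lin: "t * x j = (\<Sum>i<k. (if i = j then t else 0) * x i)" for t and x :: "nat \<Rightarrow> real"
  proof -
    have "(\<Sum>i<k. (if i = j then t else 0) * x i) = (\<Sum>i<k. if i = j then t * x i else 0)"
      by (intro sum.cong) auto
    then show ?thesis using j by (simp add: sum.delta)
  qed
  have c: "convergent_mean (\<lambda>x. cos (t * x j))" "convergent_mean (\<lambda>x. sin (t * x j))" for t
    using one[unfolded good_weight_def, rule_format, of "\<lambda>i. if i = j then t else 0"]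
    unfolding lin by simp_all
  have add: "(\<Sum>i<k. u i * x i) + t * x j = (\<Sum>i<k. (u i + (if i = j then t else 0)) * x i)"
    "(\<Sum>i<k. u i * x i) - t * x j = (\<Sum>i<k. (u i - (if i = j then t else 0)) * x i)"
    "t * x j - (\<Sum>i<k. u i * x i) = (\<Sum>i<k. ((if i = j then t else 0) - u i) * x i)" for u t and x :: "nat \<Rightarrow> real"
    unfolding lin by (simp_all add: algebra_simps sum.distrib sum_subtractf)
  have cm: "convergent_mean (\<lambda>x. w x * cos (\<Sum>j<k. u j * x j))"
    "convergent_mean (\<lambda>x. w x * sin (\<Sum>j<k. u j * x j))" for u
    using w unfolding good_weight_def by auto
  have half: "convergent_mean (\<lambda>x. w x * ((p x + q x) / 2))" "convergent_mean (\<lambda>x. w x * ((p x - q x) / 2))"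
    if "convergent_mean (\<lambda>x. w x * p x)" "convergent_mean (\<lambda>x. w x * q x)" for p q
    using convergent_mean_add[OF convergent_mean_scale[OF that(1), of "1/2"] convergent_mean_scale[OF that(2), of "1/2"]]
      convergent_mean_add[OF convergent_mean_scale[OF that(1), of "1/2"] convergent_mean_scale[OF that(2), of "-1/2"]]
    by (simp_all add: algebra_simps add_divide_distrib diff_divide_distrib)
  show ?thesis unfolding good_weight_def
  proof (intro allI conjI)
    fix u
    have "convergent_mean (\<lambda>x. (w x * cos (\<Sum>j<k. u j * x j)) * g (x j))"
    proof (rule convergent_mean_coord[OF cm(1) _ _ c g])
      fix t
      show "convergent_mean (\<lambda>x. w x * cos (\<Sum>j<k. u j * x j) * cos (t * x j))"
        unfolding mult.assoc cos_times_cos add by (intro half cm)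
      show "convergent_mean (\<lambda>x. w x * cos (\<Sum>j<k. u j * x j) * sin (t * x j))"
        unfolding mult.assoc cos_times_sin add by (intro half cm)
    qed
    then show "convergent_mean (\<lambda>x. w x * g (x j) * cos (\<Sum>j<k. u j * x j))"
      by (simp add: mult_ac)
    have "convergent_mean (\<lambda>x. (w x * sin (\<Sum>j<k. u j * x j)) * g (x j))"
    proof (rule convergent_mean_coord[OF cm(2) _ _ c g])
      fix t
      show "convergent_mean (\<lambda>x. w x * sin (\<Sum>j<k. u j * x j) * cos (t * x j))"
        unfolding mult.assoc sin_times_cos add by (intro half cm)
      show "convergent_mean (\<lambda>x. w x * sin (\<Sum>j<k. u j * x j) * sin (t * x j))"
        unfolding mult.assoc sin_times_sin add by (intro half cm)
    qed
    then show "convergent_mean (\<lambda>x. w x * g (x j) * sin (\<Sum>j<k. u j * x j))"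
      by (simp add: mult_ac)
  qed
qed

inductive coord_ring :: "((nat \<Rightarrow> real) \<Rightarrow> real) \<Rightarrow> bool" where
  const: "coord_ring (\<lambda>_. c)"
| coord: "j < k \<Longrightarrow> continuous_on UNIV g \<Longrightarrow> (\<And>y. \<bar>g y\<bar> \<le> B) \<Longrightarrow> coord_ring (\<lambda>x. g (x j))"
| add: "coord_ring F \<Longrightarrow> coord_ring G \<Longrightarrow> coord_ring (\<lambda>x. F x + G x)"
| mult: "coord_ring F \<Longrightarrow> coord_ring G \<Longrightarrow> coord_ring (\<lambda>x. F x * G x)"

text \<open>The weight is generalized in the induction because a product \<open>F G\<close> is treated by multiplying the
  weight by \<open>F\<close> first and by \<open>G\<close> afterwards.\<close>

lemma coord_ring_good:
  assumes one: "good_weight (\<lambda>_. 1)" and "coord_ring F"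
  shows "good_weight w \<Longrightarrow> good_weight (\<lambda>x. w x * F x)"
  using assms(2)
proof (induction F arbitrary: w)
  case (const c)
  then show ?case using good_weight_scale[of w c] by (simp add: mult.commute)
next
  case (coord j g B)
  then show ?case using good_weight_coord[OF one] by blast
next
  case (add F G)
  then show ?case using good_weight_add by (fastforce simp: distrib_left)
next
  case (mult F G)
  from mult.IH(2)[OF mult.IH(1)[OF mult.prems]] show ?case by (simp add: mult.assoc)
qed

lemma coord_ring_prod:
  fixes l :: nat
  shows "(\<And>j. j < l \<Longrightarrow> coord_ring (F j)) \<Longrightarrow> coord_ring (\<lambda>x. \<Prod>j<l. F j x)"
  by (induction l) (auto intro: coord_ring.intros)

lemma coord_ring_cont: "coord_ring F \<Longrightarrow> continuous_on UNIV F"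
proof (induction rule: coord_ring.induct)
  case (coord j g B)
  have "continuous_on UNIV (\<lambda>x::nat\<Rightarrow>real. g (x j))"
    by (rule continuous_on_compose2[OF coord(2) continuous_on_product_coordinates]) auto
  then show ?case .
qed (auto intro: continuous_intros)

lemma coord_ring_local: "coord_ring F \<Longrightarrow> F (\<lambda>j. if j < k then x j else 0) = F x"
  by (induction rule: coord_ring.induct) auto

text \<open>Levy's continuity theorem in \<open>k\<close> dimensions. On a large box, \<open>h\<close> is uniformly approximated by the
  ring of coordinate functions (Stone-Weierstrass). The cutoff \<open>cut\<close> is a product of functions of one
  coordinate and therefore belongs to the same ring: it confines the approximation to the box, and
  the convergence of its own means gives tightness.\<close>

lemma vector_levy_continuity:
  assumes cs: "\<And>u. (\<lambda>n. \<integral>x. cos (\<Sum>j<k. u j * x j) \<partial>Q n) \<longlonglongrightarrow> (\<integral>x. cos (\<Sum>j<k. u j * x j) \<partial>Q')"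
     "\<And>u. (\<lambda>n. \<integral>x. sin (\<Sum>j<k. u j * x j) \<partial>Q n) \<longlonglongrightarrow> (\<integral>x. sin (\<Sum>j<k. u j * x j) \<partial>Q')"
    and h: "continuous_on UNIV h" "\<And>x. \<bar>h x\<bar> \<le> (B::real)" "\<And>x. h (\<lambda>j. if j < k then x j else 0) = h x"
  shows "(\<lambda>n. \<integral>x. h x \<partial>Q n) \<longlonglongrightarrow> (\<integral>x. h x \<partial>Q')"
proof -
  have [measurable]: "(\<lambda>x::nat\<Rightarrow>real. x j) \<in> borel_measurable borel" for j
    by (intro borel_measurable_continuous_onI continuous_on_product_coordinates)
  have hm[measurable]: "h \<in> borel_measurable borel"
    using h(1) by (rule borel_measurable_continuous_onI)
  have B0: "0 \<le> B" using h(2)[of undefined] by linarith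
  have "\<bar>cos y\<bar> \<le> 1" "\<bar>sin y\<bar> \<le> 1" for y :: real by auto
  then have one: "good_weight (\<lambda>_. 1)"
    using cs unfolding good_weight_def convergent_mean_def by (auto intro!: exI[of _ 1])
  have cm: "convergent_mean F" if "coord_ring F" for F
    using good_weight_convergent[OF coord_ring_good[OF one that one]] by simp
  define \<phi> where "\<phi> L y = max 0 (min 1 (L + 1 - \<bar>y\<bar>))" for L y :: real
  define cut where "cut L x = (\<Prod>j<k. \<phi> L (x j))" for L and x :: "nat \<Rightarrow> real"
  have \<phi>: "0 \<le> \<phi> L y" "\<phi> L y \<le> 1" for L y by (auto simp: \<phi>_def)
  have cut01: "0 \<le> cut L x" "cut L x \<le> 1" for L x
    unfolding cut_def by (auto intro!: prod_nonneg prod_le_1 simp: \<phi>)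
  have cutR: "coord_ring (cut L)" for L
    unfolding cut_def
  proof (intro coord_ring_prod coord_ring.coord[where B=1])
    show "continuous_on UNIV (\<phi> L)" unfolding \<phi>_def by (intro continuous_intros)
  qed (use \<phi> in auto)
  have cutm[measurable]: "cut L \<in> borel_measurable borel" for L
    using cm[OF cutR] unfolding convergent_mean_def by auto
  have tight: "(\<lambda>l. \<integral>x. cut (real l) x \<partial>Q') \<longlonglongrightarrow> (\<integral>x. 1 \<partial>Q')"
  proof (rule integral_dominated_convergence[where w="\<lambda>_. 1"])
    show "AE x in Q'. (\<lambda>l. cut (real l) x) \<longlonglongrightarrow> 1"
    proof (rule AE_I2)
      fix x
      have "(\<lambda>l. cut (real l) x) \<longlonglongrightarrow> (\<Prod>j<k. 1)"
        unfolding cut_def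
      proof (rule tendsto_prod)
        fix j
        show "(\<lambda>l. \<phi> (real l) (x j)) \<longlonglongrightarrow> 1"
        proof (rule tendsto_eventually)
          show "\<forall>\<^sub>F l in sequentially. \<phi> (real l) (x j) = 1"
            using eventually_ge_at_top[of "nat \<lceil>\<bar>x j\<bar>\<rceil>"]
            by eventually_elim (auto simp: \<phi>_def)
        qed
      qed
      then show "(\<lambda>l. cut (real l) x) \<longlonglongrightarrow> 1" by simp
    qed
  qed (use cut01 in auto)
  show ?thesis
  proof (rule LIMSEQ_I)
    fix r :: real assume r: "0 < r"
    (* The errors collected below add up to 2 (B + 1) \<epsilon> + 2 \<epsilon> = r / 2. *)
    define \<epsilon> where "\<epsilon> = r / (4 * (B + 2))"
    have \<epsilon>: "\<epsilon> > 0" using r B0 by (simp add: \<epsilon>_def)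
    have "\<forall>\<^sub>F l in sequentially. (\<integral>x. cut (real l) x \<partial>Q') > 1 - \<epsilon>"
      using order_tendstoD(1)[OF tight, of "1 - \<epsilon>"] \<epsilon> by (simp add: Q'.prob_space)
    then obtain l where l: "(\<integral>x. cut (real l) x \<partial>Q') > 1 - \<epsilon>"
      by (auto simp: eventually_sequentially)
    let ?cut = "cut (real l)"
    define S where "S = PiE UNIV (\<lambda>j. if j < k then {- (real l + 1)..real l + 1} else {0})"
    have "compactin (product_topology (\<lambda>_::nat. euclidean) UNIV) S"
      unfolding S_def compactin_PiE by (auto simp: compactin_euclidean_iff)
    then have S: "compact S"
      by (simp add: euclidean_product_topology compactin_euclidean_iff)
    obtain F where F: "coord_ring F" "\<And>x. x \<in> S \<Longrightarrow> \<bar>h x - F x\<bar> < \<epsilon>"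
    proof -
      have "\<exists>F. coord_ring F \<and> (\<forall>x\<in>S. \<bar>h x - F x\<bar> < \<epsilon>)"
      proof (rule Stone_Weierstrass_HOL[OF S])
        fix x y assume xy: "x \<in> S \<and> y \<in> S \<and> x \<noteq> y"
        then obtain j where "x j \<noteq> y j" by blast
        moreover have "x j \<in> (if j < k then {- (real l + 1)..real l + 1} else {0})"
          "y j \<in> (if j < k then {- (real l + 1)..real l + 1} else {0})"
          using xy unfolding S_def by blast+
        ultimately have "j < k" by (cases "j < k") auto
        have ab: "\<bar>arctan z\<bar> \<le> pi / 2" for z
          using arctan_lbound[of z] arctan_ubound[of z] by linarith
        have "coord_ring (\<lambda>x. arctan (x j))"
          by (rule coord_ring.coord[OF \<open>j < k\<close> _ ab]) (intro continuous_intros)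
        moreover have "arctan (x j) \<noteq> arctan (y j)" using \<open>x j \<noteq> y j\<close> by (simp add: arctan_eq_iff)
        ultimately show "\<exists>F. coord_ring F \<and> F x \<noteq> F y" by blast
      next
        show "continuous_on S F" if "coord_ring F" for F
          by (rule continuous_on_subset[OF coord_ring_cont[OF that]]) simp
        show "continuous_on S h" by (rule continuous_on_subset[OF h(1)]) simp
      qed (auto intro: coord_ring.intros \<epsilon>)
      then show ?thesis using that by blast
    qed
    let ?f = "\<lambda>x. F x * ?cut x"
    let ?d = "\<lambda>x. (B + \<epsilon>) + (- B) * ?cut x"
    have f: "convergent_mean ?f" by (intro cm coord_ring.mult F cutR)
    have d: "convergent_mean ?d" by (intro convergent_mean_add convergent_mean_const convergent_mean_scale cm cutR)
    have dif: "\<bar>h x - ?f x\<bar> \<le> ?d x" for x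
    proof (cases "\<exists>j<k. real l + 1 < \<bar>x j\<bar>")
      case True
      then obtain j where j: "j < k" "real l + 1 < \<bar>x j\<bar>" by blast
      then have "\<phi> (real l) (x j) = 0" by (auto simp: \<phi>_def)
      then have "?cut x = 0" unfolding cut_def using j by (auto intro!: prod_zero)
      then show ?thesis using h(2)[of x] \<epsilon> by simp
    next
      case False
      define z where "z = (\<lambda>j. if j < k then x j else 0)"
      have "z j \<in> (if j < k then {- (real l + 1)..real l + 1} else {0})" for j
      proof (cases "j < k")
        case True
        with False have "\<bar>x j\<bar> \<le> real l + 1" by (meson not_less)
        then show ?thesis using True by (simp add: z_def abs_le_iff)
      qed (simp add: z_def)
      then have "z \<in> S" unfolding S_def by blast
      then have "\<bar>h x - F x\<bar> < \<epsilon>"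
        using F(2)[of z] h(3)[of x] coord_ring_local[OF F(1), of x] by (simp add: z_def)
      have "\<bar>h x - ?f x\<bar> = \<bar>h x * (1 - ?cut x) + (h x - F x) * ?cut x\<bar>" by (simp add: algebra_simps)
      also have "\<dots> \<le> \<bar>h x\<bar> * (1 - ?cut x) + \<bar>h x - F x\<bar> * ?cut x"
        using cut01[of "real l" x] by (intro order_trans[OF abs_triangle_ineq]) (simp add: abs_mult)
      also have "\<dots> \<le> B * (1 - ?cut x) + \<epsilon> * 1"
        using cut01[of "real l" x] h(2)[of x] \<open>\<bar>h x - F x\<bar> < \<epsilon>\<close> by (intro add_mono mult_mono) auto
      finally show ?thesis by (simp add: algebra_simps)
    qed
    have ih: "integrable (Q n) h" "integrable Q' h" for n
      using integrable_bdd[OF hm h(2)] by auto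
    note idif = convergent_mean_integrable[OF f] convergent_mean_integrable[OF d]
    have b: "\<bar>(\<integral>x. h x \<partial>Q n) - (\<integral>x. ?f x \<partial>Q n)\<bar> \<le> (\<integral>x. ?d x \<partial>Q n)" for n
    proof -
      have "\<bar>(\<integral>x. h x \<partial>Q n) - (\<integral>x. ?f x \<partial>Q n)\<bar> = \<bar>\<integral>x. h x - ?f x \<partial>Q n\<bar>"
        using ih idif by (subst Bochner_Integration.integral_diff) auto
      also have "\<dots> \<le> (\<integral>x. \<bar>h x - ?f x\<bar> \<partial>Q n)" by (rule integral_abs_bound)
      also have "\<dots> \<le> (\<integral>x. ?d x \<partial>Q n)"
        by (rule integral_mono) (use dif ih idif in \<open>auto intro!: Bochner_Integration.integrable_diff\<close>)
      finally show ?thesis .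
    qed
    have b': "\<bar>(\<integral>x. h x \<partial>Q') - (\<integral>x. ?f x \<partial>Q')\<bar> \<le> (\<integral>x. ?d x \<partial>Q')"
    proof -
      have "\<bar>(\<integral>x. h x \<partial>Q') - (\<integral>x. ?f x \<partial>Q')\<bar> = \<bar>\<integral>x. h x - ?f x \<partial>Q'\<bar>"
        using ih idif by (subst Bochner_Integration.integral_diff) auto
      also have "\<dots> \<le> (\<integral>x. \<bar>h x - ?f x\<bar> \<partial>Q')" by (rule integral_abs_bound)
      also have "\<dots> \<le> (\<integral>x. ?d x \<partial>Q')"
        by (rule integral_mono) (use dif ih idif in \<open>auto intro!: Bochner_Integration.integrable_diff\<close>)
      finally show ?thesis .
    qed
    have dQ': "(\<integral>x. ?d x \<partial>Q') \<le> (B + 1) * \<epsilon>"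
    proof -
      have "(\<integral>x. ?d x \<partial>Q') = (B + \<epsilon>) - B * (\<integral>x. ?cut x \<partial>Q')"
        using convergent_mean_integrable[OF cm[OF cutR]] by (simp add: Q'.prob_space)
      also have "\<dots> \<le> (B + \<epsilon>) - B * (1 - \<epsilon>)"
        using l B0 by (intro diff_left_mono mult_left_mono) auto
      finally show ?thesis by (simp add: algebra_simps)
    qed
    have e1: "\<forall>\<^sub>F n in sequentially. (\<integral>x. ?d x \<partial>Q n) < (B + 1) * \<epsilon> + \<epsilon>"
      using d dQ' \<epsilon> unfolding convergent_mean_def
      by (intro order_tendstoD(2)[of _ "\<integral>x. ?d x \<partial>Q'"]) (auto)
    have e2: "\<forall>\<^sub>F n in sequentially. \<bar>(\<integral>x. ?f x \<partial>Q n) - (\<integral>x. ?f x \<partial>Q')\<bar> < \<epsilon>"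
      using f \<epsilon> unfolding convergent_mean_def tendsto_iff dist_real_def by blast
    have "\<forall>\<^sub>F n in sequentially. norm ((\<integral>x. h x \<partial>Q n) - (\<integral>x. h x \<partial>Q')) < r"
      using e1 e2
    proof eventually_elim
      case (elim n)
      have "\<bar>(\<integral>x. h x \<partial>Q n) - (\<integral>x. h x \<partial>Q')\<bar> < 2 * (B + 1) * \<epsilon> + 2 * \<epsilon>"
        using elim b[of n] b' dQ' by (simp add: algebra_simps)
      also have "\<dots> = 2 * ((B + 2) * \<epsilon>)" by (simp add: algebra_simps)
      also have "(B + 2) * \<epsilon> = r / 4" unfolding \<epsilon>_def times_divide_eq_right mult.commute[of "B + 2" r]
        by (rule mult_divide_mult_cancel_right) (use B0 in simp)
      also have "2 * (r / 4) \<le> r" using r by simp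
      finally show ?case by simp
    qed
    then show "\<exists>N. \<forall>n\<ge>N. norm ((\<integral>x. h x \<partial>Q n) - (\<integral>x. h x \<partial>Q')) < r"
      by (simp add: eventually_sequentially)
  qed
qed

end

text \<open>The Cramer-Wold device. Vectors are embedded into sequences vanishing from index \<open>k\<close> on, where the
  product sigma-algebra is the Borel sigma-algebra.\<close>

lemma weak_conv_vecI:
  assumes "prob_space M" and Y: "\<And>n j. j < k \<Longrightarrow> Y n j \<in> borel_measurable M"
    and N: "prob_space N" "sets N = sets (Pi\<^sub>M {..<k} (\<lambda>_. borel :: real measure))"
    and cs: "\<And>u. (\<lambda>n. \<integral>\<omega>. cos (\<Sum>j<k. u j * Y n j \<omega>) \<partial>M) \<longlonglongrightarrow> (\<integral>x. cos (\<Sum>j<k. u j * x j) \<partial>N)"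
      "\<And>u. (\<lambda>n. \<integral>\<omega>. sin (\<Sum>j<k. u j * Y n j \<omega>) \<partial>M) \<longlonglongrightarrow> (\<integral>x. sin (\<Sum>j<k. u j * x j) \<partial>N)"
  shows "weak_conv_vec M k Y N"
  unfolding weak_conv_vec_def
proof (intro allI impI, elim conjE)
  fix g :: "(nat \<Rightarrow> real) \<Rightarrow> real"
  assume g: "continuous_on (PiE {..<k} (\<lambda>_. UNIV)) g" and bg: "bounded (g ` PiE {..<k} (\<lambda>_. UNIV))"
  interpret M: prob_space M by fact
  interpret N: prob_space N by fact
  define z where "z x = (\<lambda>j. if j < k then x j else 0)" for x :: "nat \<Rightarrow> real"
  have [measurable]: "z \<in> measurable N borel"
  proof (rule measurable_coordinatewise_then_product)
    fix i show "(\<lambda>x. z x i) \<in> borel_measurable N"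
    proof (cases "i < k")
      case True
      then have "(\<lambda>x. x i) \<in> borel_measurable (Pi\<^sub>M {..<k} (\<lambda>_. borel :: real measure))"
        by (intro measurable_component_singleton) auto
      then show ?thesis using True by (simp add: z_def measurable_cong_sets[OF N(2) refl])
    qed (simp add: z_def)
  qed
  have [measurable]: "(\<lambda>\<omega>. z (\<lambda>j. Y n j \<omega>)) \<in> measurable M borel" for n
  proof (rule measurable_coordinatewise_then_product)
    fix i show "(\<lambda>\<omega>. z (\<lambda>j. Y n j \<omega>) i) \<in> borel_measurable M"
      using Y by (cases "i < k") (auto simp: z_def)
  qed
  define h where "h x = g (\<lambda>j\<in>{..<k}. x j)" for x
  have h: "continuous_on UNIV h"
    unfolding h_def
  proof (rule continuous_on_compose2[OF g])
    show "continuous_on UNIV (\<lambda>x::nat\<Rightarrow>real. restrict x {..<k})"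
    proof (rule continuous_on_coordinatewise_then_product)
      fix i show "continuous_on UNIV (\<lambda>x::nat\<Rightarrow>real. restrict x {..<k} i)"
        using continuous_on_product_coordinates[of i] by (cases "i < k") simp_all
    qed
    show "(\<lambda>x. restrict x {..<k}) ` UNIV \<subseteq> PiE {..<k} (\<lambda>_. UNIV :: real set)"
      by (rule image_subsetI) (simp only: restrict_PiE_iff, simp)
  qed
  then have hm[measurable]: "h \<in> borel_measurable borel" by (rule borel_measurable_continuous_onI)
  from bg obtain B where B: "\<And>x. x \<in> PiE {..<k} (\<lambda>_. UNIV) \<Longrightarrow> \<bar>g x\<bar> \<le> B"
    by (auto simp: bounded_iff)
  have [measurable]: "(\<lambda>x::nat\<Rightarrow>real. x j) \<in> borel_measurable borel" for j
    by (intro borel_measurable_continuous_onI continuous_on_product_coordinates)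
  have hz: "h (z x) = h x" and zs: "(\<Sum>j<k. u j * z x j) = (\<Sum>j<k. u j * x j)" for x u
    by (auto simp: h_def z_def intro!: arg_cong[where f=g])
  let ?Q = "\<lambda>n. distr M borel (\<lambda>\<omega>. z (\<lambda>j. Y n j \<omega>))" and ?Q' = "distr N borel z"
  have "(\<lambda>n. \<integral>x. h x \<partial>?Q n) \<longlonglongrightarrow> (\<integral>x. h x \<partial>?Q')"
  proof (rule vector_levy_continuity[where k=k and B=B])
    show "h (\<lambda>j. if j < k then x j else 0) = h x" for x using hz[of x] by (simp add: z_def)
    show "\<bar>h x\<bar> \<le> B" for x unfolding h_def by (rule B) auto
  qed (auto simp: integral_distr zs cs h intro!: M.prob_space_distr N.prob_space_distr)
  then have "(\<lambda>n. \<integral>\<omega>. h (\<lambda>j. Y n j \<omega>) \<partial>M) \<longlonglongrightarrow> (\<integral>x. h x \<partial>N)"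
    by (simp add: integral_distr hz)
  moreover have "(\<integral>x. h x \<partial>N) = (\<integral>x. g x \<partial>N)"
  proof (rule Bochner_Integration.integral_cong[OF refl])
    fix x assume "x \<in> space N"
    then have "x \<in> PiE {..<k} (\<lambda>_. UNIV)" using sets_eq_imp_space_eq[OF N(2)] by (simp add: space_PiM)
    then show "h x = g x" by (simp add: h_def PiE_def extensional_restrict)
  qed
  ultimately show "(\<lambda>n. \<integral>\<omega>. g (\<lambda>j\<in>{..<k}. Y n j \<omega>) \<partial>M) \<longlonglongrightarrow> (\<integral>x. g x \<partial>N)"
    by (simp add: h_def)
qed

section \<open>Gaussian vectors\<close>

lemma real_distribution_normal_law: "real_distribution (normal_law 0 w)"
proof -
  have "prob_space (normal_law 0 w)"
    by (auto simp: normal_law_def intro!: prob_space_normal_density prob_space_return)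
  then show ?thesis
    unfolding real_distribution_def real_distribution_axioms_def by (simp add: normal_law_def)
qed

lemma normal_law_eq_distr:
  assumes "0 \<le> w"
  shows "normal_law 0 w = distr std_normal_distribution borel (\<lambda>x. sqrt w * x)"
proof (cases "w = 0")
  case True
  have "prob_space std_normal_distribution" by (rule prob_space_normal_density) simp
  then have "distr std_normal_distribution borel (\<lambda>x. 0::real) = return borel 0"
    by (rule prob_space.distr_const) simp
  then show ?thesis using True by (simp add: normal_law_def)
next
  case False
  interpret prob_space std_normal_distribution by (rule prob_space_normal_density) simp
  have "distributed std_normal_distribution lborel (\<lambda>x. x) (\<lambda>x. ennreal (std_normal_density x))"
    unfolding distributed_def by (simp add: distr_id2)
  from normal_density_affine[OF this, of "sqrt w" 0] False assms
  have "distributed std_normal_distribution lborel (\<lambda>x. sqrt w * x) (\<lambda>x. ennreal (normal_density 0 (sqrt w) x))"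
    by simp
  from distributed_distr_eq_density[OF this]
  have "density lborel (\<lambda>x. ennreal (normal_density 0 (sqrt w) x)) = distr std_normal_distribution lborel (\<lambda>x. sqrt w * x)"
    by simp
  also have "\<dots> = distr std_normal_distribution borel (\<lambda>x. sqrt w * x)"
    by (rule distr_cong) simp_all
  finally show ?thesis using False assms by (simp add: normal_law_def)
qed

lemma char_normal_law:
  assumes "0 \<le> w"
  shows "char (normal_law 0 w) t = complex_of_real (exp (- (w * t\<^sup>2) / 2))"
proof -
  have "char (normal_law 0 w) t = char std_normal_distribution (sqrt w * t)"
    unfolding normal_law_eq_distr[OF assms] char_def by (simp add: integral_distr mult_ac)
  then show ?thesis using assms by (simp add: char_std_normal_distribution power_mult_distrib)
qed

text \<open>Cholesky factorization, one Schur complement at a time. Division by a vanishing pivot yields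
  \<open>0\<close>, which is the right value because positivity then forces the whole column to vanish.\<close>

lemma psd_factorization:
  fixes c :: "nat \<Rightarrow> nat \<Rightarrow> real"
  assumes "\<And>j l. c j l = c l j" and "\<And>u. 0 \<le> (\<Sum>j<k. \<Sum>l<k. u j * u l * c j l)"
  shows "\<exists>A. \<forall>j<k. \<forall>l<k. c j l = (\<Sum>i<k. A j i * A l i)"
  using assms
proof (induction k arbitrary: c)
  case (Suc k)
  note sym = Suc.prems(1)
  have expand: "(\<Sum>j<Suc k. \<Sum>l<Suc k. u j * u l * c j l) =
      (\<Sum>j<k. \<Sum>l<k. u j * u l * c j l) + 2 * u k * (\<Sum>j<k. u j * c j k) + (u k)\<^sup>2 * c k k" for u
  proof -
    have "(\<Sum>l<k. u k * u l * c k l) = u k * (\<Sum>j<k. u j * c j k)"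
      unfolding sum_distrib_left by (intro sum.cong refl, subst sym[of k], simp add: mult_ac)
    moreover have "(\<Sum>j<k. u j * u k * c j k) = u k * (\<Sum>j<k. u j * c j k)"
      unfolding sum_distrib_left by (intro sum.cong refl) (simp add: mult_ac)
    ultimately show ?thesis by (simp add: sum.distrib power2_eq_square)
  qed
  have ckk: "0 \<le> c k k"
    using Suc.prems(2)[of "\<lambda>i. if i = k then 1 else 0"] unfolding expand by simp
  have col: "c j k = 0" if "c k k = 0" "j < k" for j
  proof (rule ccontr)
    assume nz: "c j k \<noteq> 0"
    (* With this s the form would take the value c j j + 2 s (c j k) = -1. *)
    define s where "s = - (c j j + 1) / (2 * c j k)"
    have q: "0 \<le> c j j + 2 * s * c j k" for s
    proof -
      let ?u = "\<lambda>i. if i = j then 1 else if i = k then s else 0"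
      have u: "?u i = (if i = j then 1 else 0)" if "i < k" for i using that by auto
      have "(\<Sum>i<k. \<Sum>l<k. ?u i * ?u l * c i l) = (\<Sum>i<k. \<Sum>l<k. if i = j then if l = j then c i l else 0 else 0)"
        by (intro sum.cong refl) (simp only: u lessThan_iff, simp)
      also have "\<dots> = (\<Sum>i<k. if i = j then \<Sum>l<k. if l = j then c i l else 0 else 0)"
        by (intro sum.cong refl) simp
      also have "\<dots> = c j j" using that(2) by (simp only: sum.delta' sum.delta finite_lessThan lessThan_iff, simp)
      finally have 1: "(\<Sum>i<k. \<Sum>l<k. ?u i * ?u l * c i l) = c j j" .
      have "(\<Sum>i<k. ?u i * c i k) = (\<Sum>i<k. if i = j then c i k else 0)"
        by (intro sum.cong refl) (simp only: u lessThan_iff, simp)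
      also have "\<dots> = c j k" using that(2) by (simp only: sum.delta' sum.delta finite_lessThan lessThan_iff, simp)
      finally have 2: "(\<Sum>i<k. ?u i * c i k) = c j k" .
      have jk: "?u k = s" using that(2) by simp
      have "0 \<le> c j j + 2 * ?u k * c j k + (?u k)\<^sup>2 * c k k"
        using Suc.prems(2)[of ?u] unfolding expand 1 2 .
      then show ?thesis unfolding jk that(1) by simp
    qed
    have "2 * s * c j k = - (c j j + 1)" using nz by (simp add: s_def)
    then show False using q[of s] by linarith
  qed
  define d where "d j l = c j l - c j k * c l k / c k k" for j l
  have "\<exists>A. \<forall>j<k. \<forall>l<k. d j l = (\<Sum>i<k. A j i * A l i)"
  proof (rule Suc.IH)
    show "d j l = d l j" for j l by (simp add: d_def sym mult.commute)
    fix u :: "nat \<Rightarrow> real"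
    let ?b = "\<Sum>j<k. u j * c j k"
    let ?u = "\<lambda>j. if j = k then - ?b / c k k else u j"
    have "(\<Sum>j<k. \<Sum>l<k. u j * u l * d j l) =
        (\<Sum>j<k. \<Sum>l<k. u j * u l * c j l) - (\<Sum>j<k. \<Sum>l<k. (u j * c j k) * (u l * c l k)) / c k k"
      by (simp add: d_def algebra_simps sum_subtractf sum_divide_distrib)
    also have "(\<Sum>j<k. \<Sum>l<k. (u j * c j k) * (u l * c l k)) = ?b\<^sup>2"
      by (simp add: power2_eq_square sum_product)
    also have "(\<Sum>j<k. \<Sum>l<k. u j * u l * c j l) - ?b\<^sup>2 / c k k =
        (\<Sum>j<Suc k. \<Sum>l<Suc k. ?u j * ?u l * c j l)"
      unfolding expand by (simp add: power2_eq_square)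
    finally have eq: "(\<Sum>j<k. \<Sum>l<k. u j * u l * d j l) = (\<Sum>j<Suc k. \<Sum>l<Suc k. ?u j * ?u l * c j l)" .
    show "0 \<le> (\<Sum>j<k. \<Sum>l<k. u j * u l * d j l)" unfolding eq by (rule Suc.prems(2))
  qed
  then obtain A where A: "\<And>j l. j < k \<Longrightarrow> l < k \<Longrightarrow> d j l = (\<Sum>i<k. A j i * A l i)" by blast
  define A' where "A' j i = (if j = k then if i = k then sqrt (c k k) else 0
      else if i = k then c j k / sqrt (c k k) else A j i)" for j i
  have "c j l = (\<Sum>i<Suc k. A' j i * A' l i)" if jl: "j < Suc k" "l < Suc k" for j l
  proof -
    consider "j < k" "l < k" | "j = k" "l < k" | "j < k" "l = k" | "j = k" "l = k"
      using jl by (metis less_Suc_eq)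
    then show ?thesis
    proof cases
      case 1
      have "c j l = d j l + c j k / sqrt (c k k) * (c l k / sqrt (c k k))"
        using ckk by (simp add: d_def)
      then show ?thesis using 1 A[OF 1] by (simp add: A'_def)
    next
      case 2
      then have "c j l = c l k" by (simp add: sym[of k l])
      also have "\<dots> = sqrt (c k k) * (c l k / sqrt (c k k))"
        using ckk col[of l] 2 by (cases "c k k = 0") auto
      finally show ?thesis using 2 by (simp add: A'_def)
    next
      case 3
      then have "c j l = sqrt (c k k) * (c j k / sqrt (c k k))"
        using ckk col[of j] by (cases "c k k = 0") auto
      then show ?thesis using 3 by (simp add: A'_def mult.commute)
    next
      case 4
      then show ?thesis using ckk by (simp add: A'_def)
    qed
  qed
  then show ?case by blast
qed simp

text \<open>The image of independent standard normal variables under a factor of the covariance matrix;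
  its linear functionals are identified by their characteristic functions, which treats
  singular covariances on a par with regular ones.\<close>

lemma exists_multivariate_normal:
  fixes c :: "nat \<Rightarrow> nat \<Rightarrow> real"
  assumes "\<And>j l. c j l = c l j" and psd: "\<And>u. 0 \<le> (\<Sum>j<k. \<Sum>l<k. u j * u l * c j l)"
  shows "\<exists>N. multivariate_normal k (\<lambda>_. 0) c N"
proof -
  obtain A where A: "\<And>j l. j < k \<Longrightarrow> l < k \<Longrightarrow> c j l = (\<Sum>i<k. A j i * A l i)"
    using psd_factorization[OF assms] by blast
  interpret std: real_distribution std_normal_distribution by (rule real_dist_normal_dist)
  let ?P = "Pi\<^sub>M {..<k} (\<lambda>_::nat. std_normal_distribution)"
  let ?B = "Pi\<^sub>M {..<k} (\<lambda>_. borel :: real measure)"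
  interpret P': prob_space ?P by (rule prob_space_PiM) unfold_locales
  define L where "L z = (\<lambda>j\<in>{..<k}. \<Sum>i<k. A j i * z i)" for z :: "nat \<Rightarrow> real"
  have [measurable]: "(\<lambda>z. z i) \<in> borel_measurable ?P" if "i < k" for i
  proof -
    have "(\<lambda>z. z i) \<in> measurable ?P std_normal_distribution"
      using that by (intro measurable_component_singleton) simp
    also have "measurable ?P std_normal_distribution = borel_measurable ?P"
      by (rule measurable_cong_sets) simp_all
    finally show ?thesis .
  qed
  have [measurable]: "L \<in> measurable ?P ?B"
    unfolding L_def by (intro measurable_restrict borel_measurable_sum borel_measurable_times) auto
  have indep: "P'.indep_vars (\<lambda>_. borel) (\<lambda>i z. b i * z i) {..<k}" for b
  proof -
    have "P'.indep_vars (\<lambda>_. std_normal_distribution) (\<lambda>i z. z i) {..<k}"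
    proof (cases "{..<k} = {}")
      case True
      then show ?thesis unfolding P'.indep_vars_def P'.indep_sets_def by simp
    next
      case False
      show ?thesis
      proof (subst P'.indep_vars_iff_distr_eq_PiM'[OF False])
        show "distr ?P ?P (\<lambda>x. \<lambda>i\<in>{..<k}. x i) = Pi\<^sub>M {..<k} (\<lambda>i. distr ?P std_normal_distribution (\<lambda>x. x i))"
        proof -
          have "distr ?P ?P (\<lambda>x. \<lambda>i\<in>{..<k}. x i) = distr ?P ?P (\<lambda>x. x)"
            by (rule distr_cong) (auto simp: space_PiM PiE_def extensional_restrict)
          moreover have "Pi\<^sub>M {..<k} (\<lambda>i. distr ?P std_normal_distribution (\<lambda>x. x i)) = ?P"
            by (intro PiM_cong refl distr_PiM_component std.prob_space_axioms) simp_all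
          ultimately show ?thesis by (simp add: distr_id2)
        qed
      next
        show "(\<lambda>z. z i) \<in> measurable ?P std_normal_distribution" if "i \<in> {..<k}" for i
          using that by (rule measurable_component_singleton)
      qed
    qed
    then show ?thesis
      by (rule P'.indep_vars_compose2[where Y="\<lambda>i x. b i * x"]) simp
  qed
  have lin: "distr (distr ?P ?B L) borel (\<lambda>x. \<Sum>j<k. u j * x j) =
      normal_law (\<Sum>j<k. u j * 0) (\<Sum>j<k. \<Sum>l<k. u j * u l * c j l)" for u
  proof -
    define b where "b i = (\<Sum>j<k. u j * A j i)" for i
    define w where "w = (\<Sum>j<k. \<Sum>l<k. u j * u l * c j l)"
    have w: "w = (\<Sum>i<k. (b i)\<^sup>2)"
    proof -
      have "w = (\<Sum>j<k. \<Sum>l<k. \<Sum>i<k. (u j * A j i) * (u l * A l i))"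
        unfolding w_def by (intro sum.cong refl) (simp add: A sum_distrib_left algebra_simps)
      also have "\<dots> = (\<Sum>j<k. \<Sum>i<k. \<Sum>l<k. (u j * A j i) * (u l * A l i))"
        by (intro sum.cong refl sum.swap)
      also have "\<dots> = (\<Sum>i<k. \<Sum>j<k. \<Sum>l<k. (u j * A j i) * (u l * A l i))"
        by (rule sum.swap)
      finally show ?thesis by (simp add: b_def power2_eq_square sum_product)
    qed
    have "distr (distr ?P ?B L) borel (\<lambda>x. \<Sum>j<k. u j * x j) = distr ?P borel (\<lambda>z. \<Sum>i<k. b i * z i)"
    proof (subst distr_distr)
      have "(\<Sum>j<k. u j * L z j) = (\<Sum>i<k. b i * z i)" for z
      proof -
        have "(\<Sum>j<k. u j * L z j) = (\<Sum>j<k. \<Sum>i<k. u j * A j i * z i)"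
          by (simp add: L_def sum_distrib_left mult.assoc)
        also have "\<dots> = (\<Sum>i<k. b i * z i)"
          by (subst sum.swap) (simp add: b_def sum_distrib_right)
        finally show ?thesis .
      qed
      then show "distr ?P borel ((\<lambda>x. \<Sum>j<k. u j * x j) \<circ> L) = distr ?P borel (\<lambda>z. \<Sum>i<k. b i * z i)"
        by (simp add: comp_def)
    next
      show "(\<lambda>x. \<Sum>j<k. u j * x j) \<in> borel_measurable ?B"
        by (intro borel_measurable_sum borel_measurable_times borel_measurable_const measurable_component_singleton)
      show "L \<in> measurable ?P ?B" by measurable
    qed
    also have "\<dots> = normal_law 0 w"
    proof (rule Levy_uniqueness)
      show "real_distribution (distr ?P borel (\<lambda>z. \<Sum>i<k. b i * z i))"
        by (intro P'.real_distribution_distr borel_measurable_sum borel_measurable_times) auto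
      show "char (distr ?P borel (\<lambda>z. \<Sum>i<k. b i * z i)) = char (normal_law 0 w)"
      proof
        fix t
        have "char (distr ?P borel (\<lambda>z. \<Sum>i<k. b i * z i)) t = (\<Prod>i<k. char (distr ?P borel (\<lambda>z. b i * z i)) t)"
          by (rule P'.char_distr_sum[OF indep])
        also have "\<dots> = (\<Prod>i<k. complex_of_real (exp (- ((b i * t)\<^sup>2) / 2)))"
        proof (rule prod.cong[OF refl])
          fix i assume i: "i \<in> {..<k}"
          have "char (distr ?P borel (\<lambda>z. b i * z i)) t = (\<integral>z. iexp (t * (b i * z i)) \<partial>?P)"
            using i unfolding char_def by (subst integral_distr) auto
          also have "\<dots> = (\<integral>y. iexp (t * (b i * y)) \<partial>distr ?P std_normal_distribution (\<lambda>z. z i))"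
            using i by (subst integral_distr) auto
          also have "distr ?P std_normal_distribution (\<lambda>z. z i) = std_normal_distribution"
            using i by (intro distr_PiM_component std.prob_space_axioms) simp_all
          also have "(\<integral>y. iexp (t * (b i * y)) \<partial>std_normal_distribution) = char std_normal_distribution (b i * t)"
            unfolding char_def by (simp add: mult_ac)
          finally show "char (distr ?P borel (\<lambda>z. b i * z i)) t = complex_of_real (exp (- ((b i * t)\<^sup>2) / 2))"
            by (simp add: char_std_normal_distribution)
        qed
        also have "\<dots> = complex_of_real (exp (\<Sum>i<k. - ((b i * t)\<^sup>2) / 2))"
          by (simp add: exp_sum)
        also have "(\<Sum>i<k. - ((b i * t)\<^sup>2) / 2) = - (w * t\<^sup>2) / 2"
          by (simp add: w power_mult_distrib sum_distrib_right sum_negf sum_divide_distrib)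
        also have "complex_of_real (exp (- (w * t\<^sup>2) / 2)) = char (normal_law 0 w) t"
          using w by (subst char_normal_law) (auto intro!: sum_nonneg)
        finally show "char (distr ?P borel (\<lambda>z. \<Sum>i<k. b i * z i)) t = char (normal_law 0 w) t" .
      qed
    qed (rule real_distribution_normal_law)
    finally show ?thesis by (simp add: w_def)
  qed
  have ps: "prob_space (distr ?P ?B L)" by (rule P'.prob_space_distr) measurable
  show ?thesis
    unfolding multivariate_normal_def
  proof (intro exI conjI allI)
    show "prob_space (distr ?P ?B L)" by (rule ps)
    show "sets (distr ?P ?B L) = sets ?B" by (rule sets_distr)
  qed (rule lin)
qed

section \<open>Central limit theorem for processes\<close>

text \<open>For \<open>w = 0\<close> the summands vanish almost surely and the limit law is the point mass at \<open>0\<close>; otherwise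
  this is the central limit theorem after rescaling by \<open>\<surd>w\<close>.\<close>

lemma iid_clt_bounded:
  fixes X :: "nat \<Rightarrow> 'a \<Rightarrow> real" and g :: "real \<Rightarrow> real"
  assumes "prob_space M"
    and ind: "prob_space.indep_vars M (\<lambda>_. borel) X UNIV"
    and id: "\<And>i. distr M borel (X i) = distr M borel (X 0)"
    and mean: "has_bochner_integral M (X 0) 0"
    and var: "has_bochner_integral M (\<lambda>\<omega>. (X 0 \<omega>)\<^sup>2) w"
    and g: "continuous_on UNIV g" "\<And>x. \<bar>g x\<bar> \<le> B"
  shows "(\<lambda>n. \<integral>\<omega>. g ((\<Sum>i<n. X i \<omega>) / sqrt (real n)) \<partial>M) \<longlonglongrightarrow> (\<integral>x. g x \<partial>normal_law 0 w)"
proof -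
  interpret prob_space M by fact
  have gm[measurable]: "g \<in> borel_measurable borel"
    using g(1) by (rule borel_measurable_continuous_onI)
  have Xm[measurable]: "X i \<in> borel_measurable M" for i
    using ind unfolding indep_vars_def2 by simp
  have transfer: "has_bochner_integral M (\<lambda>\<omega>. f (X i \<omega>)) c"
    if [measurable]: "f \<in> borel_measurable borel" and "has_bochner_integral M (\<lambda>\<omega>. f (X 0 \<omega>)) c"
    for i c and f :: "real \<Rightarrow> real"
  proof -
    have "has_bochner_integral (distr M borel (X 0)) f c"
      using that by (simp add: has_bochner_integral_iff integrable_distr_eq integral_distr)
    then have "has_bochner_integral (distr M borel (X i)) f c" by (simp only: id[of i])
    then show ?thesis
      by (simp add: has_bochner_integral_iff integrable_distr_eq integral_distr)
  qed
  have mean': "has_bochner_integral M (X i) 0" for i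
    using transfer[of "\<lambda>x. x" 0 i] mean by simp
  have var': "has_bochner_integral M (\<lambda>\<omega>. (X i \<omega>)\<^sup>2) w" for i
    by (rule transfer[of "\<lambda>x. x\<^sup>2", OF _ var]) simp
  have w0: "0 \<le> w"
    using var by (auto simp: has_bochner_integral_iff)
  show ?thesis
  proof (cases "w = 0")
    case True
    have "AE \<omega> in M. X i \<omega> = 0" for i
    proof -
      have "AE \<omega> in M. (X i \<omega>)\<^sup>2 = 0"
        using var'[of i] True by (subst integral_nonneg_eq_0_iff_AE[symmetric]) (auto simp: has_bochner_integral_iff)
      then show ?thesis by eventually_elim simp
    qed
    then have "AE \<omega> in M. \<forall>i. X i \<omega> = 0" by (simp add: AE_all_countable)
    then have "(\<integral>\<omega>. g ((\<Sum>i<n. X i \<omega>) / sqrt (real n)) \<partial>M) = (\<integral>\<omega>. g 0 \<partial>M)" for n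
      by (intro integral_cong_AE) auto
    moreover have "(\<integral>x. g x \<partial>normal_law 0 w) = g 0"
      using True by (simp add: normal_law_def integral_return)
    ultimately show ?thesis by (simp add: prob_space)
  next
    case False
    with w0 have w: "0 < w" by simp
    have "weak_conv_m (\<lambda>n. distr M borel (\<lambda>x. (\<Sum>i<n. X i x) / sqrt (n * (sqrt w)\<^sup>2))) std_normal_distribution"
      by (rule central_limit_theorem_zero_mean[where \<mu>="distr M borel (X 0)"])
        (use ind mean' var' w id in \<open>auto simp: has_bochner_integral_iff\<close>)
    then have "(\<lambda>n. \<integral>x. g (sqrt w * x) \<partial>distr M borel (\<lambda>x. (\<Sum>i<n. X i x) / sqrt (n * (sqrt w)\<^sup>2)))
        \<longlonglongrightarrow> (\<integral>x. g (sqrt w * x) \<partial>std_normal_distribution)"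
    proof (rule weak_conv_imp_integral_bdd_continuous_conv[rotated 2])
      have "continuous_on UNIV (\<lambda>x. g (sqrt w * x))"
        by (rule continuous_on_compose2[OF g(1)]) (auto intro!: continuous_on_mult continuous_on_const continuous_on_id)
      then show "isCont (\<lambda>x. g (sqrt w * x)) x" for x by (simp add: continuous_on_eq_continuous_at)
      show "norm (g (sqrt w * x)) \<le> B" for x using g(2) by simp
      show "real_distribution std_normal_distribution" by (rule real_dist_normal_dist)
      show "real_distribution (distr M borel (\<lambda>x. (\<Sum>i<n. X i x) / sqrt (n * (sqrt w)\<^sup>2)))" for n
        by (rule real_distribution_distr) measurable
    qed
    moreover have "(\<integral>x. g (sqrt w * x) \<partial>distr M borel (\<lambda>x. (\<Sum>i<n. X i x) / sqrt (n * (sqrt w)\<^sup>2)))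
        = (\<integral>\<omega>. g ((\<Sum>i<n. X i \<omega>) / sqrt (real n)) \<partial>M)" for n
      using w by (subst integral_distr) (simp_all add: real_sqrt_mult mult.commute)
    moreover have "(\<integral>x. g (sqrt w * x) \<partial>std_normal_distribution) = (\<integral>x. g x \<partial>normal_law 0 w)"
      unfolding normal_law_eq_distr[OF w0] by (subst integral_distr) simp_all
    ultimately show ?thesis by simp
  qed
qed

lemma slutsky_lipschitz:
  fixes Y Z :: "nat \<Rightarrow> 'a \<Rightarrow> real" and g :: "real \<Rightarrow> real"
  assumes "prob_space M" and [measurable]: "\<And>n. Y n \<in> borel_measurable M" "\<And>n. Z n \<in> borel_measurable M"
    and close: "\<And>\<epsilon>. \<epsilon> > 0 \<Longrightarrow> (\<lambda>n. measure M {\<omega>\<in>space M. \<bar>Y n \<omega> - Z n \<omega>\<bar> > \<epsilon>}) \<longlonglongrightarrow> 0"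
    and g: "\<And>x y. \<bar>g x - g y\<bar> \<le> \<bar>x - y\<bar>" "\<And>x. \<bar>g x\<bar> \<le> 1"
    and lim: "(\<lambda>n. \<integral>\<omega>. g (Z n \<omega>) \<partial>M) \<longlonglongrightarrow> l"
  shows "(\<lambda>n. \<integral>\<omega>. g (Y n \<omega>) \<partial>M) \<longlonglongrightarrow> l"
proof -
  interpret prob_space M by fact
  have "continuous_on UNIV g"
  proof (rule continuous_onI)
    fix x e :: real assume "0 < e"
    moreover have "\<bar>g y - g x\<bar> \<le> e" if "\<bar>y - x\<bar> < e" for y
      using g(1)[of y x] that by linarith
    ultimately show "\<exists>d>0. \<forall>y\<in>UNIV. dist y x < d \<longrightarrow> dist (g y) (g x) \<le> e"
      by (auto simp: dist_real_def)
  qed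
  then have [measurable]: "g \<in> borel_measurable borel" by (rule borel_measurable_continuous_onI)
  have int: "integrable M (\<lambda>\<omega>. g (V \<omega>))" if [measurable]: "V \<in> borel_measurable M" for V
    by (rule integrable_const_bound[where B=1]) (use g(2) in auto)
  have "(\<lambda>n. (\<integral>\<omega>. g (Y n \<omega>) \<partial>M) - (\<integral>\<omega>. g (Z n \<omega>) \<partial>M)) \<longlonglongrightarrow> 0"
  proof (rule LIMSEQ_I)
    fix r :: real assume r: "0 < r"
    define A where "A n = {\<omega>\<in>space M. \<bar>Y n \<omega> - Z n \<omega>\<bar> > r / 2}" for n
    have [measurable]: "A n \<in> sets M" for n unfolding A_def by measurable
    have "\<forall>\<^sub>F n in sequentially. prob (A n) < r / 4"
      using order_tendstoD(2)[OF close[of "r/2"], of "r/4"] r by (simp add: A_def)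
    moreover have "\<bar>(\<integral>\<omega>. g (Y n \<omega>) \<partial>M) - (\<integral>\<omega>. g (Z n \<omega>) \<partial>M)\<bar> \<le> r / 2 + 2 * prob (A n)" for n
    proof -
      have iA: "integrable M (\<lambda>\<omega>. r / 2 + 2 * indicator (A n) \<omega>)"
        by (intro Bochner_Integration.integrable_add integrable_const integrable_mult_right)
          (simp add: integrable_real_indicator emeasure_eq_measure)
      have "\<bar>(\<integral>\<omega>. g (Y n \<omega>) \<partial>M) - (\<integral>\<omega>. g (Z n \<omega>) \<partial>M)\<bar> = \<bar>\<integral>\<omega>. g (Y n \<omega>) - g (Z n \<omega>) \<partial>M\<bar>"
        by (subst Bochner_Integration.integral_diff) (simp_all add: int)
      also have "\<dots> \<le> (\<integral>\<omega>. \<bar>g (Y n \<omega>) - g (Z n \<omega>)\<bar> \<partial>M)" by (rule integral_abs_bound)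
      also have "\<dots> \<le> (\<integral>\<omega>. r / 2 + 2 * indicator (A n) \<omega> \<partial>M)"
      proof (rule integral_mono)
        fix \<omega> assume "\<omega> \<in> space M"
        show "\<bar>g (Y n \<omega>) - g (Z n \<omega>)\<bar> \<le> r / 2 + 2 * indicator (A n) \<omega>"
        proof (cases "\<omega> \<in> A n")
          case True
          have "\<bar>g (Y n \<omega>) - g (Z n \<omega>)\<bar> \<le> \<bar>g (Y n \<omega>)\<bar> + \<bar>g (Z n \<omega>)\<bar>" by (rule abs_triangle_ineq4)
          then show ?thesis using True g(2)[of "Y n \<omega>"] g(2)[of "Z n \<omega>"] r by simp
        next
          case False
          then have "\<bar>Y n \<omega> - Z n \<omega>\<bar> \<le> r / 2" using \<open>\<omega> \<in> space M\<close> by (simp add: A_def not_less)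
          then show ?thesis using False g(1)[of "Y n \<omega>" "Z n \<omega>"] by simp
        qed
      qed (intro iA Bochner_Integration.integrable_diff integrable_abs int; measurable)+
      also have "\<dots> = r / 2 + 2 * prob (A n)"
        by (subst Bochner_Integration.integral_add) (simp_all add: prob_space emeasure_eq_measure)
      finally show ?thesis .
    qed
    moreover from this have "\<bar>(\<integral>\<omega>. g (Y n \<omega>) \<partial>M) - (\<integral>\<omega>. g (Z n \<omega>) \<partial>M)\<bar> < r" if "prob (A n) < r / 4" for n
      by (rule le_less_trans) (use that in linarith)
    ultimately have "\<forall>\<^sub>F n in sequentially. norm ((\<integral>\<omega>. g (Y n \<omega>) \<partial>M) - (\<integral>\<omega>. g (Z n \<omega>) \<partial>M) - 0) < r"
      by (auto elim!: eventually_mono)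
    then show "\<exists>N. \<forall>n\<ge>N. norm ((\<integral>\<omega>. g (Y n \<omega>) \<partial>M) - (\<integral>\<omega>. g (Z n \<omega>) \<partial>M) - 0) < r"
      by (simp add: eventually_sequentially)
  qed
  from tendsto_add[OF this lim] show ?thesis by simp
qed

text \<open>Every linear combination of finitely many coordinates is a normalized sum of i.i.d. variables up to a
  term that vanishes in probability. Cosine and sine are bounded Lipschitz functions, so this
  determines the limits of the characteristic functions.\<close>

lemma AGP_iid_approx:
  fixes W :: "nat \<Rightarrow> 'a \<Rightarrow> 'b" and F :: "'i \<Rightarrow> 'b \<Rightarrow> real"
  assumes "prob_space M"
    and ind: "prob_space.indep_vars M (\<lambda>_. P) W UNIV"
    and id: "\<And>i. distr M P (W i) = distr M P (W 0)"
    and Fm: "\<And>s. s \<in> S \<Longrightarrow> F s \<in> borel_measurable P"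
    and mean: "\<And>s. s \<in> S \<Longrightarrow> has_bochner_integral M (\<lambda>\<omega>. F s (W 0 \<omega>)) 0"
    and cov: "\<And>s t. s \<in> S \<Longrightarrow> t \<in> S \<Longrightarrow> has_bochner_integral M (\<lambda>\<omega>. F s (W 0 \<omega>) * F t (W 0 \<omega>)) (c s t)"
    and Xm: "\<And>n s. s \<in> S \<Longrightarrow> X n s \<in> borel_measurable M"
    and approx: "\<And>s \<epsilon>. s \<in> S \<Longrightarrow> \<epsilon> > 0 \<Longrightarrow>
      (\<lambda>n. measure M {\<omega>\<in>space M. \<bar>X n s \<omega> - (\<Sum>i<n. F s (W i \<omega>)) / sqrt (real n)\<bar> > \<epsilon>}) \<longlonglongrightarrow> 0"
  shows "AGP M S X (\<lambda>_. 0) c"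
  unfolding AGP_def
proof (intro allI ballI)
  interpret prob_space M by fact
  fix k :: nat and \<tau> assume \<tau>: "\<tau> \<in> {..<k} \<rightarrow> S"
  have \<tau>S: "\<tau> j \<in> S" if "j < k" for j using \<tau> that by auto
  have Wm[measurable]: "W i \<in> measurable M P" for i using ind unfolding indep_vars_def2 by simp
  have FW[measurable]: "(\<lambda>\<omega>. F s (W i \<omega>)) \<in> borel_measurable M" if "s \<in> S" for s i
    by (rule measurable_compose[OF Wm Fm[OF that]])
  define c' where "c' j l = (\<integral>\<omega>. F (\<tau> j) (W 0 \<omega>) * F (\<tau> l) (W 0 \<omega>) \<partial>M)" for j l
  have c': "c' j l = c (\<tau> j) (\<tau> l)" if "j < k" "l < k" for j l
    using cov[OF \<tau>S \<tau>S, OF that] by (simp add: c'_def has_bochner_integral_iff)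
  define \<xi> where "\<xi> u i \<omega> = (\<Sum>j<k. u j * F (\<tau> j) (W i \<omega>))" for u i \<omega>
  define wu where "wu u = (\<Sum>j<k. \<Sum>l<k. u j * u l * c' j l)" for u
  have \<xi>m[measurable]: "\<xi> u i \<in> borel_measurable M" for u i
    unfolding \<xi>_def by (intro borel_measurable_sum borel_measurable_times borel_measurable_const FW) (use \<tau>S in simp)
  have \<xi>0: "has_bochner_integral M (\<xi> u 0) 0" for u
  proof -
    have "has_bochner_integral M (\<xi> u 0) (\<Sum>j<k. u j * 0)"
      unfolding \<xi>_def by (intro has_bochner_integral_sum has_bochner_integral_mult_right) (use mean \<tau>S in simp)
    then show ?thesis by simp
  qed
  have \<xi>2: "has_bochner_integral M (\<lambda>\<omega>. (\<xi> u 0 \<omega>)\<^sup>2) (wu u)" for u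
  proof -
    have "(\<xi> u 0 \<omega>)\<^sup>2 = (\<Sum>j<k. \<Sum>l<k. u j * u l * (F (\<tau> j) (W 0 \<omega>) * F (\<tau> l) (W 0 \<omega>)))" for \<omega>
      by (simp add: \<xi>_def power2_eq_square sum_product mult_ac)
    moreover have "has_bochner_integral M
        (\<lambda>\<omega>. \<Sum>j<k. \<Sum>l<k. u j * u l * (F (\<tau> j) (W 0 \<omega>) * F (\<tau> l) (W 0 \<omega>))) (wu u)"
      unfolding wu_def
      by (intro has_bochner_integral_sum has_bochner_integral_mult_right)
        (use cov \<tau>S c' in simp)
    ultimately show ?thesis by simp
  qed
  obtain N where N: "multivariate_normal k (\<lambda>_. 0) c' N"
  proof -
    have "c' j l = c' l j" for j l by (simp add: c'_def mult.commute)
    moreover have "0 \<le> (\<Sum>j<k. \<Sum>l<k. u j * u l * c' j l)" for u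
    proof -
      have "(\<integral>\<omega>. (\<xi> u 0 \<omega>)\<^sup>2 \<partial>M) = (\<Sum>j<k. \<Sum>l<k. u j * u l * c' j l)"
        using \<xi>2[of u] by (simp add: has_bochner_integral_iff wu_def)
      moreover have "0 \<le> (\<integral>\<omega>. (\<xi> u 0 \<omega>)\<^sup>2 \<partial>M)" by simp
      ultimately show ?thesis by simp
    qed
    ultimately show ?thesis using exists_multivariate_normal that by blast
  qed
  have setsN: "sets N = sets (Pi\<^sub>M {..<k} (\<lambda>_. borel :: real measure))" and psN: "prob_space N"
    and linN: "distr N borel (\<lambda>x. \<Sum>j<k. u j * x j) = normal_law 0 (wu u)" for u
    using N by (auto simp: multivariate_normal_def wu_def)
  have linm[measurable]: "(\<lambda>x. \<Sum>j<k. u j * x j) \<in> borel_measurable N" for u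
    unfolding measurable_cong_sets[OF setsN refl]
    by (intro borel_measurable_sum borel_measurable_times borel_measurable_const measurable_component_singleton)
  have lim: "(\<lambda>n. \<integral>\<omega>. g (\<Sum>j<k. u j * X n (\<tau> j) \<omega>) \<partial>M) \<longlonglongrightarrow> (\<integral>x. g (\<Sum>j<k. u j * x j) \<partial>N)"
    if g: "\<And>x y. \<bar>g x - g y\<bar> \<le> \<bar>x - y\<bar>" "\<And>x. \<bar>g x\<bar> \<le> 1" "continuous_on UNIV g"
    for g :: "real \<Rightarrow> real" and u
  proof -
    have [measurable]: "g \<in> borel_measurable borel" using g(3) by (rule borel_measurable_continuous_onI)
    have \<xi>P: "(\<lambda>x. \<Sum>j<k. u j * F (\<tau> j) x) \<in> borel_measurable P"
      by (intro borel_measurable_sum borel_measurable_times borel_measurable_const Fm) (use \<tau>S in simp)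
    have "(\<lambda>n. \<integral>\<omega>. g ((\<Sum>i<n. \<xi> u i \<omega>) / sqrt (real n)) \<partial>M) \<longlonglongrightarrow> (\<integral>x. g x \<partial>normal_law 0 (wu u))"
    proof (rule iid_clt_bounded[where X="\<xi> u", OF \<open>prob_space M\<close> _ _ \<xi>0 \<xi>2 g(3,2)])
      show "indep_vars (\<lambda>_. borel) (\<xi> u) UNIV"
        using indep_vars_compose2[OF ind, of "\<lambda>_ x. \<Sum>j<k. u j * F (\<tau> j) x" "\<lambda>_. borel"] \<xi>P
        by (simp add: \<xi>_def[abs_def])
      have "distr M borel (\<xi> u i) = distr (distr M P (W i)) borel (\<lambda>x. \<Sum>j<k. u j * F (\<tau> j) x)" for i
        by (subst distr_distr[OF \<xi>P Wm]) (simp add: comp_def \<xi>_def[abs_def])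
      then show "distr M borel (\<xi> u i) = distr M borel (\<xi> u 0)" for i by (simp only: id[of i])
    qed
    moreover have "(\<integral>x. g x \<partial>normal_law 0 (wu u)) = (\<integral>x. g (\<Sum>j<k. u j * x j) \<partial>N)"
      unfolding linN[symmetric] by (subst integral_distr) simp_all
    ultimately have "(\<lambda>n. \<integral>\<omega>. g ((\<Sum>i<n. \<xi> u i \<omega>) / sqrt (real n)) \<partial>M) \<longlonglongrightarrow> (\<integral>x. g (\<Sum>j<k. u j * x j) \<partial>N)"
      by simp
    then show ?thesis
    proof (rule slutsky_lipschitz[OF \<open>prob_space M\<close> _ _ _ g(1,2), rotated 3])
      fix n
      show "(\<lambda>\<omega>. \<Sum>j<k. u j * X n (\<tau> j) \<omega>) \<in> borel_measurable M"
        by (intro borel_measurable_sum borel_measurable_times borel_measurable_const Xm) (use \<tau>S in simp)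
      show "(\<lambda>\<omega>. (\<Sum>i<n. \<xi> u i \<omega>) / sqrt (real n)) \<in> borel_measurable M" by measurable
    next
      fix \<epsilon> :: real assume \<epsilon>: "0 < \<epsilon>"
      (* If every coordinate is within this distance, the linear combination is within \<epsilon>. *)
      define \<epsilon>' where "\<epsilon>' = \<epsilon> / (1 + (\<Sum>j<k. \<bar>u j\<bar>))"
      have s0: "0 \<le> (\<Sum>j<k. \<bar>u j\<bar>)" by (intro sum_nonneg) simp
      then have s1: "0 < 1 + (\<Sum>j<k. \<bar>u j\<bar>)" by linarith
      have \<epsilon>': "0 < \<epsilon>'" unfolding \<epsilon>'_def using \<epsilon> s1 by (rule divide_pos_pos)
      define D where "D n j \<omega> = X n (\<tau> j) \<omega> - (\<Sum>i<n. F (\<tau> j) (W i \<omega>)) / sqrt (real n)" for n j \<omega>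
      have Dm: "D n j \<in> borel_measurable M" if "j < k" for n j
        unfolding D_def using that \<tau>S by (intro borel_measurable_diff borel_measurable_divide borel_measurable_sum Xm FW borel_measurable_const) simp_all
      have le: "measure M {\<omega>\<in>space M. \<bar>(\<Sum>j<k. u j * X n (\<tau> j) \<omega>) - (\<Sum>i<n. \<xi> u i \<omega>) / sqrt (real n)\<bar> > \<epsilon>}
         \<le> (\<Sum>j<k. measure M {\<omega>\<in>space M. \<bar>D n j \<omega>\<bar> > \<epsilon>'})" for n
      proof -
        have Ds: "{\<omega>\<in>space M. \<bar>D n j \<omega>\<bar> > \<epsilon>'} \<in> sets M" if "j < k" for j
          using Dm[OF that] by measurable
        have "(\<Sum>j<k. u j * X n (\<tau> j) \<omega>) - (\<Sum>i<n. \<xi> u i \<omega>) / sqrt (real n) = (\<Sum>j<k. u j * D n j \<omega>)" for \<omega>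
        proof -
          have "(\<Sum>i<n. \<xi> u i \<omega>) = (\<Sum>j<k. u j * (\<Sum>i<n. F (\<tau> j) (W i \<omega>)))"
            unfolding \<xi>_def sum_distrib_left by (rule sum.swap)
          then show ?thesis by (simp add: D_def right_diff_distrib sum_subtractf sum_divide_distrib[of _ "{..<k}"])
        qed
        moreover have "\<bar>\<Sum>j<k. u j * D n j \<omega>\<bar> \<le> \<epsilon>" if "\<And>j. j < k \<Longrightarrow> \<bar>D n j \<omega>\<bar> \<le> \<epsilon>'" for \<omega>
        proof -
          have "\<bar>\<Sum>j<k. u j * D n j \<omega>\<bar> \<le> (\<Sum>j<k. \<bar>u j\<bar> * \<epsilon>')"
            by (intro order_trans[OF sum_abs] sum_mono) (simp add: abs_mult mult_left_mono that)
          also have "\<dots> = (\<Sum>j<k. \<bar>u j\<bar>) * \<epsilon>'" by (simp add: sum_distrib_right)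
          also have "\<dots> \<le> (1 + (\<Sum>j<k. \<bar>u j\<bar>)) * \<epsilon>'" using \<epsilon>' by simp
          also have "\<dots> = \<epsilon>" unfolding \<epsilon>'_def times_divide_eq_right
            by (rule nonzero_mult_div_cancel_left) (use s1 in linarith)
          finally show ?thesis .
        qed
        ultimately have "{\<omega>\<in>space M. \<bar>(\<Sum>j<k. u j * X n (\<tau> j) \<omega>) - (\<Sum>i<n. \<xi> u i \<omega>) / sqrt (real n)\<bar> > \<epsilon>}
            \<subseteq> (\<Union>j<k. {\<omega>\<in>space M. \<bar>D n j \<omega>\<bar> > \<epsilon>'})"
          by (auto simp: not_less[symmetric])
        then have "measure M {\<omega>\<in>space M. \<bar>(\<Sum>j<k. u j * X n (\<tau> j) \<omega>) - (\<Sum>i<n. \<xi> u i \<omega>) / sqrt (real n)\<bar> > \<epsilon>}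
          \<le> measure M (\<Union>j<k. {\<omega>\<in>space M. \<bar>D n j \<omega>\<bar> > \<epsilon>'})"
          using Ds by (intro finite_measure_mono) auto
        also have "\<dots> \<le> (\<Sum>j<k. measure M {\<omega>\<in>space M. \<bar>D n j \<omega>\<bar> > \<epsilon>'})"
          using Ds by (intro finite_measure_subadditive_finite) auto
        finally show ?thesis .
      qed
      have "(\<lambda>n. \<Sum>j<k. measure M {\<omega>\<in>space M. \<bar>D n j \<omega>\<bar> > \<epsilon>'}) \<longlonglongrightarrow> (\<Sum>j<k. 0)"
        unfolding D_def by (intro tendsto_sum approx \<epsilon>') (use \<tau>S in simp)
      then have B: "(\<lambda>n. \<Sum>j<k. measure M {\<omega>\<in>space M. \<bar>D n j \<omega>\<bar> > \<epsilon>'}) \<longlonglongrightarrow> 0" by simp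
      show "(\<lambda>n. measure M {\<omega>\<in>space M. \<bar>(\<Sum>j<k. u j * X n (\<tau> j) \<omega>) - (\<Sum>i<n. \<xi> u i \<omega>) / sqrt (real n)\<bar> > \<epsilon>}) \<longlonglongrightarrow> 0"
      proof (rule tendsto_sandwich[OF always_eventually always_eventually tendsto_const B])
        show "\<forall>n. 0 \<le> measure M {\<omega>\<in>space M. \<bar>(\<Sum>j<k. u j * X n (\<tau> j) \<omega>) - (\<Sum>i<n. \<xi> u i \<omega>) / sqrt (real n)\<bar> > \<epsilon>}"
          by simp
      qed (rule allI, rule le)
    qed
  qed
  have lip: "\<bar>f x - f y\<bar> \<le> \<bar>x - y\<bar>" if f: "\<And>z. (f has_real_derivative f' z) (at z)" "\<And>z. \<bar>f' z\<bar> \<le> 1"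
    for f f' :: "real \<Rightarrow> real" and x y
  proof -
    have "norm (f x - f y) \<le> 1 * norm (x - y)"
      by (rule field_differentiable_bound[of UNIV f f']) (use f in \<open>auto intro: has_field_derivative_at_within\<close>)
    then show ?thesis by simp
  qed
  have "weak_conv_vec M k (\<lambda>n j. X n (\<tau> j)) N"
  proof (rule weak_conv_vecI[OF \<open>prob_space M\<close> _ psN setsN])
    show "X n (\<tau> j) \<in> borel_measurable M" if "j < k" for n j using Xm[OF \<tau>S[OF that]] .
    fix u
    show "(\<lambda>n. \<integral>\<omega>. cos (\<Sum>j<k. u j * X n (\<tau> j) \<omega>) \<partial>M) \<longlonglongrightarrow> (\<integral>x. cos (\<Sum>j<k. u j * x j) \<partial>N)"
      by (rule lim, rule lip[of _ "\<lambda>x. - sin x"])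
        (auto intro!: derivative_eq_intros continuous_on_cos continuous_on_id)
    show "(\<lambda>n. \<integral>\<omega>. sin (\<Sum>j<k. u j * X n (\<tau> j) \<omega>) \<partial>M) \<longlonglongrightarrow> (\<integral>x. sin (\<Sum>j<k. u j * x j) \<partial>N)"
      by (rule lim, rule lip[of _ cos])
        (auto intro!: derivative_eq_intros continuous_on_sin continuous_on_id)
  qed
  moreover have "multivariate_normal k (\<lambda>_. 0) (\<lambda>j l. c (\<tau> j) (\<tau> l)) N"
  proof -
    have "(\<Sum>j<k. \<Sum>l<k. u j * u l * c' j l) = (\<Sum>j<k. \<Sum>l<k. u j * u l * c (\<tau> j) (\<tau> l))" for u
      by (intro sum.cong refl) (simp add: c')
    then show ?thesis using N by (simp add: multivariate_normal_def)
  qed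
  ultimately show "\<exists>N. multivariate_normal k (\<lambda>j. 0) (\<lambda>j l. c (\<tau> j) (\<tau> l)) N \<and>
      weak_conv_vec M k (\<lambda>n j. X n (\<tau> j)) N" by blast
qed

section \<open>The local polynomial smoother at a fixed design\<close>

definition lpk_normal_mat :: "nat \<Rightarrow> (real \<Rightarrow> real) \<Rightarrow> real \<Rightarrow> nat \<Rightarrow> (nat \<Rightarrow> real) \<Rightarrow> real \<Rightarrow> real mat" where
  "lpk_normal_mat p K h m \<tau> t =
     mat (p + 1) (p + 1) (\<lambda>(r, s). \<Sum>j<m. K ((\<tau> j - t) / h) / h * (\<tau> j - t) ^ r * (\<tau> j - t) ^ s)"

lemma lpk_normal_mat_carrier: "lpk_normal_mat p K h m \<tau> t \<in> carrier_mat (p + 1) (p + 1)"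
  by (simp add: lpk_normal_mat_def)

text \<open>Only the first row of the inverse of the normal matrix enters.\<close>

lemma lpk_via_normal_mat:
  "lpk p K h m \<tau> y t =
     (case mat_inverse (lpk_normal_mat p K h m \<tau> t) of
        None \<Rightarrow> 0
      | Some B \<Rightarrow> \<Sum>r<p + 1. B $$ (0, r) * (\<Sum>j<m. (\<tau> j - t) ^ r * (K ((\<tau> j - t) / h) / h) * y j))"
proof -
  define Z where "Z = mat m (p + 1) (\<lambda>(j, r). (\<tau> j - t) ^ r)"
  define W where "W = mat m m (\<lambda>(j, l). if j = l then K ((\<tau> j - t) / h) / h else 0)"
  have Z: "Z \<in> carrier_mat m (p + 1)" and W: "W \<in> carrier_mat m m" by (simp_all add: Z_def W_def)
  have ZW: "(transpose_mat Z * W) $$ (r, j) = (\<tau> j - t) ^ r * (K ((\<tau> j - t) / h) / h)"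
    if "r < p + 1" "j < m" for r j
  proof -
    have "(transpose_mat Z * W) $$ (r, j) = (\<Sum>l\<in>{0..<m}. (\<tau> l - t) ^ r * (if l = j then K ((\<tau> l - t) / h) / h else 0))"
      using that by (simp add: Z_def W_def scalar_prod_def)
    also have "\<dots> = (\<Sum>l\<in>{0..<m}. if l = j then (\<tau> l - t) ^ r * (K ((\<tau> l - t) / h) / h) else 0)"
      by (intro sum.cong) auto
    also have "\<dots> = (\<tau> j - t) ^ r * (K ((\<tau> j - t) / h) / h)"
      using that by (simp only: sum.delta finite_atLeastLessThan) simp
    finally show ?thesis .
  qed
  have ZWd: "dim_row (transpose_mat Z * W) = p + 1" "dim_col (transpose_mat Z * W) = m"
    using Z W by auto
  have A: "transpose_mat Z * W * Z = lpk_normal_mat p K h m \<tau> t"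
  proof (rule eq_matI)
    fix r s assume "r < dim_row (lpk_normal_mat p K h m \<tau> t)" "s < dim_col (lpk_normal_mat p K h m \<tau> t)"
    then have rs: "r < p + 1" "s < p + 1" by (simp_all add: lpk_normal_mat_def)
    have "(transpose_mat Z * W * Z) $$ (r, s) = (\<Sum>j\<in>{0..<m}. (transpose_mat Z * W) $$ (r, j) * Z $$ (j, s))"
      using rs ZWd Z by (simp add: scalar_prod_def)
    also have "\<dots> = (\<Sum>j\<in>{0..<m}. K ((\<tau> j - t) / h) / h * (\<tau> j - t) ^ r * (\<tau> j - t) ^ s)"
      using rs by (intro sum.cong refl) (simp add: ZW, simp add: Z_def)
    finally show "(transpose_mat Z * W * Z) $$ (r, s) = lpk_normal_mat p K h m \<tau> t $$ (r, s)"
      using rs by (simp add: lpk_normal_mat_def lessThan_atLeast0)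
  qed (use ZWd Z in \<open>auto simp: lpk_normal_mat_def\<close>)
  have "scalar_prod (unit_vec (p + 1) 0) (B *\<^sub>v ((transpose_mat Z * W) *\<^sub>v vec m y)) =
      (\<Sum>r<p + 1. B $$ (0, r) * (\<Sum>j<m. (\<tau> j - t) ^ r * (K ((\<tau> j - t) / h) / h) * y j))"
    if B: "B \<in> carrier_mat (p + 1) (p + 1)" for B
  proof -
    have zy: "((transpose_mat Z * W) *\<^sub>v vec m y) $ r = (\<Sum>j<m. (\<tau> j - t) ^ r * (K ((\<tau> j - t) / h) / h) * y j)"
      if "r < p + 1" for r
    proof -
      have "((transpose_mat Z * W) *\<^sub>v vec m y) $ r = (\<Sum>j\<in>{0..<m}. (transpose_mat Z * W) $$ (r, j) * y j)"
        using that ZWd by (simp add: scalar_prod_def)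
      also have "\<dots> = (\<Sum>j\<in>{0..<m}. (\<tau> j - t) ^ r * (K ((\<tau> j - t) / h) / h) * y j)"
        using that by (intro sum.cong refl) (simp add: ZW)
      finally show ?thesis by (simp add: lessThan_atLeast0)
    qed
    have d: "dim_vec ((transpose_mat Z * W) *\<^sub>v vec m y) = p + 1" using ZWd by simp
    have "B *\<^sub>v ((transpose_mat Z * W) *\<^sub>v vec m y) \<in> carrier_vec (p + 1)"
      by (rule carrier_vecI) (use B in simp)
    then have "scalar_prod (unit_vec (p + 1) 0) (B *\<^sub>v ((transpose_mat Z * W) *\<^sub>v vec m y)) =
       (B *\<^sub>v ((transpose_mat Z * W) *\<^sub>v vec m y)) $ 0"
      by (intro scalar_prod_left_unit) simp_all
    also have "\<dots> = (\<Sum>r\<in>{0..<p + 1}. B $$ (0, r) * ((transpose_mat Z * W) *\<^sub>v vec m y) $ r)"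
      using B d by (simp add: scalar_prod_def del: index_mult_mat_vec(1) add: mult_mat_vec_def[of B])
    also have "\<dots> = (\<Sum>r\<in>{0..<p + 1}. B $$ (0, r) * (\<Sum>j<m. (\<tau> j - t) ^ r * (K ((\<tau> j - t) / h) / h) * y j))"
      by (intro sum.cong refl) (simp only: zy atLeastLessThan_iff)
    finally show ?thesis by (simp only: lessThan_atLeast0)
  qed
  then have "(case mat_inverse (lpk_normal_mat p K h m \<tau> t) of None \<Rightarrow> 0
      | Some B \<Rightarrow> scalar_prod (unit_vec (p + 1) 0) (B *\<^sub>v ((transpose_mat Z * W) *\<^sub>v vec m y))) =
     (case mat_inverse (lpk_normal_mat p K h m \<tau> t) of
        None \<Rightarrow> 0
      | Some B \<Rightarrow> \<Sum>r<p + 1. B $$ (0, r) * (\<Sum>j<m. (\<tau> j - t) ^ r * (K ((\<tau> j - t) / h) / h) * y j))"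
    using mat_inverse(2)[OF lpk_normal_mat_carrier] by (auto split: option.split)
  then show ?thesis
    unfolding lpk_def Let_def Z_def[symmetric] W_def[symmetric] A .
qed

text \<open>Cramer's rule expresses the inverse as a rational function of the entries. This is what makes the
  smoother a measurable function of design and observations.\<close>

lemma mat_inverse_eq_adj:
  fixes A :: "real mat"
  assumes A: "A \<in> carrier_mat n n"
  shows "mat_inverse A = None \<longleftrightarrow> det A = 0"
    and "mat_inverse A = Some B \<Longrightarrow> B = (1 / det A) \<cdot>\<^sub>m adj_mat A"
proof -
  show *: "mat_inverse A = None \<longleftrightarrow> det A = 0"
  proof
    assume "mat_inverse A = None"
    from mat_inverse(1)[OF A this, where b="()"] show "det A = 0"
      using det_non_zero_imp_unit[OF A, where b="()"] by blast
  next
    assume d: "det A = 0"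
    show "mat_inverse A = None"
    proof (rule ccontr)
      assume "mat_inverse A \<noteq> None"
      then obtain B where "mat_inverse A = Some B" by blast
      from mat_inverse(2)[OF A this] have "A * B = 1\<^sub>m n" "B \<in> carrier_mat n n" by auto
      then have "det A * det B = 1" using det_mult[OF A] by (metis det_one)
      then show False using d by simp
    qed
  qed
  assume B: "mat_inverse A = Some B"
  then have d: "det A \<noteq> 0" using * by auto
  from mat_inverse(2)[OF A B] have B': "B * A = 1\<^sub>m n" "B \<in> carrier_mat n n" by auto
  note adj = adj_mat[OF A]
  have "adj_mat A = (B * A) * adj_mat A" using B' adj by simp
  also have "\<dots> = B * (A * adj_mat A)" by (rule assoc_mult_mat[OF B'(2) A adj(1)])
  also have "\<dots> = det A \<cdot>\<^sub>m B"
    unfolding adj(2) using mult_smult_distrib[OF B'(2) one_carrier_mat] B'(2) by simp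
  finally show "B = (1 / det A) \<cdot>\<^sub>m adj_mat A" using d B'(2) by (auto intro!: eq_matI)
qed

lemma borel_measurable_det:
  fixes F :: "'a \<Rightarrow> nat \<Rightarrow> nat \<Rightarrow> real"
  assumes "\<And>i j. i < n \<Longrightarrow> j < n \<Longrightarrow> (\<lambda>\<omega>. F \<omega> i j) \<in> borel_measurable N"
  shows "(\<lambda>\<omega>. det (mat n n (\<lambda>(i, j). F \<omega> i j))) \<in> borel_measurable N"
proof -
  have "det (mat n n (\<lambda>(i, j). F \<omega> i j)) = (\<Sum>p | p permutes {0..<n}. signof p * (\<Prod>i = 0..<n. F \<omega> i (p i)))" for \<omega>
    by (subst det_def'[of _ n]) (auto intro!: sum.cong prod.cong dest: permutes_in_image)
  moreover have "(\<lambda>\<omega>. \<Sum>p | p permutes {0..<n}. signof p * (\<Prod>i = 0..<n. F \<omega> i (p i))) \<in> borel_measurable N"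
    by (intro borel_measurable_sum borel_measurable_times borel_measurable_const borel_measurable_prod assms)
      (auto dest: permutes_in_image)
  ultimately show ?thesis by simp
qed

lemma borel_measurable_lpk:
  assumes [measurable]: "K \<in> borel_measurable borel"
    and \<tau>: "\<And>j. j < m \<Longrightarrow> \<tau> j \<in> borel_measurable N" and y: "\<And>j. j < m \<Longrightarrow> y j \<in> borel_measurable N"
  shows "(\<lambda>\<omega>. lpk p K h m (\<lambda>j. \<tau> j \<omega>) (\<lambda>j. y j \<omega>) t) \<in> borel_measurable N"
proof -
  define A where "A \<omega> = lpk_normal_mat p K h m (\<lambda>j. \<tau> j \<omega>) t" for \<omega>
  define E where "E \<omega> r s = (\<Sum>j<m. K ((\<tau> j \<omega> - t) / h) / h * (\<tau> j \<omega> - t) ^ r * (\<tau> j \<omega> - t) ^ s)" for \<omega> r s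
  have AE: "A \<omega> = mat (p + 1) (p + 1) (\<lambda>(r, s). E \<omega> r s)" for \<omega>
    by (simp add: A_def lpk_normal_mat_def E_def)
  have Em: "(\<lambda>\<omega>. E \<omega> r s) \<in> borel_measurable N" for r s
    unfolding E_def
  proof (rule borel_measurable_sum)
    fix j assume "j \<in> {..<m}"
    then have [measurable]: "\<tau> j \<in> borel_measurable N" using \<tau> by simp
    show "(\<lambda>\<omega>. K ((\<tau> j \<omega> - t) / h) / h * (\<tau> j \<omega> - t) ^ r * (\<tau> j \<omega> - t) ^ s) \<in> borel_measurable N"
      by measurable
  qed
  have detm[measurable]: "(\<lambda>\<omega>. det (A \<omega>)) \<in> borel_measurable N"
    unfolding AE by (rule borel_measurable_det) (rule Em)
  have adjm[measurable]: "(\<lambda>\<omega>. adj_mat (A \<omega>) $$ (0, r)) \<in> borel_measurable N" if "r < p + 1" for r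
  proof -
    have "adj_mat (A \<omega>) $$ (0, r) = (-1) ^ r * det (mat p p (\<lambda>(i, j).
        E \<omega> (if i < r then i else Suc i) (Suc j)))" for \<omega>
      using that unfolding adj_mat_def cofactor_def mat_delete_def AE
      by (auto intro!: arg_cong[where f=det] eq_matI)
    moreover have "(\<lambda>\<omega>. (-1) ^ r * det (mat p p (\<lambda>(i, j). E \<omega> (if i < r then i else Suc i) (Suc j)))) \<in> borel_measurable N"
      by (intro borel_measurable_times borel_measurable_const borel_measurable_det Em)
    ultimately show ?thesis by simp
  qed
  define R where "R \<omega> r = (\<Sum>j<m. (\<tau> j \<omega> - t) ^ r * (K ((\<tau> j \<omega> - t) / h) / h) * y j \<omega>)" for \<omega> r
  have Rm: "(\<lambda>\<omega>. R \<omega> r) \<in> borel_measurable N" for r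
    unfolding R_def
  proof (rule borel_measurable_sum)
    fix j assume "j \<in> {..<m}"
    then have [measurable]: "\<tau> j \<in> borel_measurable N" "y j \<in> borel_measurable N" using \<tau> y by simp_all
    show "(\<lambda>\<omega>. (\<tau> j \<omega> - t) ^ r * (K ((\<tau> j \<omega> - t) / h) / h) * y j \<omega>) \<in> borel_measurable N"
      by measurable
  qed
  have "lpk p K h m (\<lambda>j. \<tau> j \<omega>) (\<lambda>j. y j \<omega>) t =
      (if det (A \<omega>) = 0 then 0 else \<Sum>r<p + 1. 1 / det (A \<omega>) * adj_mat (A \<omega>) $$ (0, r) * R \<omega> r)" for \<omega>
  proof -
    have c: "A \<omega> \<in> carrier_mat (p + 1) (p + 1)" by (simp add: AE)
    show ?thesis
    proof (cases "mat_inverse (A \<omega>)")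
      case None
      then show ?thesis using mat_inverse_eq_adj(1)[OF c]
        by (simp add: lpk_via_normal_mat A_def)
    next
      case (Some B)
      then have d: "det (A \<omega>) \<noteq> 0" using mat_inverse_eq_adj(1)[OF c] by auto
      have "B $$ (0, r) = 1 / det (A \<omega>) * adj_mat (A \<omega>) $$ (0, r)" if "r < p + 1" for r
        using adj_mat(1)[OF c] that unfolding mat_inverse_eq_adj(2)[OF c Some] by simp
      then have "(\<Sum>r<p + 1. B $$ (0, r) * R \<omega> r) = (\<Sum>r<p + 1. 1 / det (A \<omega>) * adj_mat (A \<omega>) $$ (0, r) * R \<omega> r)"
        by (intro sum.cong refl) simp
      then show ?thesis using d Some by (simp add: lpk_via_normal_mat A_def R_def)
    qed
  qed
  moreover have "(\<lambda>\<omega>. if det (A \<omega>) = 0 then 0 else \<Sum>r<p + 1. 1 / det (A \<omega>) * adj_mat (A \<omega>) $$ (0, r) * R \<omega> r) \<in> borel_measurable N"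
    by (intro measurable_If borel_measurable_const borel_measurable_sum borel_measurable_times borel_measurable_divide Rm adjm detm)
      (simp_all)
  ultimately show ?thesis by simp
qed

text \<open>In the scaled coordinates \<open>x\<^sub>j = (\<tau>\<^sub>j - t) / h\<close> the coefficients \<open>b\<close> of the first row of the inverse satisfy
  \<open>\<Sum>\<^sub>j K(x\<^sub>j) (\<Sum>\<^sub>r b\<^sub>r x\<^sub>j\<^sup>r)\<^sup>2 = h b\<^sub>0\<close>, by the reproducing property. With the lower bound on the quadratic
  form this gives \<open>\<bar>b\<^sub>r\<bar> \<le> 1 / (lam m)\<close>, and all bounds on the weights follow.\<close>

lemma lpk_weights:
  fixes \<tau> :: "nat \<Rightarrow> real"
  assumes h: "h > 0" and m: "m > 0" and lam: "lam > 0"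
    and K: "\<And>u. 0 \<le> K u" "\<And>u. K u \<le> B" "\<And>u. \<bar>u\<bar> > 1 \<Longrightarrow> K u = 0"
    and lower: "\<And>a. lam * (real m * h) * (\<Sum>r<p + 1. (a r)\<^sup>2) \<le>
      (\<Sum>j<m. K ((\<tau> j - t) / h) * (\<Sum>r<p + 1. a r * ((\<tau> j - t) / h) ^ r)\<^sup>2)"
    and upper: "(\<Sum>j<m. K ((\<tau> j - t) / h)) \<le> U * (real m * h)"
  shows "\<exists>w. (\<forall>y. lpk p K h m \<tau> y t = (\<Sum>j<m. w j * y j)) \<and>
    (\<forall>r<p + 1. (\<Sum>j<m. w j * (\<tau> j - t) ^ r) = (if r = 0 then 1 else 0)) \<and>
    (\<forall>j<m. h < \<bar>\<tau> j - t\<bar> \<longrightarrow> w j = 0) \<and>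
    (\<Sum>j<m. \<bar>w j\<bar>) \<le> (real p + 1) * U / lam \<and>
    (\<Sum>j<m. (w j)\<^sup>2) \<le> B / lam / (real m * h)"
proof -
  define A where "A = lpk_normal_mat p K h m \<tau> t"
  have Ac: "A \<in> carrier_mat (p + 1) (p + 1)" unfolding A_def by (rule lpk_normal_mat_carrier)
  define x where "x j = (\<tau> j - t) / h" for j
  have x: "\<tau> j - t = h * x j" for j using h by (simp add: x_def)
  have mh: "0 < real m * h" using h m by simp
  have Aent: "A $$ (r, s) = (\<Sum>j<m. K (x j) / h * (h * x j) ^ r * (h * x j) ^ s)" if "r < p + 1" "s < p + 1" for r s
    using that by (simp add: A_def lpk_normal_mat_def x[symmetric] x_def[symmetric])
  have "det A \<noteq> 0"
  proof
    assume "det A = 0"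
    then obtain v where v: "v \<in> carrier_vec (p + 1)" "v \<noteq> 0\<^sub>v (p + 1)" "A *\<^sub>v v = 0\<^sub>v (p + 1)"
      using det_0_iff_vec_prod_zero_field[OF Ac] by blast
    have row: "(\<Sum>s<p + 1. A $$ (r, s) * v $ s) = 0" if "r < p + 1" for r
    proof -
      have "(A *\<^sub>v v) $ r = 0" using v(3) that by simp
      moreover have "(A *\<^sub>v v) $ r = (\<Sum>s\<in>{0..<p + 1}. A $$ (r, s) * v $ s)"
        using that Ac v(1) by (simp add: scalar_prod_def)
      ultimately show ?thesis by (simp only: lessThan_atLeast0)
    qed
    have "(\<Sum>j<m. K (x j) * (\<Sum>r<p + 1. v $ r * h ^ r * x j ^ r)\<^sup>2) =
       h * (\<Sum>r<p + 1. v $ r * (\<Sum>s<p + 1. A $$ (r, s) * v $ s))"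
    proof -
      have "(\<Sum>r<p + 1. v $ r * (\<Sum>s<p + 1. A $$ (r, s) * v $ s)) =
         (\<Sum>r<p + 1. \<Sum>s<p + 1. \<Sum>j<m. K (x j) / h * ((v $ r * h ^ r * x j ^ r) * (v $ s * h ^ s * x j ^ s)))"
        unfolding sum_distrib_left
        by (intro sum.cong refl) (simp add: Aent sum_distrib_left sum_distrib_right power_mult_distrib mult_ac)
      also have "\<dots> = (\<Sum>r<p + 1. \<Sum>j<m. \<Sum>s<p + 1. K (x j) / h * ((v $ r * h ^ r * x j ^ r) * (v $ s * h ^ s * x j ^ s)))"
        by (intro sum.cong refl sum.swap)
      also have "\<dots> = (\<Sum>j<m. \<Sum>r<p + 1. \<Sum>s<p + 1. K (x j) / h * ((v $ r * h ^ r * x j ^ r) * (v $ s * h ^ s * x j ^ s)))"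
        by (rule sum.swap)
      also have "\<dots> = (\<Sum>j<m. K (x j) / h * (\<Sum>r<p + 1. v $ r * h ^ r * x j ^ r)\<^sup>2)"
        unfolding power2_eq_square sum_product by (simp only: sum_distrib_left)
      finally show ?thesis using h by (simp add: sum_distrib_left)
    qed
    also have "(\<Sum>r<p + 1. v $ r * (\<Sum>s<p + 1. A $$ (r, s) * v $ s)) = 0"
      by (intro sum.neutral ballI, subst row) auto
    also have "h * 0 = 0" by simp
    finally have "lam * (real m * h) * (\<Sum>r<p + 1. (v $ r * h ^ r)\<^sup>2) \<le> 0"
      using lower[of "\<lambda>r. v $ r * h ^ r"] by (simp add: x_def)
    moreover have "0 \<le> (\<Sum>r<p + 1. (v $ r * h ^ r)\<^sup>2)" by (intro sum_nonneg) simp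
    moreover have "0 < lam * (real m * h)" using lam mh by (rule mult_pos_pos)
    ultimately have "(\<Sum>r<p + 1. (v $ r * h ^ r)\<^sup>2) = 0"
      using mult_pos_pos[of "lam * (real m * h)" "\<Sum>r<p + 1. (v $ r * h ^ r)\<^sup>2"] by linarith
    then have "\<forall>r\<in>{..<p + 1}. (v $ r * h ^ r)\<^sup>2 = 0"
      by (subst (asm) sum_nonneg_eq_0_iff) auto
    then have "v $ r = 0" if "r < p + 1" for r using h that by auto
    then have "v = 0\<^sub>v (p + 1)" using v(1) by (intro eq_vecI) auto
    then show False using v(2) by simp
  qed
  then obtain C where C: "mat_inverse A = Some C"
    using mat_inverse_eq_adj(1)[OF Ac] by (cases "mat_inverse A") auto
  from mat_inverse(2)[OF Ac C] have CA: "C * A = 1\<^sub>m (p + 1)" and Cc: "C \<in> carrier_mat (p + 1) (p + 1)" by auto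
  define b where "b r = C $$ (0, r) * h ^ r" for r
  define w where "w j = K (x j) / h * (\<Sum>r<p + 1. b r * x j ^ r)" for j
  have w: "lpk p K h m \<tau> y t = (\<Sum>j<m. w j * y j)" for y
  proof -
    have "lpk p K h m \<tau> y t = (\<Sum>r<p + 1. C $$ (0, r) * (\<Sum>j<m. (\<tau> j - t) ^ r * (K ((\<tau> j - t) / h) / h) * y j))"
      using C by (simp add: lpk_via_normal_mat A_def)
    also have "\<dots> = (\<Sum>r<p + 1. \<Sum>j<m. K (x j) / h * (b r * x j ^ r) * y j)"
      unfolding sum_distrib_left x_def[symmetric] x b_def
      by (intro sum.cong refl) (simp add: power_mult_distrib mult_ac)
    also have "\<dots> = (\<Sum>j<m. \<Sum>r<p + 1. K (x j) / h * (b r * x j ^ r) * y j)" by (rule sum.swap)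
    also have "\<dots> = (\<Sum>j<m. w j * y j)"
      unfolding w_def sum_distrib_left sum_distrib_right by (rule refl)
    finally show ?thesis .
  qed
  have rep: "(\<Sum>j<m. w j * (\<tau> j - t) ^ s) = (if s = 0 then 1 else 0)" if s: "s < p + 1" for s
  proof -
    have "(C * A) $$ (0, s) = (\<Sum>r\<in>{0..<p + 1}. C $$ (0, r) * A $$ (r, s))"
      using Ac Cc s by (simp add: scalar_prod_def)
    also have "\<dots> = (\<Sum>r<p + 1. \<Sum>j<m. K (x j) / h * (b r * x j ^ r) * (h * x j) ^ s)"
      unfolding lessThan_atLeast0[symmetric] b_def using s
      by (intro sum.cong refl) (simp add: Aent sum_distrib_left power_mult_distrib mult_ac)
    also have "\<dots> = (\<Sum>j<m. \<Sum>r<p + 1. K (x j) / h * (b r * x j ^ r) * (h * x j) ^ s)" by (rule sum.swap)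
    also have "\<dots> = (\<Sum>j<m. w j * (\<tau> j - t) ^ s)"
      unfolding w_def x sum_distrib_left sum_distrib_right by (rule refl)
    finally show ?thesis using s unfolding CA by simp
  qed
  have repx: "(\<Sum>j<m. w j * x j ^ s) = (if s = 0 then 1 else 0)" if "s < p + 1" for s
  proof -
    have "h ^ s * (\<Sum>j<m. w j * x j ^ s) = (if s = 0 then 1 else 0)"
      using rep[OF that] unfolding x by (simp add: sum_distrib_left power_mult_distrib mult_ac)
    then show ?thesis using h by (auto split: if_splits)
  qed
  define q where "q = (\<Sum>r<p + 1. (b r)\<^sup>2)"
  have quad: "(\<Sum>j<m. K (x j) * (\<Sum>r<p + 1. b r * x j ^ r)\<^sup>2) = h * b 0"
  proof -
    have "(\<Sum>j<m. K (x j) * (\<Sum>r<p + 1. b r * x j ^ r)\<^sup>2) = h * (\<Sum>j<m. \<Sum>s<p + 1. b s * (w j * x j ^ s))"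
      unfolding sum_distrib_left[of h]
    proof (rule sum.cong[OF refl])
      fix j
      define Q where "Q = (\<Sum>r<p + 1. b r * x j ^ r)"
      have "(\<Sum>s<p + 1. b s * (w j * x j ^ s)) = w j * Q"
        unfolding Q_def sum_distrib_left by (intro sum.cong refl) (simp only: mult_ac)
      then show "K (x j) * (\<Sum>r<p + 1. b r * x j ^ r)\<^sup>2 = (\<Sum>s<p + 1. h * (b s * (w j * x j ^ s)))"
        unfolding sum_distrib_left[symmetric] Q_def[symmetric] w_def
        using h by (simp del: sum.lessThan_Suc add: power2_eq_square)
    qed
    also have "(\<Sum>j<m. \<Sum>s<p + 1. b s * (w j * x j ^ s)) = (\<Sum>s<p + 1. \<Sum>j<m. b s * (w j * x j ^ s))"
      by (rule sum.swap)
    also have "\<dots> = (\<Sum>s<p + 1. b s * (if s = 0 then 1 else 0))"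
      unfolding sum_distrib_left[symmetric] by (intro sum.cong refl) (simp only: repx lessThan_iff)
    also have "\<dots> = (\<Sum>s<p + 1. if s = 0 then b s else 0)"
      by (intro sum.cong refl) simp
    also have "\<dots> = b 0" by (subst sum.delta) simp_all
    finally show ?thesis .
  qed
  have qb: "lam * real m * q \<le> b 0"
  proof -
    have "lam * (real m * h) * q \<le> h * b 0"
      using lower[of b] unfolding q_def x_def[symmetric] quad .
    then have "h * (lam * real m * q) \<le> h * b 0" by (simp add: mult_ac)
    then show ?thesis using h by simp
  qed
  have q0: "(b r)\<^sup>2 \<le> q" if "r < p + 1" for r
    unfolding q_def using that by (intro member_le_sum) auto
  have lm: "0 < lam * real m" using lam m by simp
  have b0: "b 0 \<le> 1 / (lam * real m)"
  proof (cases "b 0 \<le> 0")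
    case True
    then show ?thesis using lm by (meson divide_nonneg_pos order_trans zero_le_one)
  next
    case False
    have "lam * real m * (b 0)\<^sup>2 \<le> lam * real m * q"
      by (rule mult_left_mono[OF q0]) (use lm in auto)
    then have "lam * real m * (b 0)\<^sup>2 \<le> b 0" using qb by linarith
    then have "lam * real m * b 0 \<le> 1" using False by (simp add: power2_eq_square)
    then show ?thesis using lm by (simp add: pos_le_divide_eq mult.commute)
  qed
  have br: "\<bar>b r\<bar> \<le> 1 / (lam * real m)" if "r < p + 1" for r
  proof -
    have "q \<le> b 0 / (lam * real m)"
      using qb lm by (simp only: pos_le_divide_eq mult.commute)
    with q0[OF that] have "(b r)\<^sup>2 \<le> b 0 / (lam * real m)" by linarith
    also have "\<dots> \<le> (1 / (lam * real m)) / (lam * real m)"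
      using b0 lm by (intro divide_right_mono) auto
    finally have "(b r)\<^sup>2 \<le> (1 / (lam * real m))\<^sup>2" by (simp add: power2_eq_square)
    then have "\<bar>b r\<bar> \<le> \<bar>1 / (lam * real m)\<bar>" by (simp only: abs_le_square_iff)
    also have "\<dots> = 1 / (lam * real m)" using lm by (intro abs_of_nonneg divide_nonneg_pos) auto
    finally show ?thesis .
  qed
  have wb: "\<bar>w j\<bar> \<le> K (x j) / h * ((real p + 1) * (1 / (lam * real m)))" for j
  proof (cases "\<bar>x j\<bar> > 1")
    case True then show ?thesis using K(3) by (simp add: w_def)
  next
    case False
    have "\<bar>\<Sum>r<p + 1. b r * x j ^ r\<bar> \<le> (\<Sum>r<p + 1. 1 / (lam * real m))"
    proof (intro order_trans[OF sum_abs] sum_mono)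
      fix r assume "r \<in> {..<p + 1}"
      then have "\<bar>b r\<bar> * \<bar>x j\<bar> ^ r \<le> 1 / (lam * real m) * 1"
        using False lm by (intro mult_mono br power_le_one) auto
      then show "\<bar>b r * x j ^ r\<bar> \<le> 1 / (lam * real m)" by (simp add: abs_mult power_abs)
    qed
    also have "\<dots> = (real p + 1) * (1 / (lam * real m))" by simp
    finally have "\<bar>w j\<bar> \<le> K (x j) / h * ((real p + 1) * (1 / (lam * real m)))"
      unfolding w_def abs_mult using K(1) h by (simp only: abs_of_nonneg divide_nonneg_pos) (intro mult_left_mono divide_nonneg_pos, auto)
    then show ?thesis .
  qed
  have s1: "(\<Sum>j<m. \<bar>w j\<bar>) \<le> (real p + 1) * U / lam"
  proof -
    have "(\<Sum>j<m. \<bar>w j\<bar>) \<le> (\<Sum>j<m. K (x j) / h * ((real p + 1) * (1 / (lam * real m))))"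
      by (intro sum_mono wb)
    also have "\<dots> = (\<Sum>j<m. K (x j)) * ((real p + 1) * (1 / (lam * real m)) / h)"
      unfolding sum_distrib_right by (intro sum.cong refl) simp
    also have "\<dots> \<le> (U * (real m * h)) * ((real p + 1) * (1 / (lam * real m)) / h)"
      using upper lm h unfolding x_def by (intro mult_right_mono) auto
    also have "\<dots> = (real p + 1) * U / lam" using m h by simp
    finally show ?thesis .
  qed
  have s2: "(\<Sum>j<m. (w j)\<^sup>2) \<le> B / lam / (real m * h)"
  proof -
    have B0: "0 \<le> B" using K(1,2)[of 0] by linarith
    have "(\<Sum>j<m. (w j)\<^sup>2) \<le> (\<Sum>j<m. B / h\<^sup>2 * (K (x j) * (\<Sum>r<p + 1. b r * x j ^ r)\<^sup>2))"
    proof (rule sum_mono)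
      fix j
      have "(w j)\<^sup>2 = K (x j) * (K (x j) * (\<Sum>r<p + 1. b r * x j ^ r)\<^sup>2) / h\<^sup>2"
        unfolding w_def by (simp only: power_mult_distrib power_divide) (simp add: power2_eq_square)
      also have "\<dots> \<le> B * (K (x j) * (\<Sum>r<p + 1. b r * x j ^ r)\<^sup>2) / h\<^sup>2"
        using K by (intro divide_right_mono mult_right_mono) auto
      finally show "(w j)\<^sup>2 \<le> B / h\<^sup>2 * (K (x j) * (\<Sum>r<p + 1. b r * x j ^ r)\<^sup>2)" by simp
    qed
    also have "\<dots> = B / h\<^sup>2 * (h * b 0)" unfolding sum_distrib_left[symmetric] quad ..
    also have "\<dots> = B / h * b 0" using h by (simp add: power2_eq_square)
    also have "\<dots> \<le> B / h * (1 / (lam * real m))"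
      using B0 h b0 by (intro mult_left_mono) auto
    also have "\<dots> = B / lam / (real m * h)" by (simp add: mult_ac)
    finally show ?thesis .
  qed
  have supp: "w j = 0" if "h < \<bar>\<tau> j - t\<bar>" for j
  proof -
    have "h < h * \<bar>x j\<bar>" using that h unfolding x by (simp add: abs_mult)
    then have "1 < \<bar>x j\<bar>" using h by simp
    then show ?thesis using K(3) by (simp add: w_def)
  qed
  show ?thesis using w rep supp s1 s2 by blast
qed

section \<open>Mean squared error at a fixed design\<close>

text \<open>The functional annihilates the Taylor polynomial of degree less than \<open>q\<close> at \<open>t\<close>; only remainders of
  size \<open>C h\<^sup>q\<close> are left.\<close>

lemma local_poly_error:
  fixes \<tau> w :: "'j \<Rightarrow> real" and D :: "nat \<Rightarrow> real \<Rightarrow> real"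
  assumes J: "finite J" "\<And>j. j \<in> J \<Longrightarrow> \<tau> j \<in> {l<..<u}" "\<And>j. j \<in> J \<Longrightarrow> \<bar>\<tau> j - t\<bar> \<le> h"
    and t: "t \<in> {l<..<u}" and q: "0 < q"
    and rep: "\<And>r. r < q \<Longrightarrow> (\<Sum>j\<in>J. w j * (\<tau> j - t) ^ r) = (if r = 0 then 1 else 0)"
    and D: "\<And>j x. j < q \<Longrightarrow> x \<in> {l<..<u} \<Longrightarrow> (D j has_real_derivative D (Suc j) x) (at x)"
    and C: "\<And>x. x \<in> {l<..<u} \<Longrightarrow> \<bar>D q x\<bar> \<le> C"
  shows "\<bar>(\<Sum>j\<in>J. w j * D 0 (\<tau> j)) - D 0 t\<bar> \<le> (\<Sum>j\<in>J. \<bar>w j\<bar>) * (C * h ^ q)"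
proof -
  define R where "R j = D 0 (\<tau> j) - (\<Sum>r<q. D r t / fact r * (\<tau> j - t) ^ r)" for j
  have C0: "0 \<le> C" using C[OF t] by linarith
  have R: "\<bar>R j\<bar> \<le> C * h ^ q" if j: "j \<in> J" for j
  proof (cases "\<tau> j = t")
    case True
    have "(\<Sum>r<q. D r t / fact r * (\<tau> j - t) ^ r) = (\<Sum>r<q. if r = 0 then D r t else 0)"
      by (intro sum.cong refl) (auto simp: True)
    also have "\<dots> = D 0 t" using q by (simp only: sum.delta finite_lessThan lessThan_iff) simp
    finally have "R j = 0" by (simp add: R_def True)
    moreover have "0 \<le> h" using J(3)[OF j] by linarith
    ultimately show ?thesis using C0 by simp
  next
    case False
    have "\<exists>s. (if \<tau> j < t then \<tau> j < s \<and> s < t else t < s \<and> s < \<tau> j) \<and>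
        D 0 (\<tau> j) = (\<Sum>r<q. D r t / fact r * (\<tau> j - t) ^ r) + D q s / fact q * (\<tau> j - t) ^ q"
      by (rule Taylor[OF q refl, where a="min t (\<tau> j)" and b="max t (\<tau> j)"])
        (use False J(2)[OF j] t in \<open>auto intro!: D simp: min_def max_def split: if_splits\<close>)
    then obtain s where s': "if \<tau> j < t then \<tau> j < s \<and> s < t else t < s \<and> s < \<tau> j"
        and Rj: "D 0 (\<tau> j) = (\<Sum>r<q. D r t / fact r * (\<tau> j - t) ^ r) + D q s / fact q * (\<tau> j - t) ^ q"
      by blast
    have s: "s \<in> {l<..<u}" "R j = D q s / fact q * (\<tau> j - t) ^ q"
      using J(2)[OF j] t s' Rj unfolding R_def by (auto split: if_splits)
    have "\<bar>R j\<bar> = \<bar>D q s\<bar> / fact q * \<bar>\<tau> j - t\<bar> ^ q" unfolding s(2) by (simp add: abs_mult power_abs)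
    also have "\<dots> \<le> C * h ^ q"
    proof (rule mult_mono)
      have "\<bar>D q s\<bar> / fact q \<le> \<bar>D q s\<bar> / 1"
        by (rule divide_left_mono) (auto simp: fact_ge_1)
      then show "\<bar>D q s\<bar> / fact q \<le> C" using C[OF s(1)] by simp
      show "\<bar>\<tau> j - t\<bar> ^ q \<le> h ^ q" using J(3)[OF j] by (intro power_mono) auto
    qed (use C0 in auto)
    finally show ?thesis .
  qed
  have "(\<Sum>j\<in>J. w j * D 0 (\<tau> j)) =
      (\<Sum>j\<in>J. \<Sum>r<q. D r t / fact r * (w j * (\<tau> j - t) ^ r)) + (\<Sum>j\<in>J. w j * R j)"
    unfolding sum.distrib[symmetric] by (intro sum.cong refl) (simp add: R_def sum_distrib_left algebra_simps)
  also have "(\<Sum>j\<in>J. \<Sum>r<q. D r t / fact r * (w j * (\<tau> j - t) ^ r)) =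
      (\<Sum>r<q. \<Sum>j\<in>J. D r t / fact r * (w j * (\<tau> j - t) ^ r))" by (rule sum.swap)
  also have "\<dots> = (\<Sum>r<q. if r = 0 then D r t else 0)"
    unfolding sum_distrib_left[symmetric] by (intro sum.cong refl) (simp add: rep)
  also have "\<dots> = D 0 t" using q by (simp only: sum.delta finite_lessThan lessThan_iff) simp
  finally have "\<bar>(\<Sum>j\<in>J. w j * D 0 (\<tau> j)) - D 0 t\<bar> = \<bar>\<Sum>j\<in>J. w j * R j\<bar>" by simp
  also have "\<dots> \<le> (\<Sum>j\<in>J. \<bar>w j\<bar> * (C * h ^ q))"
    by (intro order_trans[OF sum_abs] sum_mono) (simp add: abs_mult R mult_left_mono)
  finally show ?thesis by (simp add: sum_distrib_right)
qed

text \<open>The left-hand side is the tensor square of the functional \<open>\<Sum>\<^sub>j w\<^sub>j f(\<tau>\<^sub>j) - f(t)\<close>, applied to \<open>G 0 0\<close>. Applying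
  the functional in the second argument gives a function of the first argument whose derivative of
  order \<open>q\<close> is already small; applying it in the first argument gains the second factor \<open>h\<^sup>q\<close>.\<close>

lemma local_poly_cov_error:
  fixes \<tau> w :: "'j \<Rightarrow> real" and G :: "nat \<Rightarrow> nat \<Rightarrow> real \<Rightarrow> real \<Rightarrow> real"
  assumes J: "finite J" "\<And>j. j \<in> J \<Longrightarrow> \<tau> j \<in> {l<..<u}" "\<And>j. j \<in> J \<Longrightarrow> \<bar>\<tau> j - t\<bar> \<le> h"
    and t: "t \<in> {l<..<u}" and q: "0 < q"
    and rep: "\<And>r. r < q \<Longrightarrow> (\<Sum>j\<in>J. w j * (\<tau> j - t) ^ r) = (if r = 0 then 1 else 0)"
    and G1: "\<And>j x y. j < q \<Longrightarrow> x \<in> {l<..<u} \<Longrightarrow> y \<in> {l<..<u} \<Longrightarrow>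
      ((\<lambda>x. G j 0 x y) has_real_derivative G (Suc j) 0 x y) (at x)"
    and G2: "\<And>k x y. k < q \<Longrightarrow> x \<in> {l<..<u} \<Longrightarrow> y \<in> {l<..<u} \<Longrightarrow>
      (G q k x has_real_derivative G q (Suc k) x y) (at y)"
    and C: "\<And>x y. x \<in> {l<..<u} \<Longrightarrow> y \<in> {l<..<u} \<Longrightarrow> \<bar>G q q x y\<bar> \<le> C"
  shows "\<bar>(\<Sum>j\<in>J. w j * ((\<Sum>l\<in>J. w l * G 0 0 (\<tau> j) (\<tau> l)) - G 0 0 (\<tau> j) t)) -
      ((\<Sum>l\<in>J. w l * G 0 0 t (\<tau> l)) - G 0 0 t t)\<bar> \<le> ((\<Sum>j\<in>J. \<bar>w j\<bar>) * h ^ q)\<^sup>2 * C"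
proof -
  define D where "D k x = (\<Sum>l\<in>J. w l * G k 0 x (\<tau> l)) - G k 0 x t" for k x
  have "\<bar>(\<Sum>j\<in>J. w j * D 0 (\<tau> j)) - D 0 t\<bar> \<le>
      (\<Sum>j\<in>J. \<bar>w j\<bar>) * (((\<Sum>j\<in>J. \<bar>w j\<bar>) * (C * h ^ q)) * h ^ q)"
  proof (rule local_poly_error[OF J t q rep])
    fix k x assume k: "k < q" "x \<in> {l<..<u}"
    show "(D k has_real_derivative D (Suc k) x) (at x)"
      unfolding D_def[abs_def]
      by (intro DERIV_diff DERIV_sum DERIV_cmult G1 k J t)
  next
    fix x assume x: "x \<in> {l<..<u}"
    show "\<bar>D q x\<bar> \<le> (\<Sum>j\<in>J. \<bar>w j\<bar>) * (C * h ^ q)"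
      unfolding D_def by (rule local_poly_error[OF J t q rep]) (use x G2 C in auto)
  qed auto
  then show ?thesis unfolding D_def by (simp add: power2_eq_square mult_ac)
qed

text \<open>The error is the sum of a deterministic bias, the smoothing error of \<open>v\<close> and a weighted noise term.
  Injectivity of the design removes the mixed products of the noise.\<close>

lemma fixed_design_mse:
  fixes \<tau> w :: "'j \<Rightarrow> real" and G :: "nat \<Rightarrow> nat \<Rightarrow> real \<Rightarrow> real \<Rightarrow> real"
    and v e :: "real \<Rightarrow> 'a \<Rightarrow> real"
  assumes J: "finite J" "\<And>j. j \<in> J \<Longrightarrow> \<tau> j \<in> {l<..<u}" "\<And>j. j \<in> J \<Longrightarrow> \<bar>\<tau> j - t\<bar> \<le> h"
    and inj: "inj_on \<tau> J"
    and t: "t \<in> {l<..<u}" and q: "0 < q"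
    and rep: "\<And>r. r < q \<Longrightarrow> (\<Sum>j\<in>J. w j * (\<tau> j - t) ^ r) = (if r = 0 then 1 else 0)"
    and D: "\<And>j x. j < q \<Longrightarrow> x \<in> {l<..<u} \<Longrightarrow> (D j has_real_derivative D (Suc j) x) (at x)"
    and CD: "\<And>x. x \<in> {l<..<u} \<Longrightarrow> \<bar>D q x\<bar> \<le> C"
    and G1: "\<And>j x y. j < q \<Longrightarrow> x \<in> {l<..<u} \<Longrightarrow> y \<in> {l<..<u} \<Longrightarrow>
      ((\<lambda>x. G j 0 x y) has_real_derivative G (Suc j) 0 x y) (at x)"
    and G2: "\<And>k x y. k < q \<Longrightarrow> x \<in> {l<..<u} \<Longrightarrow> y \<in> {l<..<u} \<Longrightarrow>
      (G q k x has_real_derivative G q (Suc k) x y) (at y)"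
    and CG: "\<And>x y. x \<in> {l<..<u} \<Longrightarrow> y \<in> {l<..<u} \<Longrightarrow> \<bar>G q q x y\<bar> \<le> C'"
    and v: "\<And>x y. x \<in> {l<..<u} \<Longrightarrow> y \<in> {l<..<u} \<Longrightarrow> has_bochner_integral M (\<lambda>\<omega>. v x \<omega> * v y \<omega>) (G 0 0 x y)"
    and e: "\<And>x y. x \<in> {l<..<u} \<Longrightarrow> y \<in> {l<..<u} \<Longrightarrow>
      has_bochner_integral M (\<lambda>\<omega>. e x \<omega> * e y \<omega>) (if x = y then S x else 0)"
    and CS: "\<And>x. x \<in> {l<..<u} \<Longrightarrow> S x \<le> C''"
    and M: "prob_space M"
  shows "(\<integral>\<^sup>+\<omega>. ennreal (((\<Sum>j\<in>J. w j * (D 0 (\<tau> j) + v (\<tau> j) \<omega> + e (\<tau> j) \<omega>)) - D 0 t - v t \<omega>)\<^sup>2) \<partial>M) \<le>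
    ennreal (3 * (((\<Sum>j\<in>J. \<bar>w j\<bar>) * h ^ q)\<^sup>2 * (C\<^sup>2 + C') + C'' * (\<Sum>j\<in>J. (w j)\<^sup>2)))"
proof -
  interpret prob_space M by fact
  define A where "A = (\<Sum>j\<in>J. \<bar>w j\<bar>)"
  define B where "B = (\<Sum>j\<in>J. w j * D 0 (\<tau> j)) - D 0 t"
  define V where "V \<omega> = (\<Sum>j\<in>J. w j * v (\<tau> j) \<omega>) - v t \<omega>" for \<omega>
  define E where "E \<omega> = (\<Sum>j\<in>J. w j * e (\<tau> j) \<omega>)" for \<omega>
  define V2 where "V2 = (\<Sum>j\<in>J. w j * ((\<Sum>l\<in>J. w l * G 0 0 (\<tau> j) (\<tau> l)) - G 0 0 (\<tau> j) t)) -
      ((\<Sum>l\<in>J. w l * G 0 0 t (\<tau> l)) - G 0 0 t t)"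
  have "\<bar>B\<bar> \<le> A * (C * h ^ q)"
    unfolding A_def B_def by (rule local_poly_error[OF J t q rep D CD])
  then have B2: "B\<^sup>2 \<le> (A * h ^ q)\<^sup>2 * C\<^sup>2"
    using abs_le_square_iff[of B "A * (C * h ^ q)"] by (simp add: power_mult_distrib mult_ac abs_le_iff)
  have iV: "has_bochner_integral M (\<lambda>\<omega>. (V \<omega>)\<^sup>2) V2"
  proof -
    have "(V \<omega>)\<^sup>2 = (\<Sum>j\<in>J. w j * ((\<Sum>l\<in>J. w l * (v (\<tau> j) \<omega> * v (\<tau> l) \<omega>)) - v (\<tau> j) \<omega> * v t \<omega>)) -
      ((\<Sum>l\<in>J. w l * (v t \<omega> * v (\<tau> l) \<omega>)) - v t \<omega> * v t \<omega>)" for \<omega>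
      unfolding V_def power2_eq_square right_diff_distrib left_diff_distrib sum_distrib_left sum_distrib_right sum_subtractf
      by (simp add: mult_ac sum_distrib_left[symmetric])
    moreover have "has_bochner_integral M (\<lambda>\<omega>. (\<Sum>j\<in>J. w j * ((\<Sum>l\<in>J. w l * (v (\<tau> j) \<omega> * v (\<tau> l) \<omega>)) - v (\<tau> j) \<omega> * v t \<omega>)) -
      ((\<Sum>l\<in>J. w l * (v t \<omega> * v (\<tau> l) \<omega>)) - v t \<omega> * v t \<omega>)) V2"
      unfolding V2_def
      by (intro has_bochner_integral_diff has_bochner_integral_sum has_bochner_integral_mult_right v J t)
    ultimately show ?thesis by simp
  qed
  have V2: "V2 \<le> (A * h ^ q)\<^sup>2 * C'"
    using local_poly_cov_error[OF J t q rep G1 G2 CG] unfolding A_def V2_def by linarith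
  have iE: "has_bochner_integral M (\<lambda>\<omega>. (E \<omega>)\<^sup>2) (\<Sum>j\<in>J. (w j)\<^sup>2 * S (\<tau> j))"
  proof -
    have 1: "(E \<omega>)\<^sup>2 = (\<Sum>j\<in>J. \<Sum>l\<in>J. w j * w l * (e (\<tau> j) \<omega> * e (\<tau> l) \<omega>))" for \<omega>
      unfolding E_def power2_eq_square sum_product by (intro sum.cong refl) (simp add: mult_ac)
    have "has_bochner_integral M (\<lambda>\<omega>. \<Sum>j\<in>J. \<Sum>l\<in>J. w j * w l * (e (\<tau> j) \<omega> * e (\<tau> l) \<omega>))
        (\<Sum>j\<in>J. \<Sum>l\<in>J. w j * w l * (if \<tau> j = \<tau> l then S (\<tau> j) else 0))"
      by (intro has_bochner_integral_sum has_bochner_integral_mult_right e J)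
    moreover have "(\<Sum>l\<in>J. w j * w l * (if \<tau> j = \<tau> l then S (\<tau> j) else 0)) = (w j)\<^sup>2 * S (\<tau> j)" if "j \<in> J" for j
    proof -
      have "(\<Sum>l\<in>J. w j * w l * (if \<tau> j = \<tau> l then S (\<tau> j) else 0)) = (\<Sum>l\<in>J. if l = j then (w j)\<^sup>2 * S (\<tau> j) else 0)"
        by (intro sum.cong refl) (use inj that in \<open>auto simp: inj_on_def power2_eq_square\<close>)
      then show ?thesis using that J(1) by (simp only: sum.delta) simp
    qed
    ultimately show ?thesis unfolding 1 by simp
  qed
  have E2: "(\<Sum>j\<in>J. (w j)\<^sup>2 * S (\<tau> j)) \<le> C'' * (\<Sum>j\<in>J. (w j)\<^sup>2)"
    unfolding sum_distrib_left
  proof (rule sum_mono)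
    fix j assume "j \<in> J"
    then show "(w j)\<^sup>2 * S (\<tau> j) \<le> C'' * (w j)\<^sup>2"
      unfolding mult.commute[of C''] by (intro mult_left_mono CS J) auto
  qed
  have split: "(\<Sum>j\<in>J. w j * (D 0 (\<tau> j) + v (\<tau> j) \<omega> + e (\<tau> j) \<omega>)) - D 0 t - v t \<omega> = B + V \<omega> + E \<omega>" for \<omega>
    by (simp add: B_def V_def E_def distrib_left sum.distrib)
  have three: "(x + y + z)\<^sup>2 \<le> 3 * (x\<^sup>2 + y\<^sup>2 + z\<^sup>2)" for x y z :: real
  proof -
    have "3 * (x\<^sup>2 + y\<^sup>2 + z\<^sup>2) - (x + y + z)\<^sup>2 = (x - y)\<^sup>2 + (y - z)\<^sup>2 + (x - z)\<^sup>2"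
      by (simp add: power2_eq_square algebra_simps)
    then show ?thesis by (metis add_nonneg_nonneg diff_ge_0_iff_ge zero_le_power2)
  qed
  have "(\<integral>\<^sup>+\<omega>. ennreal ((B + V \<omega> + E \<omega>)\<^sup>2) \<partial>M) \<le> (\<integral>\<^sup>+\<omega>. ennreal (3 * (B\<^sup>2 + (V \<omega>)\<^sup>2 + (E \<omega>)\<^sup>2)) \<partial>M)"
    by (intro nn_integral_mono ennreal_leI three)
  also have "\<dots> = ennreal (3 * (B\<^sup>2 + V2 + (\<Sum>j\<in>J. (w j)\<^sup>2 * S (\<tau> j))))"
  proof (rule nn_integral_eq_integral[THEN trans])
    have "has_bochner_integral M (\<lambda>\<omega>. 3 * (B\<^sup>2 + (V \<omega>)\<^sup>2 + (E \<omega>)\<^sup>2)) (3 * (B\<^sup>2 + V2 + (\<Sum>j\<in>J. (w j)\<^sup>2 * S (\<tau> j))))"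
    proof -
      have "has_bochner_integral M (\<lambda>_. B\<^sup>2) (B\<^sup>2)" by (simp add: has_bochner_integral_iff prob_space)
      then show ?thesis by (intro has_bochner_integral_mult_right has_bochner_integral_add iV iE)
    qed
    then show "integrable M (\<lambda>\<omega>. 3 * (B\<^sup>2 + (V \<omega>)\<^sup>2 + (E \<omega>)\<^sup>2))"
      "ennreal (\<integral>\<omega>. 3 * (B\<^sup>2 + (V \<omega>)\<^sup>2 + (E \<omega>)\<^sup>2) \<partial>M) = ennreal (3 * (B\<^sup>2 + V2 + (\<Sum>j\<in>J. (w j)\<^sup>2 * S (\<tau> j))))"
      by (simp_all only: has_bochner_integral_iff)
  qed simp
  also have "\<dots> \<le> ennreal (3 * ((A * h ^ q)\<^sup>2 * (C\<^sup>2 + C') + C'' * (\<Sum>j\<in>J. (w j)\<^sup>2)))"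
    by (intro ennreal_leI) (use B2 V2 E2 in \<open>simp add: distrib_left\<close>)
  finally show ?thesis unfolding split A_def .
qed

section \<open>Positivity of the population normal matrix\<close>

lemma kernel_times_bounded_integrable:
  assumes K: "kernel_condition K" and [measurable]: "f \<in> borel_measurable borel"
    and b: "\<And>u. \<bar>u\<bar> \<le> 1 \<Longrightarrow> \<bar>f u\<bar> \<le> (b::real)"
  shows "integrable lborel (\<lambda>u. K u * f u)"
proof (rule Bochner_Integration.integrable_bound[where f="\<lambda>u. b * K u"])
  have [measurable]: "K \<in> borel_measurable borel" and K0: "\<And>u. 0 \<le> K u" "\<And>u. \<bar>u\<bar> > 1 \<Longrightarrow> K u = 0"
    using K by (auto simp: kernel_condition_def)
  show "integrable lborel (\<lambda>u. b * K u)"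
    using K by (intro integrable_mult_right) (auto simp: kernel_condition_def has_bochner_integral_iff)
  show "(\<lambda>u. K u * f u) \<in> borel_measurable lborel" by measurable
  have "\<bar>K u * f u\<bar> \<le> \<bar>b * K u\<bar>" for u
  proof (cases "\<bar>u\<bar> \<le> 1")
    case True
    then have "\<bar>f u\<bar> \<le> \<bar>b\<bar>" using b[of u] by linarith
    then show ?thesis using K0(1)[of u] by (simp add: abs_mult mult.commute[of "K u"] mult_right_mono)
  qed (use K0 in auto)
  then show "AE u in lborel. norm (K u * f u) \<le> norm (b * K u)" by auto
qed

lemma power_abs_le_1: "\<bar>u\<bar> \<le> 1 \<Longrightarrow> \<bar>u ^ k\<bar> \<le> (1::real)"
  by (simp add: power_abs power_le_one)

lemma poly_sum_bound:
  fixes a :: "nat \<Rightarrow> real"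
  assumes "\<bar>u\<bar> \<le> 1"
  shows "(\<Sum>r<n. a r * u ^ r)\<^sup>2 \<le> (\<Sum>r<n. \<bar>a r\<bar>)\<^sup>2"
proof -
  have "\<bar>\<Sum>r<n. a r * u ^ r\<bar> \<le> (\<Sum>r<n. \<bar>a r\<bar>)"
    by (intro order_trans[OF sum_abs] sum_mono)
      (use power_abs_le_1[OF assms] in \<open>simp add: abs_mult mult_left_le\<close>)
  then show ?thesis by (metis abs_ge_zero power2_abs power_mono)
qed

lemma mult_poly_square:
  fixes a :: "nat \<Rightarrow> real"
  shows "c * (\<Sum>r<n. a r * u ^ r)\<^sup>2 = (\<Sum>r<n. \<Sum>s<n. a r * a s * (c * u ^ (r + s)))"
proof -
  have "(\<Sum>r<n. a r * u ^ r)\<^sup>2 = (\<Sum>r<n. \<Sum>s<n. a r * u ^ r * (a s * u ^ s))"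
    unfolding power2_eq_square sum_product ..
  then show ?thesis by (simp add: sum_distrib_left power_add mult_ac)
qed

text \<open>By symmetry a kernel vanishing on one half line would vanish on both.\<close>

lemma kernel_half_mass:
  assumes K: "kernel_condition K" and A: "A = {0<..} \<or> A = {..<0::real}"
  shows "\<not> (AE u in lborel. indicator A u * K u = 0)"
proof
  assume ae: "AE u in lborel. indicator A u * K u = 0"
  have Km[measurable]: "K \<in> borel_measurable borel" and Ks: "\<And>u. K (- u) = K u"
    and K1: "(\<integral>u. K u \<partial>lborel) = 1"
    using K by (auto simp: kernel_condition_def has_bochner_integral_iff)
  have [measurable]: "A \<in> sets borel" using A by auto
  have "AE u in distr lborel borel uminus. indicator A u * K u = 0"
    using ae unfolding lborel_distr_uminus .
  then have ae': "AE u in lborel. indicator A (- u) * K u = 0"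
    by (subst (asm) AE_distr_iff) (auto simp: Ks)
  have "AE u in lborel. u \<noteq> (0::real)" by (rule AE_lborel_singleton)
  then have "AE u in lborel. K u = 0"
    using ae ae' by eventually_elim (use A in \<open>auto split: split_indicator_asm\<close>)
  then have "(\<integral>u. K u \<partial>lborel) = 0" by (rule integral_eq_zero_AE)
  then show False using K1 by simp
qed

text \<open>The form is positive off the origin, since a nonzero polynomial has finitely many roots while the
  kernel carries mass on the half line. It therefore attains a positive minimum on the unit sphere.\<close>

lemma half_kernel_form_pos:
  assumes n: "0 < n" and K: "kernel_condition K" and A: "A = {0<..} \<or> A = {..<0::real}"
  shows "\<exists>lam>0. \<forall>a. lam * (\<Sum>r<n. (a r)\<^sup>2) \<le>
    (\<integral>u. indicator A u * (K u * (\<Sum>r<n. a r * u ^ r)\<^sup>2) \<partial>lborel)"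
proof -
  have Km[measurable]: "K \<in> borel_measurable borel" and K0: "\<And>u. 0 \<le> K u"
    using K by (auto simp: kernel_condition_def)
  have Am[measurable]: "A \<in> sets borel" using A by auto
  define Mk where "Mk k = (\<integral>u. indicator A u * (K u * u ^ k) \<partial>lborel)" for k
  define Q where "Q a = (\<Sum>r<n. \<Sum>s<n. a r * a s * Mk (r + s))" for a
  have ik: "integrable lborel (\<lambda>u. indicator A u * (K u * u ^ k))" for k
  proof -
    have "integrable lborel (\<lambda>u. K u * (indicator A u * u ^ k))"
      by (rule kernel_times_bounded_integrable[OF K, where b=1])
        (auto simp: power_abs_le_1 split: split_indicator)
    then show ?thesis by (simp add: mult_ac)
  qed
  have Q: "Q a = (\<integral>u. indicator A u * (K u * (\<Sum>r<n. a r * u ^ r)\<^sup>2) \<partial>lborel)" for a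
  proof -
    have "indicator A u * (K u * (\<Sum>r<n. a r * u ^ r)\<^sup>2) =
        (\<Sum>r<n. \<Sum>s<n. a r * a s * (indicator A u * (K u * u ^ (r + s))))" for u
      unfolding mult.assoc[symmetric, of "indicator A u" "K u"] by (simp add: mult_poly_square mult.assoc)
    moreover have "(\<integral>u. (\<Sum>r<n. \<Sum>s<n. a r * a s * (indicator A u * (K u * u ^ (r + s)))) \<partial>lborel) = Q a"
      unfolding Q_def Mk_def
      by (subst Bochner_Integration.integral_sum, intro Bochner_Integration.integrable_sum integrable_mult_right ik,
        intro sum.cong refl, subst Bochner_Integration.integral_sum, intro integrable_mult_right ik,
        intro sum.cong refl integral_mult_right_zero)
    ultimately show ?thesis by simp
  qed
  have Qpos: "0 < Q a" if "r0 < n" "a r0 \<noteq> 0" for a r0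
  proof -
    let ?f = "\<lambda>u. indicator A u * (K u * (\<Sum>r<n. a r * u ^ r)\<^sup>2)"
    have f0: "0 \<le> ?f u" for u using K0 by (auto split: split_indicator)
    have "integrable lborel (\<lambda>u. K u * (indicator A u * (\<Sum>r<n. a r * u ^ r)\<^sup>2))"
      by (rule kernel_times_bounded_integrable[OF K, where b="(\<Sum>r<n. \<bar>a r\<bar>)\<^sup>2"])
        (use poly_sum_bound[of _ a n] in \<open>auto simp del: sum.lessThan_Suc split: split_indicator\<close>)
    then have fi: "integrable lborel ?f" by (simp only: mult.left_commute)
    obtain p where p: "n = Suc p" using n by (cases n) auto
    have "Q a \<noteq> 0"
    proof
      assume "Q a = 0"
      then have "AE u in lborel. ?f u = 0"
        unfolding Q using fi f0 by (subst (asm) integral_nonneg_eq_0_iff_AE) auto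
      moreover have "AE u in lborel. u \<notin> {u. (\<Sum>r\<le>p. a r * u ^ r) = 0}"
      proof (rule AE_not_in)
        have "finite {u. (\<Sum>r\<le>p. a r * u ^ r) = 0}"
          using that by (subst polyfun_finite_roots) (auto simp: less_Suc_eq_le p)
        then show "{u. (\<Sum>r\<le>p. a r * u ^ r) = 0} \<in> null_sets lborel"
          by (rule finite_imp_null_set_lborel)
      qed
      ultimately have "AE u in lborel. indicator A u * K u = 0"
        by eventually_elim (auto simp: p lessThan_Suc_atMost simp del: sum.lessThan_Suc sum.atMost_Suc split: split_indicator_asm)
      then show False using kernel_half_mass[OF K A] by contradiction
    qed
    moreover have "0 \<le> Q a" unfolding Q by (rule integral_nonneg_AE) (use f0 in auto)
    ultimately show ?thesis by simp
  qed
  define S where "S = PiE UNIV (\<lambda>r. if r < n then {- 1..1} else {0::real}) \<inter> {x. (\<Sum>r<n. (x r)\<^sup>2) = 1}"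
  have "compactin (product_topology (\<lambda>_::nat. euclidean) UNIV) (PiE UNIV (\<lambda>r. if r < n then {- 1..1} else {0::real}))"
    unfolding compactin_PiE by (auto simp: compactin_euclidean_iff)
  then have "compact (PiE UNIV (\<lambda>r. if r < n then {- 1..1} else {0::real}))"
    by (simp add: euclidean_product_topology compactin_euclidean_iff)
  moreover have "closed {x::nat\<Rightarrow>real. (\<Sum>r<n. (x r)\<^sup>2) = 1}"
    by (intro closed_Collect_eq continuous_on_sum continuous_on_power continuous_on_product_coordinates continuous_on_const)
  ultimately have S: "compact S" unfolding S_def by (rule compact_Int_closed)
  have "(\<lambda>r. if r = 0 then 1 else 0) \<in> S"
  proof -
    have "(\<Sum>r<n. (if r = 0 then 1 else 0::real)\<^sup>2) = (\<Sum>r<n. if r = 0 then 1 else 0)"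
      by (intro sum.cong) auto
    then show ?thesis unfolding S_def using n by (auto simp del: sum.lessThan_Suc)
  qed
  then have "S \<noteq> {}" by blast
  moreover have "continuous_on S Q"
    unfolding Q_def
    by (intro continuous_on_sum continuous_on_mult continuous_on_const continuous_on_subset[OF continuous_on_product_coordinates]) auto
  ultimately obtain x0 where x0: "x0 \<in> S" "\<And>x. x \<in> S \<Longrightarrow> Q x0 \<le> Q x"
    using continuous_attains_inf[OF S] by blast
  have "\<exists>r0<n. x0 r0 \<noteq> 0"
  proof (rule ccontr)
    assume "\<not> ?thesis"
    then have "(\<Sum>r<n. (x0 r)\<^sup>2) = 0" by (intro sum.neutral) auto
    then show False using x0(1) by (simp add: S_def)
  qed
  then have lam: "0 < Q x0" using Qpos by blast
  have "Q x0 * (\<Sum>r<n. (a r)\<^sup>2) \<le> Q a" for a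
  proof (cases "\<exists>r0<n. a r0 \<noteq> 0")
    case False
    then have "(\<Sum>r<n. (a r)\<^sup>2) = 0" "Q a = 0" unfolding Q_def by (auto intro!: sum.neutral)
    then show ?thesis by simp
  next
    case True
    define nrm where "nrm = sqrt (\<Sum>r<n. (a r)\<^sup>2)"
    have nrm2: "nrm\<^sup>2 = (\<Sum>r<n. (a r)\<^sup>2)" unfolding nrm_def by (intro real_sqrt_pow2 sum_nonneg) simp
    have ar: "(a r)\<^sup>2 \<le> nrm\<^sup>2" if "r < n" for r
      unfolding nrm2 using that by (intro member_le_sum) auto
    obtain r0 where "r0 < n" "a r0 \<noteq> 0" using True by blast
    then have "0 < nrm\<^sup>2" using ar[of r0] by (meson less_le_trans zero_less_power2)
    moreover have "0 \<le> nrm" unfolding nrm_def by (intro real_sqrt_ge_zero sum_nonneg) simp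
    ultimately have nrm: "0 < nrm" by (simp add: less_le)
    define z where "z r = (if r < n then a r / nrm else 0)" for r
    have "z \<in> S"
    proof -
      have "(\<Sum>r<n. (z r)\<^sup>2) = (\<Sum>r<n. (a r)\<^sup>2 / nrm\<^sup>2)"
        by (intro sum.cong refl) (simp add: z_def power_divide)
      also have "\<dots> = 1" using nrm by (simp only: sum_divide_distrib[symmetric] nrm2[symmetric]) simp
      finally have 1: "(\<Sum>r<n. (z r)\<^sup>2) = 1" .
      have "z r \<in> (if r < n then {- 1..1} else {0})" for r
      proof (cases "r < n")
        case True
        then have "\<bar>a r\<bar> \<le> nrm" using ar[OF True] nrm by (metis abs_le_square_iff abs_of_pos)
        then have "\<bar>a r / nrm\<bar> \<le> 1" using nrm by simp
        then show ?thesis using True by (simp only: z_def if_True abs_le_iff) auto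
      qed (simp add: z_def)
      then show ?thesis using 1 unfolding S_def by blast
    qed
    then have "Q x0 \<le> Q z" by (rule x0(2))
    also have "Q z = Q a / nrm\<^sup>2"
      unfolding Q_def sum_divide_distrib by (intro sum.cong refl) (simp add: z_def power2_eq_square)
    finally show ?thesis using nrm by (simp only: nrm2[symmetric] pos_le_divide_eq zero_less_power)
  qed
  then show ?thesis using lam unfolding Q by blast
qed

lemma half_kernel_form:
  assumes n: "0 < n" and K: "kernel_condition K"
  obtains lam where "lam > 0" "\<And>a A. A = {0<..} \<or> A = {..<0::real} \<Longrightarrow> lam * (\<Sum>r<n. (a r)\<^sup>2) \<le>
    (\<integral>u. indicator A u * (K u * (\<Sum>r<n. a r * u ^ r)\<^sup>2) \<partial>lborel)"
proof -
  obtain l1 l2 where l: "l1 > 0" "l2 > 0"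
    "\<And>a. l1 * (\<Sum>r<n. (a r)\<^sup>2) \<le> (\<integral>u. indicator {0<..} u * (K u * (\<Sum>r<n. a r * u ^ r)\<^sup>2) \<partial>lborel)"
    "\<And>a. l2 * (\<Sum>r<n. (a r)\<^sup>2) \<le> (\<integral>u. indicator {..<0} u * (K u * (\<Sum>r<n. a r * u ^ r)\<^sup>2) \<partial>lborel)"
    using half_kernel_form_pos[OF n K, of "{0<..}"] half_kernel_form_pos[OF n K, of "{..<0}"] by blast
  have s: "0 \<le> (\<Sum>r<n. (a r)\<^sup>2)" for a :: "nat \<Rightarrow> real" by (intro sum_nonneg) simp
  have "min l1 l2 * (\<Sum>r<n. (a r)\<^sup>2) \<le> l1 * (\<Sum>r<n. (a r)\<^sup>2)"
    "min l1 l2 * (\<Sum>r<n. (a r)\<^sup>2) \<le> l2 * (\<Sum>r<n. (a r)\<^sup>2)" for a :: "nat \<Rightarrow> real"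
    by (intro mult_right_mono s; simp)+
  note m = this
  show ?thesis
  proof (rule that)
    show "0 < min l1 l2" using l by simp
    fix a :: "nat \<Rightarrow> real" and A :: "real set" assume "A = {0<..} \<or> A = {..<0}"
    then show "min l1 l2 * (\<Sum>r<n. (a r)\<^sup>2) \<le> (\<integral>u. indicator A u * (K u * (\<Sum>r<n. a r * u ^ r)\<^sup>2) \<partial>lborel)"
      using order_trans[OF m(1) l(3)] order_trans[OF m(2) l(4)] by auto
  qed
qed

text \<open>The expectation of \<open>K(x) x\<^sup>k\<close> at \<open>x = (T - t) / h\<close> for a design point \<open>T\<close> with density \<open>\<pi>\<close>.\<close>

definition local_moment :: "(real \<Rightarrow> real) \<Rightarrow> (real \<Rightarrow> real) \<Rightarrow> real \<Rightarrow> real \<Rightarrow> nat \<Rightarrow> real" where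
  "local_moment \<pi> K h t k = (\<integral>x. \<pi> x * (K ((x - t) / h) * ((x - t) / h) ^ k) \<partial>lborel)"

text \<open>After the substitution \<open>x = t + h u\<close>, one half of the window lies in a set where \<open>\<pi>\<close> is at least \<open>c\<close>.
  Restricting the integral of a square to that half bounds the form from below.\<close>

lemma local_moment_form:
  assumes K: "kernel_condition K" and h: "0 < h"
    and [measurable]: "\<pi> \<in> borel_measurable borel" and \<pi>: "\<And>x. 0 \<le> \<pi> x" "\<And>x. \<pi> x \<le> P"
  shows local_moment_0: "local_moment \<pi> K h t 0 \<le> P * h"
    and local_moment_lower: "\<lbrakk>\<And>x. x \<in> I \<Longrightarrow> c \<le> \<pi> x; 0 < c; {t<..t + h} \<subseteq> I \<or> {t - h..<t} \<subseteq> I;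
        \<And>a A. A = {0<..} \<or> A = {..<0::real} \<Longrightarrow> lam * (\<Sum>r<n. (a r)\<^sup>2) \<le>
          (\<integral>u. indicator A u * (K u * (\<Sum>r<n. a r * u ^ r)\<^sup>2) \<partial>lborel)\<rbrakk> \<Longrightarrow>
      c * h * lam * (\<Sum>r<n. (a r)\<^sup>2) \<le> (\<Sum>r<n. \<Sum>s<n. a r * a s * local_moment \<pi> K h t (r + s))"
proof -
  have Km[measurable]: "K \<in> borel_measurable borel" and K0: "\<And>u. 0 \<le> K u" "\<And>u. \<bar>u\<bar> > 1 \<Longrightarrow> K u = 0"
    and K1: "(\<integral>u. K u \<partial>lborel) = 1" and Ki: "integrable lborel K"
    using K by (auto simp: kernel_condition_def has_bochner_integral_iff)
  have aff: "(\<integral>x. f x * g ((x - t) / h) \<partial>lborel) = h * (\<integral>u. f (t + h * u) * g u \<partial>lborel)" for f g :: "real \<Rightarrow> real"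
    using h by (subst lborel_integral_real_affine[where c=h and t=t]) auto
  have int: "integrable lborel (\<lambda>u. \<pi> (t + h * u) * (K u * f u))"
    if [measurable]: "f \<in> borel_measurable borel" and b: "\<And>u. \<bar>u\<bar> \<le> 1 \<Longrightarrow> \<bar>f u\<bar> \<le> b" for f and b :: real
  proof -
    have "integrable lborel (\<lambda>u. K u * (\<pi> (t + h * u) * f u))"
    proof (rule kernel_times_bounded_integrable[OF K, where b="P * b"])
      fix u :: real assume "\<bar>u\<bar> \<le> 1"
      then show "\<bar>\<pi> (t + h * u) * f u\<bar> \<le> P * b"
        unfolding abs_mult using \<pi> b[of u] by (intro mult_mono) (auto intro: order_trans)
    qed measurable
    then show ?thesis by (simp add: mult_ac)
  qed
  have lm: "local_moment \<pi> K h t k = h * (\<integral>u. \<pi> (t + h * u) * (K u * u ^ k) \<partial>lborel)" for k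
    unfolding local_moment_def using aff[of \<pi> "\<lambda>u. K u * u ^ k"] .
  show "local_moment \<pi> K h t 0 \<le> P * h"
  proof -
    have "(\<integral>u. \<pi> (t + h * u) * (K u * u ^ 0) \<partial>lborel) \<le> (\<integral>u. P * K u \<partial>lborel)"
      using \<pi> K0 Ki by (intro integral_mono int[where b=1] integrable_mult_right) (auto intro: mult_right_mono)
    then show ?thesis unfolding lm using K1 h by (simp add: mult.commute)
  qed
  show "c * h * lam * (\<Sum>r<n. (a r)\<^sup>2) \<le> (\<Sum>r<n. \<Sum>s<n. a r * a s * local_moment \<pi> K h t (r + s))"
    if c: "\<And>x. x \<in> I \<Longrightarrow> c \<le> \<pi> x" "0 < c" and I: "{t<..t + h} \<subseteq> I \<or> {t - h..<t} \<subseteq> I"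
      and lam: "\<And>a A. A = {0<..} \<or> A = {..<0::real} \<Longrightarrow> lam * (\<Sum>r<n. (a r)\<^sup>2) \<le>
          (\<integral>u. indicator A u * (K u * (\<Sum>r<n. a r * u ^ r)\<^sup>2) \<partial>lborel)"
  proof -
    define q where "q u = (\<Sum>r<n. a r * u ^ r)\<^sup>2" for u
    have qm[measurable]: "q \<in> borel_measurable borel" unfolding q_def by measurable
    have q0: "0 \<le> q u" for u by (simp add: q_def)
    have qb: "\<bar>q u\<bar> \<le> (\<Sum>r<n. \<bar>a r\<bar>)\<^sup>2" if "\<bar>u\<bar> \<le> 1" for u
      using poly_sum_bound[OF that, of a n] q0[of u] by (simp only: q_def abs_of_nonneg)
    have "(\<Sum>r<n. \<Sum>s<n. a r * a s * local_moment \<pi> K h t (r + s)) =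
        h * (\<integral>u. \<pi> (t + h * u) * (K u * q u) \<partial>lborel)"
    proof -
      have "\<pi> (t + h * u) * (K u * q u) =
         (\<Sum>r<n. \<Sum>s<n. a r * a s * (\<pi> (t + h * u) * (K u * u ^ (r + s))))" for u
        unfolding q_def mult.assoc[symmetric, of "\<pi> (t + h * u)" "K u"] by (simp add: mult_poly_square mult.assoc)
      moreover have "(\<integral>u. (\<Sum>r<n. \<Sum>s<n. a r * a s * (\<pi> (t + h * u) * (K u * u ^ (r + s)))) \<partial>lborel) =
         (\<Sum>r<n. \<Sum>s<n. a r * a s * (\<integral>u. \<pi> (t + h * u) * (K u * u ^ (r + s)) \<partial>lborel))"
      proof -
        have i: "integrable lborel (\<lambda>u. \<pi> (t + h * u) * (K u * u ^ k))" for k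
          by (rule int[where b=1]) (auto simp: power_abs_le_1)
        show ?thesis
          by (subst Bochner_Integration.integral_sum, intro Bochner_Integration.integrable_sum integrable_mult_right i,
            intro sum.cong refl, subst Bochner_Integration.integral_sum, intro integrable_mult_right i,
            intro sum.cong refl integral_mult_right_zero)
      qed
      ultimately show ?thesis
        unfolding lm by (simp only: sum_distrib_left mult_ac)
    qed
    moreover have "c * (lam * (\<Sum>r<n. (a r)\<^sup>2)) \<le> (\<integral>u. \<pi> (t + h * u) * (K u * q u) \<partial>lborel)"
    proof -
      obtain A where A: "A = {0<..} \<or> A = {..<0::real}" "\<And>u. u \<in> A \<Longrightarrow> \<bar>u\<bar> \<le> 1 \<Longrightarrow> t + h * u \<in> I"
      proof -
        have "t + h * u \<in> {t<..t + h}" if "u \<in> {0<..}" "\<bar>u\<bar> \<le> 1" for u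
          using that h by (auto simp: mult_left_le)
        moreover have "t + h * u \<in> {t - h..<t}" if "u \<in> {..<0}" "\<bar>u\<bar> \<le> 1" for u
        proof -
          have "h * (- u) \<le> h * 1" using that h by (intro mult_left_mono) auto
          then show ?thesis using that h by (auto simp: mult_pos_neg)
        qed
        ultimately show ?thesis using I that by (metis subsetD)
      qed
      have Am[measurable]: "A \<in> sets borel" using A(1) by auto
      have "c * (lam * (\<Sum>r<n. (a r)\<^sup>2)) \<le> c * (\<integral>u. indicator A u * (K u * q u) \<partial>lborel)"
        using lam[OF A(1), of a] c(2) unfolding q_def by (intro mult_left_mono) auto
      also have "\<dots> = (\<integral>u. c * (indicator A u * (K u * q u)) \<partial>lborel)" by simp
      also have "\<dots> \<le> (\<integral>u. \<pi> (t + h * u) * (K u * q u) \<partial>lborel)"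
      proof (rule integral_mono)
        have "integrable lborel (\<lambda>u. K u * (indicator A u * q u))"
          by (rule kernel_times_bounded_integrable[OF K, where b="(\<Sum>r<n. \<bar>a r\<bar>)\<^sup>2"])
            (use qb in \<open>auto simp del: sum.lessThan_Suc split: split_indicator\<close>)
        then show "integrable lborel (\<lambda>u. c * (indicator A u * (K u * q u)))"
          by (intro integrable_mult_right) (simp only: mult.left_commute)
        show "integrable lborel (\<lambda>u. \<pi> (t + h * u) * (K u * q u))"
          by (rule int[OF qm qb])
        fix u :: real
        show "c * (indicator A u * (K u * q u)) \<le> \<pi> (t + h * u) * (K u * q u)"
        proof (cases "\<bar>u\<bar> > 1 \<or> u \<notin> A")
          case True
          then show ?thesis using K0 \<pi>(1) q0 by auto
        next
          case False
          then have "c \<le> \<pi> (t + h * u)" using c(1) A(2) by auto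
          then show ?thesis using False K0 q0 by (auto intro: mult_right_mono)
        qed
      qed
      finally show ?thesis .
    qed
    then have "h * (c * (lam * (\<Sum>r<n. (a r)\<^sup>2))) \<le> h * (\<integral>u. \<pi> (t + h * u) * (K u * q u) \<partial>lborel)"
      using h by (intro mult_left_mono) auto
    ultimately show ?thesis by (simp only: mult_ac)
  qed
qed

text \<open>Perturbing each moment by at most \<open>d\<close> changes the quadratic form by at most \<open>d (\<Sum>\<^sub>r \<bar>a\<^sub>r\<bar>)\<^sup>2\<close>, which is at most
  \<open>d n \<Sum>\<^sub>r a\<^sub>r\<^sup>2\<close>.\<close>

lemma empirical_form_lower:
  fixes x :: "nat \<Rightarrow> real" and \<mu> :: "nat \<Rightarrow> real"
  assumes n: "0 < n" and K: "\<And>u. 0 \<le> K u"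
    and pop: "\<And>a. c * (\<Sum>r<n. (a r)\<^sup>2) \<le> (\<Sum>r<n. \<Sum>s<n. a r * a s * \<mu> (r + s))"
    and dev: "\<And>k. k < 2 * n \<Longrightarrow> \<bar>(\<Sum>j<m. K (x j) * x j ^ k) - real m * \<mu> k\<bar> \<le> d"
  shows "(real m * c - d * (real n)) * (\<Sum>r<n. (a r)\<^sup>2) \<le> (\<Sum>j<m. K (x j) * (\<Sum>r<n. a r * x j ^ r)\<^sup>2)"
proof -
  define E where "E k = (\<Sum>j<m. K (x j) * x j ^ k) - real m * \<mu> k" for k
  have d0: "0 \<le> d" using dev[of 0] n by simp
  have form: "(\<Sum>j<m. K (x j) * (\<Sum>r<n. a r * x j ^ r)\<^sup>2) =
      real m * (\<Sum>r<n. \<Sum>s<n. a r * a s * \<mu> (r + s)) + (\<Sum>r<n. \<Sum>s<n. a r * a s * E (r + s))"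
  proof -
    have "(\<Sum>j<m. K (x j) * (\<Sum>r<n. a r * x j ^ r)\<^sup>2) =
        (\<Sum>j<m. \<Sum>r<n. \<Sum>s<n. a r * a s * (K (x j) * x j ^ (r + s)))"
      unfolding mult_poly_square ..
    also have "\<dots> = (\<Sum>r<n. \<Sum>j<m. \<Sum>s<n. a r * a s * (K (x j) * x j ^ (r + s)))"
      by (rule sum.swap)
    also have "\<dots> = (\<Sum>r<n. \<Sum>s<n. \<Sum>j<m. a r * a s * (K (x j) * x j ^ (r + s)))"
      by (intro sum.cong refl sum.swap)
    also have "\<dots> = (\<Sum>r<n. \<Sum>s<n. a r * a s * (real m * \<mu> (r + s) + E (r + s)))"
      unfolding sum_distrib_left[symmetric] by (simp add: E_def)
    also have "\<dots> = real m * (\<Sum>r<n. \<Sum>s<n. a r * a s * \<mu> (r + s)) + (\<Sum>r<n. \<Sum>s<n. a r * a s * E (r + s))"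
      unfolding sum_distrib_left sum.distrib[symmetric] by (intro sum.cong refl) (simp add: algebra_simps)
    finally show ?thesis .
  qed
  have "\<bar>\<Sum>r<n. \<Sum>s<n. a r * a s * E (r + s)\<bar> \<le> (\<Sum>r<n. \<Sum>s<n. \<bar>a r\<bar> * \<bar>a s\<bar> * d)"
  proof (intro order_trans[OF sum_abs] sum_mono)
    fix r s assume "r \<in> {..<n}" "s \<in> {..<n}"
    then show "\<bar>a r * a s * E (r + s)\<bar> \<le> \<bar>a r\<bar> * \<bar>a s\<bar> * d"
      unfolding abs_mult E_def by (intro mult_left_mono dev) auto
  qed
  also have "\<dots> = d * (\<Sum>r<n. \<bar>a r\<bar>)\<^sup>2"
    unfolding power2_eq_square sum_product by (simp add: sum_distrib_left mult_ac)
  also have "\<dots> \<le> d * ((real n) * (\<Sum>r<n. (a r)\<^sup>2))"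
  proof (rule mult_left_mono[OF _ d0])
    show "(\<Sum>r<n. \<bar>a r\<bar>)\<^sup>2 \<le> (real n) * (\<Sum>r<n. (a r)\<^sup>2)"
      using sum_squared_le_sum_of_squares[of "\<lambda>r. \<bar>a r\<bar>" "{..<n}"] by (simp add: mult.commute)
  qed
  finally have "- (d * ((real n) * (\<Sum>r<n. (a r)\<^sup>2))) \<le> (\<Sum>r<n. \<Sum>s<n. a r * a s * E (r + s))"
    by linarith
  moreover have "real m * (c * (\<Sum>r<n. (a r)\<^sup>2)) \<le> real m * (\<Sum>r<n. \<Sum>s<n. a r * a s * \<mu> (r + s))"
    by (intro mult_left_mono pop) simp
  ultimately show ?thesis unfolding form left_diff_distrib mult.assoc by linarith
qed

section \<open>Random designs\<close>

lemma lpk_cong: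
  assumes "\<And>j. j < m \<Longrightarrow> \<tau> j = \<tau>' j" "\<And>j. j < m \<Longrightarrow> y j = y' j"
  shows "lpk p K h m \<tau> y t = lpk p K h m \<tau>' y' t"
proof -
  have "lpk_normal_mat p K h m \<tau> t = lpk_normal_mat p K h m \<tau>' t"
    unfolding lpk_normal_mat_def by (intro cong_mat) (auto intro!: sum.cong simp: assms)
  moreover have "(\<Sum>j<m. (\<tau> j - t) ^ r * (K ((\<tau> j - t) / h) / h) * y j) =
      (\<Sum>j<m. (\<tau>' j - t) ^ r * (K ((\<tau>' j - t) / h) / h) * y' j)" for r
    by (intro sum.cong refl) (simp add: assms)
  ultimately show ?thesis unfolding lpk_via_normal_mat by (simp only:)
qed

text \<open>The empirical kernel moments of orders \<open>0, \<dots>, 2 q - 1\<close> are close to their expectations. For \<open>q = p + 1\<close>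
  these include all entries of the normal matrix, whose orders go up to \<open>2 p\<close>.\<close>

definition good_design :: "(real \<Rightarrow> real) \<Rightarrow> nat \<Rightarrow> real \<Rightarrow> real \<Rightarrow> (nat \<Rightarrow> real) \<Rightarrow> nat \<Rightarrow> (nat \<Rightarrow> real) \<Rightarrow> real \<Rightarrow> bool" where
  "good_design K q \<kappa> h \<mu> m \<tau> t \<longleftrightarrow>
     (\<forall>k<2 * q. \<bar>(\<Sum>j<m. K ((\<tau> j - t) / h) * ((\<tau> j - t) / h) ^ k) - real m * \<mu> k\<bar> \<le> \<kappa> * (real m * h))"

lemma good_design_cong:
  assumes "\<And>j. j < m \<Longrightarrow> \<tau> j = \<tau>' j"
  shows "good_design K q \<kappa> h \<mu> m \<tau> t = good_design K q \<kappa> h \<mu> m \<tau>' t"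
proof -
  have "(\<Sum>j<m. K ((\<tau> j - t) / h) * ((\<tau> j - t) / h) ^ k) = (\<Sum>j<m. K ((\<tau>' j - t) / h) * ((\<tau>' j - t) / h) ^ k)" for k
    by (intro sum.cong refl) (simp add: assms)
  then show ?thesis unfolding good_design_def by simp
qed

lemma measurable_good_design:
  assumes [measurable]: "K \<in> borel_measurable borel" and \<tau>: "\<And>j. j < m \<Longrightarrow> \<tau> j \<in> borel_measurable N"
  shows "{\<omega>\<in>space N. good_design K q \<kappa> h \<mu> m (\<lambda>j. \<tau> j \<omega>) t} \<in> sets N"
proof -
  have "(\<lambda>\<omega>. \<Sum>j<m. K ((\<tau> j \<omega> - t) / h) * ((\<tau> j \<omega> - t) / h) ^ k) \<in> borel_measurable N" for k
  proof (rule borel_measurable_sum)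
    fix j assume "j \<in> {..<m}"
    then have [measurable]: "\<tau> j \<in> borel_measurable N" using \<tau> by simp
    show "(\<lambda>\<omega>. K ((\<tau> j \<omega> - t) / h) * ((\<tau> j \<omega> - t) / h) ^ k) \<in> borel_measurable N" by measurable
  qed
  then have [measurable]: "(\<lambda>\<omega>. \<bar>(\<Sum>j<m. K ((\<tau> j \<omega> - t) / h) * ((\<tau> j \<omega> - t) / h) ^ k) - real m * \<mu> k\<bar>) \<in> borel_measurable N" for k
    by (intro borel_measurable_abs borel_measurable_diff borel_measurable_const)
  show ?thesis unfolding good_design_def by measurable
qed

lemma good_design_weights:
  fixes \<tau> :: "nat \<Rightarrow> real"
  assumes h: "h > 0" and m: "m > 0" and c: "c > 0" and \<kappa>: "\<kappa> * (real p + 1) = c / 2"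
    and K: "\<And>u. 0 \<le> K u" "\<And>u. K u \<le> B" "\<And>u. \<bar>u\<bar> > 1 \<Longrightarrow> K u = 0"
    and pop: "\<And>a. c * h * (\<Sum>r<p + 1. (a r)\<^sup>2) \<le> (\<Sum>r<p + 1. \<Sum>s<p + 1. a r * a s * \<mu> (r + s))"
    and \<mu>0: "\<mu> 0 \<le> P * h"
    and good: "good_design K (p + 1) \<kappa> h \<mu> m \<tau> t"
  shows "\<exists>w. (\<forall>y. lpk p K h m \<tau> y t = (\<Sum>j<m. w j * y j)) \<and>
    (\<forall>r<p + 1. (\<Sum>j<m. w j * (\<tau> j - t) ^ r) = (if r = 0 then 1 else 0)) \<and>
    (\<forall>j<m. h < \<bar>\<tau> j - t\<bar> \<longrightarrow> w j = 0) \<and>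
    (\<Sum>j<m. \<bar>w j\<bar>) \<le> (real p + 1) * (P + \<kappa>) / (c / 2) \<and>
    (\<Sum>j<m. (w j)\<^sup>2) \<le> B / (c / 2) / (real m * h)"
proof (rule lpk_weights[OF h m _ K])
  show "0 < c / 2" using c by simp
  note g = good[unfolded good_design_def, rule_format]
  fix a :: "nat \<Rightarrow> real"
  have "(real m * (c * h) - \<kappa> * (real m * h) * real (p + 1)) * (\<Sum>r<p + 1. (a r)\<^sup>2) \<le>
      (\<Sum>j<m. K ((\<tau> j - t) / h) * (\<Sum>r<p + 1. a r * ((\<tau> j - t) / h) ^ r)\<^sup>2)"
    by (rule empirical_form_lower[OF _ K(1) pop g]) auto
  moreover have "real m * (c * h) - \<kappa> * (real m * h) * real (p + 1) = c / 2 * (real m * h)"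
  proof -
    have "\<kappa> * (real m * h) * real (p + 1) = (\<kappa> * (real p + 1)) * (real m * h)" by (simp add: algebra_simps)
    then show ?thesis unfolding \<kappa> by (simp add: algebra_simps)
  qed
  ultimately show "c / 2 * (real m * h) * (\<Sum>r<p + 1. (a r)\<^sup>2) \<le>
      (\<Sum>j<m. K ((\<tau> j - t) / h) * (\<Sum>r<p + 1. a r * ((\<tau> j - t) / h) ^ r)\<^sup>2)"
    by metis
next
  have "\<bar>(\<Sum>j<m. K ((\<tau> j - t) / h)) - real m * \<mu> 0\<bar> \<le> \<kappa> * (real m * h)"
    using good[unfolded good_design_def, rule_format, of 0] by simp
  moreover have "real m * \<mu> 0 \<le> real m * (P * h)" using \<mu>0 by (intro mult_left_mono) auto
  ultimately show "(\<Sum>j<m. K ((\<tau> j - t) / h)) \<le> (P + \<kappa>) * (real m * h)"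
    by (simp add: algebra_simps abs_le_iff)
qed

text \<open>Hoeffding's inequality for each moment order; the summands lie in \<open>[- B, B]\<close>.\<close>

lemma bad_design_prob:
  fixes T :: "nat \<Rightarrow> 'a \<Rightarrow> real"
  assumes "prob_space M" and ind: "prob_space.indep_vars M (\<lambda>_. borel) T {..<m}"
    and dist: "\<And>j. j < m \<Longrightarrow> distributed M lborel (T j) (\<lambda>x. ennreal (\<pi> x))" and \<pi>0: "\<And>x. 0 \<le> \<pi> x"
    and \<pi>m[measurable]: "\<pi> \<in> borel_measurable borel"
    and K: "kernel_condition K" and B: "\<And>u. K u \<le> B" "0 < B" and h: "0 < h" and m: "0 < m" and \<kappa>: "0 < \<kappa>"
  shows "measure M {\<omega>\<in>space M. \<not> good_design K q \<kappa> h (local_moment \<pi> K h t) m (\<lambda>j. T j \<omega>) t}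
    \<le> real (2 * q) * (2 * exp (- (\<kappa>\<^sup>2 / (2 * B\<^sup>2) * (real m * h\<^sup>2))))"
proof -
  interpret prob_space M by fact
  have Km[measurable]: "K \<in> borel_measurable borel" and K0: "\<And>u. 0 \<le> K u" "\<And>u. \<bar>u\<bar> > 1 \<Longrightarrow> K u = 0"
    using K by (auto simp: kernel_condition_def)
  define g where "g k x = K ((x - t) / h) * ((x - t) / h) ^ k" for k x
  have gm[measurable]: "g k \<in> borel_measurable borel" for k unfolding g_def by measurable
  have gb: "\<bar>g k x\<bar> \<le> B" for k x
  proof (cases "\<bar>(x - t) / h\<bar> > 1")
    case True then show ?thesis using K0(2)[of "(x - t) / h"] B by (simp add: g_def)
  next
    case False
    then have "\<bar>K ((x - t) / h)\<bar> * \<bar>((x - t) / h) ^ k\<bar> \<le> B * 1"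
      using B K0(1) by (intro mult_mono power_abs_le_1) auto
    then show ?thesis by (simp add: g_def abs_mult)
  qed
  have Tm[measurable]: "T j \<in> borel_measurable M" if "j < m" for j
    using dist[OF that] by (auto simp: distributed_def)
  define Bad where "Bad k = {\<omega>\<in>space M. \<bar>(\<Sum>j<m. g k (T j \<omega>)) - real m * local_moment \<pi> K h t k\<bar> \<ge> \<kappa> * (real m * h)}" for k
  have sm: "(\<lambda>\<omega>. \<Sum>j<m. g k (T j \<omega>)) \<in> borel_measurable M" for k
    by (intro borel_measurable_sum measurable_compose[OF Tm gm]) simp
  have Bs: "Bad k \<in> sets M" for k unfolding Bad_def using sm[of k] by measurable
  have Bp: "prob (Bad k) \<le> 2 * exp (- (\<kappa>\<^sup>2 / (2 * B\<^sup>2) * (real m * h\<^sup>2)))" for k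
  proof -
    have ex: "expectation (\<lambda>\<omega>. g k (T j \<omega>)) = local_moment \<pi> K h t k" if "j < m" for j
      unfolding local_moment_def g_def[symmetric]
      by (rule distributed_integral[OF dist[OF that], symmetric]) (auto simp: \<pi>0)
    interpret H: Hoeffding_ineq M "{..<m}" "\<lambda>j \<omega>. g k (T j \<omega>)" "\<lambda>_. - B" "\<lambda>_. B"
        "\<Sum>j<m. expectation (\<lambda>\<omega>. g k (T j \<omega>))"
    proof unfold_locales
      show "indep_vars (\<lambda>_. borel) (\<lambda>j \<omega>. g k (T j \<omega>)) {..<m}"
        by (rule indep_vars_compose2[OF ind]) simp
      show "AE \<omega> in M. g k (T j \<omega>) \<in> {- B..B}" for j
        using gb[of k] by (auto simp: abs_le_iff minus_le_iff)
    qed (rule refl finite_lessThan)+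
    have "prob {x\<in>space M. \<bar>(\<Sum>j<m. g k (T j x)) - (\<Sum>j<m. expectation (\<lambda>\<omega>. g k (T j \<omega>)))\<bar> \<ge> \<kappa> * (real m * h)}
        \<le> 2 * exp (- 2 * (\<kappa> * (real m * h))\<^sup>2 / (\<Sum>j<m. (B - - B)\<^sup>2))"
      by (rule H.Hoeffding_ineq_abs_ge) (use \<kappa> m h B in auto)
    moreover have "(\<Sum>j<m. expectation (\<lambda>\<omega>. g k (T j \<omega>))) = real m * local_moment \<pi> K h t k"
      by (simp add: ex)
    moreover have "- 2 * (\<kappa> * (real m * h))\<^sup>2 / (\<Sum>j<m. (B - - B)\<^sup>2) = - (\<kappa>\<^sup>2 / (2 * B\<^sup>2) * (real m * h\<^sup>2))"
      using m B(2) by (simp add: power2_eq_square field_simps)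
    ultimately show ?thesis unfolding Bad_def by simp
  qed
  have "{\<omega>\<in>space M. \<not> good_design K q \<kappa> h (local_moment \<pi> K h t) m (\<lambda>j. T j \<omega>) t} \<subseteq> (\<Union>k<2 * q. Bad k)"
    unfolding good_design_def Bad_def g_def by fastforce
  then have "measure M {\<omega>\<in>space M. \<not> good_design K q \<kappa> h (local_moment \<pi> K h t) m (\<lambda>j. T j \<omega>) t} \<le> measure M (\<Union>k<2 * q. Bad k)"
    using Bs by (intro finite_measure_mono) auto
  also have "\<dots> \<le> (\<Sum>k<2 * q. measure M (Bad k))"
    using Bs by (intro finite_measure_subadditive_finite) auto
  also have "\<dots> \<le> (\<Sum>k<2 * q. 2 * exp (- (\<kappa>\<^sup>2 / (2 * B\<^sup>2) * (real m * h\<^sup>2))))"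
    by (intro sum_mono Bp)
  finally show ?thesis by simp
qed

text \<open>The law of \<open>Y\<close> has no atoms, so the diagonal is a null set of the product of the two laws.\<close>

lemma (in prob_space) AE_indep_distributed_neq:
  fixes X Y :: "'a \<Rightarrow> real"
  assumes ind: "indep_var borel X borel Y"
    and Y: "distributed M lborel Y f"
  shows "AE \<omega> in M. X \<omega> \<noteq> Y \<omega>"
proof -
  have [measurable]: "random_variable borel X" "random_variable borel Y"
    using ind by (auto dest: indep_var_rv1 indep_var_rv2)
  have joint: "distr M borel X \<Otimes>\<^sub>M distr M borel Y = distr M (borel \<Otimes>\<^sub>M borel) (\<lambda>\<omega>. (X \<omega>, Y \<omega>))"
    using ind by (simp add: indep_var_distribution_eq)
  interpret Y: prob_space "distr M borel Y" by (rule prob_space_distr) simp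
  interpret X: prob_space "distr M borel X" by (rule prob_space_distr) simp
  interpret XY: pair_sigma_finite "distr M borel X" "distr M borel Y" ..
  have "AE z in distr M borel X \<Otimes>\<^sub>M distr M borel Y. fst z \<noteq> snd z"
  proof (rule XY.AE_pair_measure)
    show "{z \<in> space (distr M borel X \<Otimes>\<^sub>M distr M borel Y). fst z \<noteq> snd z} \<in> sets (distr M borel X \<Otimes>\<^sub>M distr M borel Y)"
      by measurable
    show "AE x in distr M borel X. AE y in distr M borel Y. fst (x, y) \<noteq> snd (x, y)"
    proof (rule AE_I2)
      fix x :: real
      have "AE \<omega> in M. Y \<omega> \<noteq> x"
        unfolding distributed_AE2[OF Y, of "\<lambda>y. y \<noteq> x", simplified]
        using AE_lborel_singleton[of x] by eventually_elim simp
      then show "AE y in distr M borel Y. fst (x, y) \<noteq> snd (x, y)"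
        by (subst AE_distr_iff) (auto simp: eq_commute)
    qed
  qed
  then show ?thesis unfolding joint by (subst (asm) AE_distr_iff) auto
qed

lemma design_density_bounded:
  assumes "design_density a b \<pi>" "a < b"
  shows "\<exists>P. \<forall>x. \<pi> x \<le> P"
proof -
  obtain \<pi>' where \<pi>': "continuous_on {a..b} \<pi>'" "\<And>x. x \<in> {a<..<b} \<Longrightarrow> (\<pi> has_real_derivative \<pi>' x) (at x)"
    using assms(1) unfolding design_density_def by blast
  have "bounded (\<pi>' ` {a..b})"
    by (intro compact_imp_bounded compact_continuous_image \<pi>'(1)) simp
  then obtain L where "\<forall>y\<in>\<pi>' ` {a..b}. norm y \<le> L" unfolding bounded_iff by blast
  then have L: "\<bar>\<pi>' x\<bar> \<le> L" if "x \<in> {a..b}" for x using that by auto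
  define x0 where "x0 = (a + b) / 2"
  have x0: "x0 \<in> {a<..<b}" using assms(2) by (simp add: x0_def)
  have L0: "0 \<le> L" using L[of a] assms(2) by fastforce
  have "\<pi> x \<le> \<bar>\<pi> x0\<bar> + L * (b - a)" if x: "x \<in> {a<..<b}" for x
  proof -
    have "norm (\<pi> x - \<pi> x0) \<le> L * norm (x - x0)"
      by (rule field_differentiable_bound[of "{a<..<b}" \<pi> \<pi>'])
        (use \<pi>'(2) L x x0 in \<open>auto intro: has_field_derivative_at_within\<close>)
    also have "\<dots> \<le> L * (b - a)" using x x0 L0 by (intro mult_left_mono) auto
    finally show ?thesis by simp
  qed
  moreover have "\<pi> x = 0" if "x \<notin> {a..b}" for x using assms(1) that by (simp add: design_density_def)
  ultimately have "\<pi> x \<le> max (\<bar>\<pi> x0\<bar> + L * (b - a)) (max (max (\<pi> a) (\<pi> b)) 0)" for x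
    by (cases "x \<in> {a<..<b}"; cases "x = a"; cases "x = b"; fastforce simp: le_max_iff_disj)
  then show ?thesis by blast
qed

section \<open>Rates\<close>

lemma exp_power_decay:
  assumes "0 < \<epsilon>" "0 < (c::real)"
  shows "(\<lambda>n. real n * exp (- (c * real n powr \<epsilon>))) \<longlonglongrightarrow> 0"
proof -
  have 1: "filterlim (\<lambda>n. c * real n powr \<epsilon>) at_top sequentially"
    using assms by real_asymp
  (* This power of n^\<epsilon> dominates n. *)
  define k where "k = nat \<lceil>1 / \<epsilon>\<rceil>"
  have "((\<lambda>x::real. x ^ k / exp x) \<longlongrightarrow> 0) at_top" by (rule tendsto_power_div_exp_0)
  from filterlim_compose[OF this 1]
  have "(\<lambda>n. (c * real n powr \<epsilon>) ^ k / exp (c * real n powr \<epsilon>)) \<longlonglongrightarrow> 0" .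
  from tendsto_mult_left[OF this, of "1 / c ^ k"]
  have 2: "(\<lambda>n. (real n powr \<epsilon>) ^ k / exp (c * real n powr \<epsilon>)) \<longlonglongrightarrow> 0"
    using assms(2) by (simp add: power_mult_distrib)
  show ?thesis
  proof (rule tendsto_sandwich[OF _ _ tendsto_const 2])
    show "\<forall>\<^sub>F n in sequentially. real n * exp (- (c * real n powr \<epsilon>)) \<le> (real n powr \<epsilon>) ^ k / exp (c * real n powr \<epsilon>)"
      using eventually_ge_at_top[of 1]
    proof eventually_elim
      case (elim n)
      have "1 / \<epsilon> \<le> real k" unfolding k_def by linarith
      then have "1 \<le> \<epsilon> * real k" using assms(1) by (simp add: field_simps)
      then have "real n powr 1 \<le> real n powr (\<epsilon> * real k)" using elim by (intro powr_mono) auto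
      also have "\<dots> = (real n powr \<epsilon>) ^ k" using elim by (simp add: powr_powr[symmetric] powr_realpow)
      finally show ?case using elim by (simp add: exp_minus divide_inverse mult_right_mono)
    qed
  qed simp
qed

lemma (in prob_space) indep_vars_reindex:
  assumes f: "inj_on f I" and ind: "indep_vars N X (f ` I)"
  shows "indep_vars (\<lambda>i. N (f i)) (\<lambda>i. X (f i)) I"
  unfolding indep_vars_def2
proof (intro conjI ballI)
  show "random_variable (N (f i)) (X (f i))" if "i \<in> I" for i
    using ind that unfolding indep_vars_def2 by auto
  let ?F = "\<lambda>i. {X i -` A \<inter> space M |A. A \<in> sets (N i)}"
  have ind': "indep_sets ?F (f ` I)" using ind unfolding indep_vars_def2 by blast
  show "indep_sets (\<lambda>i. ?F (f i)) I"
  proof (rule indep_setsI)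
    show "?F (f i) \<subseteq> events" if "i \<in> I" for i
      using ind' that unfolding indep_sets_def by blast
    fix A J assume J: "J \<noteq> {}" "J \<subseteq> I" "finite J" and A: "\<forall>j\<in>J. A j \<in> ?F (f j)"
    have injJ: "inj_on f J" using f J(2) by (rule inj_on_subset)
    define A' where "A' = A \<circ> inv_into J f"
    have A': "A' (f j) = A j" if "j \<in> J" for j using inv_into_f_f[OF injJ that] by (simp add: A'_def)
    have "prob (\<Inter>j\<in>f ` J. A' j) = (\<Prod>j\<in>f ` J. prob (A' j))"
      by (rule indep_setsD[OF ind']) (use J A A' in auto)
    then show "prob (\<Inter>j\<in>J. A j) = (\<Prod>j\<in>J. prob (A j))"
      using injJ A' by (simp add: prod.reindex)
  qed
qed

section \<open>The model\<close>

text \<open>The standing assumptions, with the smoothness of \<open>\<gamma>\<close> and \<open>\<sigma>\<close> deferred: how it is used depends on the set on which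
  uniformity is claimed.\<close>

locale lpk_model = prob_space M
  for M :: "'a measure" +
  fixes a b C \<delta> :: real and p :: nat and v e :: "nat \<Rightarrow> real \<Rightarrow> 'a \<Rightarrow> real" and \<eta> \<sigma> \<pi> K :: "real \<Rightarrow> real"
    and \<gamma> :: "real \<Rightarrow> real \<Rightarrow> real" and m :: "nat \<Rightarrow> nat \<Rightarrow> nat" and T :: "nat \<Rightarrow> nat \<Rightarrow> nat \<Rightarrow> 'a \<Rightarrow> real"
    and h :: "nat \<Rightarrow> real"
  assumes ab: "a < b"
    and model: "subject_effect_error_model M {a..b} v e \<gamma> \<sigma>"
    and y_measurable: "\<And>n i j. i < n \<Longrightarrow> j < m n i \<Longrightarrow>
      (\<lambda>\<omega>. \<eta> (T n i j \<omega>) + v i (T n i j \<omega>) \<omega> + e i (T n i j \<omega>) \<omega>) \<in> borel_measurable M"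
    and design_indep: "\<And>n. design_independent M {a..b} v e {(i, j). i < n \<and> j < m n i} (T n)"
    and density: "design_density a b \<pi>"
    and design: "\<And>n. random_design M \<pi> {(i, j). i < n \<and> j < m n i} (T n)"
    and \<eta>_cont: "continuous_on {a<..<b} \<eta>"
    and kernel: "kernel_condition K"
    and C_pos: "C > 0" and \<delta>_pos: "\<delta> > 0"
    and m_ge: "\<And>n i. i < n \<Longrightarrow> real (m n i) \<ge> C * real n powr \<delta>"
    and h_pos: "\<And>n. h n > 0" and h_lim: "h \<longlonglongrightarrow> 0"
    and bandwidth: "h \<in> \<Theta>(\<lambda>n. real n powr (- \<delta> / (2 * real p + 3)))"
begin

definition indiv :: "nat \<Rightarrow> real \<Rightarrow> 'a \<Rightarrow> real" where
  "indiv i t \<omega> = \<eta> t + v i t \<omega>"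

definition recon :: "nat \<Rightarrow> nat \<Rightarrow> real \<Rightarrow> 'a \<Rightarrow> real" where
  "recon n i t \<omega> = lpk p K (h n) (m n i) (\<lambda>j. T n i j \<omega>)
     (\<lambda>j. \<eta> (T n i j \<omega>) + v i (T n i j \<omega>) \<omega> + e i (T n i j \<omega>) \<omega>) t"

definition rate :: "nat \<Rightarrow> real" where
  "rate n = real n powr (- ((real p + 1) * \<delta> / (2 * real p + 3)))"

lemma K_meas[measurable]: "K \<in> borel_measurable borel"
  and K_nonneg: "0 \<le> K u" and K_support: "\<bar>u\<bar> > 1 \<Longrightarrow> K u = 0"
  using kernel by (auto simp: kernel_condition_def)

lemma K_bound: obtains B where "0 < B" "\<And>u. K u \<le> B"
proof -
  obtain B where B: "\<And>u. K u \<le> B" using kernel by (auto simp: kernel_condition_def)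
  show ?thesis by (rule that[of "max B 1"]) (use B in \<open>auto simp: le_max_iff_disj\<close>)
qed

lemma \<pi>_meas[measurable]: "\<pi> \<in> borel_measurable borel" and \<pi>_nonneg: "0 \<le> \<pi> x"
  using density by (auto simp: design_density_def)

lemma effects_indep: "indep_vars (\<lambda>_. path_space {a..b}) (\<lambda>i. sample_path {a..b} (v i)) UNIV"
proof -
  have "indep_vars (\<lambda>_. path_space {a..b})
     (\<lambda>k. case k of Inl i \<Rightarrow> sample_path {a..b} (v i) | Inr i \<Rightarrow> sample_path {a..b} (e i)) (UNIV :: (nat + nat) set)"
    using model unfolding subject_effect_error_model_def by blast
  then have "indep_vars (\<lambda>_. path_space {a..b})
     (\<lambda>k. case k of Inl i \<Rightarrow> sample_path {a..b} (v i) | Inr i \<Rightarrow> sample_path {a..b} (e i)) (range (Inl :: nat \<Rightarrow> nat + nat))"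
    by (rule indep_vars_subset) simp
  from indep_vars_reindex[OF _ this] show ?thesis by simp
qed

lemma path_meas:
  shows v_path[measurable]: "sample_path {a..b} (v i) \<in> measurable M (path_space {a..b})"
    and e_path[measurable]: "sample_path {a..b} (e i) \<in> measurable M (path_space {a..b})"
proof -
  have *: "indep_vars (\<lambda>_. path_space {a..b})
     (\<lambda>k. case k of Inl i \<Rightarrow> sample_path {a..b} (v i) | Inr i \<Rightarrow> sample_path {a..b} (e i)) (UNIV :: (nat + nat) set)"
    using model unfolding subject_effect_error_model_def by blast
  show "sample_path {a..b} (v i) \<in> measurable M (path_space {a..b})"
    using *[unfolded indep_vars_def2, THEN conjunct1, THEN bspec, of "Inl i"] by simp
  show "sample_path {a..b} (e i) \<in> measurable M (path_space {a..b})"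
    using *[unfolded indep_vars_def2, THEN conjunct1, THEN bspec, of "Inr i"] by simp
qed

lemma path_distr:
  "distr M (path_space {a..b}) (sample_path {a..b} (v i)) = distr M (path_space {a..b}) (sample_path {a..b} (v 0))"
  "distr M (path_space {a..b}) (sample_path {a..b} (e i)) = distr M (path_space {a..b}) (sample_path {a..b} (e 0))"
  using model unfolding subject_effect_error_model_def by blast+

lemma coord_meas: "t \<in> {a..b} \<Longrightarrow> (\<lambda>x. x t) \<in> borel_measurable (path_space {a..b})"
  by (rule measurable_component_singleton)

lemma sample_path_apply: "t \<in> I \<Longrightarrow> sample_path I X \<omega> t = X t \<omega>"
  by (simp add: sample_path_def)

lemma v_meas: "t \<in> {a..b} \<Longrightarrow> v i t \<in> borel_measurable M"
  using measurable_compose[OF v_path coord_meas[of t], of i] by (simp add: sample_path_apply)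

lemma same_law_integral:
  assumes F: "F \<in> borel_measurable N" and X: "X \<in> measurable M N" "Y \<in> measurable M N"
    and d: "distr M N X = distr M N Y" and Y: "has_bochner_integral M (\<lambda>\<omega>. F (Y \<omega>)) (c::real)"
  shows "has_bochner_integral M (\<lambda>\<omega>. F (X \<omega>)) c"
proof -
  have "has_bochner_integral (distr M N Y) F c"
    using Y by (simp add: has_bochner_integral_iff integrable_distr_eq[OF X(2) F] integral_distr[OF X(2) F])
  then have "has_bochner_integral (distr M N X) F c" by (simp only: d)
  then show ?thesis by (simp add: has_bochner_integral_iff integrable_distr_eq[OF X(1) F] integral_distr[OF X(1) F])
qed

lemma v_cov:
  assumes "s \<in> {a..b}" "t \<in> {a..b}"
  shows "has_bochner_integral M (\<lambda>\<omega>. v i s \<omega> * v i t \<omega>) (\<gamma> s t)"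
proof -
  have "has_bochner_integral M (\<lambda>\<omega>. v 0 s \<omega> * v 0 t \<omega>) (\<gamma> s t)"
    using model assms unfolding subject_effect_error_model_def by blast
  moreover have "(\<lambda>x. x s * x t) \<in> borel_measurable (path_space {a..b})"
    by (intro borel_measurable_times coord_meas assms)
  ultimately show ?thesis
    using same_law_integral[where F="\<lambda>x. x s * x t", OF _ v_path v_path path_distr(1), of "\<gamma> s t" i] assms
    by (simp add: sample_path_apply)
qed

lemma e_cov:
  assumes "s \<in> {a..b}" "t \<in> {a..b}"
  shows "has_bochner_integral M (\<lambda>\<omega>. e i s \<omega> * e i t \<omega>) (if s = t then (\<sigma> t)\<^sup>2 else 0)"
proof -
  have "has_bochner_integral M (\<lambda>\<omega>. e 0 s \<omega> * e 0 t \<omega>) (if s = t then (\<sigma> t)\<^sup>2 else 0)"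
    using model assms unfolding subject_effect_error_model_def by blast
  moreover have "(\<lambda>x. x s * x t) \<in> borel_measurable (path_space {a..b})"
    by (intro borel_measurable_times coord_meas assms)
  ultimately show ?thesis
    using same_law_integral[where F="\<lambda>x. x s * x t", OF _ e_path e_path path_distr(2), of "if s = t then (\<sigma> t)\<^sup>2 else 0" i] assms
    by (simp add: sample_path_apply)
qed

lemma v_mean:
  assumes "t \<in> {a..b}"
  shows "has_bochner_integral M (v 0 t) 0"
  using model assms unfolding subject_effect_error_model_def by blast

lemma T_distr: "i < n \<Longrightarrow> j < m n i \<Longrightarrow> distributed M lborel (T n i j) (\<lambda>x. ennreal (\<pi> x))"
  using design[of n] unfolding random_design_def by auto

lemma T_meas: "i < n \<Longrightarrow> j < m n i \<Longrightarrow> T n i j \<in> borel_measurable M"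
  using T_distr[of i n j] by (auto simp: distributed_def)

lemma T_indep:
  assumes "i < n"
  shows "indep_vars (\<lambda>_. borel) (T n i) {..<m n i}"
proof -
  have "indep_vars (\<lambda>_. borel) (\<lambda>(i, j). T n i j) {(i, j). i < n \<and> j < m n i}"
    using design[of n] unfolding random_design_def by blast
  then have "indep_vars (\<lambda>_. borel) (\<lambda>(i, j). T n i j) (Pair i ` {..<m n i})"
    by (rule indep_vars_subset) (use assms in auto)
  from indep_vars_reindex[OF _ this] show ?thesis by (simp add: inj_on_def)
qed

lemma T_interior:
  assumes "i < n" "j < m n i"
  shows "AE \<omega> in M. T n i j \<omega> \<in> {a<..<b}"
proof (subst distributed_AE2[OF T_distr[OF assms]])
  show "AE x in lborel. 0 < ennreal (\<pi> x) \<longrightarrow> x \<in> {a<..<b}"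
    using AE_lborel_singleton[of a] AE_lborel_singleton[of b]
  proof eventually_elim
    case (elim x)
    show ?case
    proof
      assume "0 < ennreal (\<pi> x)"
      then have "x \<in> {a..b}" using density by (fastforce simp: design_density_def)
      then show "x \<in> {a<..<b}" using elim by auto
    qed
  qed
qed simp

lemma T_distinct:
  assumes "i < n"
  shows "AE \<omega> in M. inj_on (\<lambda>j. T n i j \<omega>) {..<m n i}"
proof -
  have "AE \<omega> in M. T n i j \<omega> \<noteq> T n i l \<omega>" if "j < m n i" "l < m n i" "j \<noteq> l" for j l
  proof (rule AE_indep_distributed_neq[OF _ T_distr[OF assms that(2)]])
    have "indep_vars (\<lambda>_. borel) (T n i) (case_bool j l ` UNIV)"
      by (rule indep_vars_subset[OF T_indep[OF assms]]) (use that in \<open>auto split: bool.split\<close>)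
    then have "indep_vars (\<lambda>_. borel) (\<lambda>b. T n i (case_bool j l b)) UNIV"
      by (rule indep_vars_reindex[rotated]) (use that in \<open>auto simp: inj_on_def split: bool.split\<close>)
    then show "indep_var borel (T n i j) borel (T n i l)"
      unfolding indep_var_def
      by (rule indep_vars_cong[THEN iffD1, rotated 3]) (auto split: bool.split)
  qed
  then have "AE \<omega> in M. \<forall>j\<in>{..<m n i}. \<forall>l\<in>{..<m n i}. j \<noteq> l \<longrightarrow> T n i j \<omega> \<noteq> T n i l \<omega>"
    by (intro AE_finite_allI) auto
  then show ?thesis by eventually_elim (auto simp: inj_on_def)
qed

lemma recon_meas:
  assumes "i < n"
  shows "recon n i t \<in> borel_measurable M"
  unfolding recon_def[abs_def]
  by (rule borel_measurable_lpk[OF K_meas T_meas y_measurable]) (use assms in auto)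

lemma indiv_meas: "t \<in> {a..b} \<Longrightarrow> indiv i t \<in> borel_measurable M"
  unfolding indiv_def[abs_def] by (intro borel_measurable_add borel_measurable_const v_meas)

text \<open>Design independence, applied to the truncated squared error as a function of design, paths and
  values at the design points: its mean does not change when the design is frozen at an independent
  realization. The truncation event is measurable with respect to the design.\<close>

lemma condition_on_design:
  fixes A :: "(nat \<Rightarrow> real) \<Rightarrow> bool"
  assumes i: "i < n" and t: "t \<in> {a..b}"
    and A: "A = (\<lambda>\<tau>. good_design K q \<kappa> (h n) \<mu> (m n i) \<tau> t)"
  shows "(\<integral>\<^sup>+\<omega>. (if A (\<lambda>j. T n i j \<omega>) then ennreal ((recon n i t \<omega> - indiv i t \<omega>)\<^sup>2) else 0) \<partial>M) =
    (\<integral>\<^sup>+\<omega>'. (\<integral>\<^sup>+\<omega>. (if A (\<lambda>j. T n i j \<omega>') then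
        ennreal ((lpk p K (h n) (m n i) (\<lambda>j. T n i j \<omega>')
          (\<lambda>j. indicator {a<..<b} (T n i j \<omega>') * \<eta> (T n i j \<omega>') + v i (T n i j \<omega>') \<omega> + e i (T n i j \<omega>') \<omega>) t
          - indiv i t \<omega>)\<^sup>2) else 0) \<partial>M) \<partial>M)"
proof -
  let ?J = "{(i, j). i < n \<and> j < m n i}"
  let ?I = "{a..b}"
  define des where "des = (\<lambda>\<omega>. \<lambda>(i, j)\<in>?J. T n i j \<omega>)"
  define pth where "pth = (\<lambda>\<omega>. \<lambda>(i, t)\<in>(UNIV :: nat set) \<times> ?I. (v i t \<omega>, e i t \<omega>))"
  (* Off the open interval \<eta> is arbitrary; the cut-off version is Borel and agrees with it at almost every design. *)
  define \<eta>0 where "\<eta>0 x = indicator {a<..<b} x * \<eta> x" for x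
  have \<eta>0m[measurable]: "\<eta>0 \<in> borel_measurable borel"
  proof -
    have "(\<lambda>x. indicator {a<..<b} x *\<^sub>R \<eta> x) \<in> borel_measurable borel"
      by (rule borel_measurable_continuous_on_indicator) (use \<eta>_cont in auto)
    then show ?thesis by (simp add: \<eta>0_def[abs_def])
  qed
  let ?N = "Pi\<^sub>M ?J (\<lambda>_. borel :: real measure) \<Otimes>\<^sub>M
     (Pi\<^sub>M (UNIV \<times> ?I) (\<lambda>_. borel :: (real \<times> real) measure) \<Otimes>\<^sub>M Pi\<^sub>M ?J (\<lambda>_. borel :: (real \<times> real) measure))"
  define g :: "(nat \<times> nat \<Rightarrow> real) \<times> (nat \<times> real \<Rightarrow> real \<times> real) \<times> (nat \<times> nat \<Rightarrow> real \<times> real) \<Rightarrow> ennreal"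
    where "g = (\<lambda>(d, P, x). if A (\<lambda>j. d (i, j)) then
     ennreal ((lpk p K (h n) (m n i) (\<lambda>j. d (i, j)) (\<lambda>j. \<eta>0 (d (i, j)) + fst (x (i, j)) + snd (x (i, j))) t
       - (\<eta> t + fst (P (i, t))))\<^sup>2) else 0)"
  have dm: "(\<lambda>z. fst z (i, j)) \<in> borel_measurable ?N" if "j < m n i" for j
    by (rule measurable_compose[OF measurable_fst measurable_component_singleton]) (use that i in auto)
  have pm: "(\<lambda>z. fst (snd z) (i, t)) \<in> measurable ?N borel"
    by (rule measurable_compose[OF measurable_compose[OF measurable_snd measurable_fst] measurable_component_singleton])
      (use t in auto)
  have xm: "(\<lambda>z. snd (snd z) (i, j)) \<in> measurable ?N borel" if "j < m n i" for j
    by (rule measurable_compose[OF measurable_compose[OF measurable_snd measurable_snd] measurable_component_singleton])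
      (use that i in auto)
  have fm: "fst \<in> borel_measurable (borel :: (real \<times> real) measure)" "snd \<in> borel_measurable (borel :: (real \<times> real) measure)"
    by (intro borel_measurable_continuous_onI continuous_on_fst continuous_on_snd continuous_on_id)+
  have gm: "g \<in> borel_measurable ?N"
  proof -
    have "{z\<in>space ?N. A (\<lambda>j. fst z (i, j))} \<in> sets ?N"
      unfolding A by (rule measurable_good_design[OF K_meas dm])
    moreover have "(\<lambda>z. lpk p K (h n) (m n i) (\<lambda>j. fst z (i, j))
        (\<lambda>j. \<eta>0 (fst z (i, j)) + fst (snd (snd z) (i, j)) + snd (snd (snd z) (i, j))) t) \<in> borel_measurable ?N"
    proof (rule borel_measurable_lpk[OF K_meas dm])
      fix j assume j: "j < m n i"
      show "(\<lambda>z. \<eta>0 (fst z (i, j)) + fst (snd (snd z) (i, j)) + snd (snd (snd z) (i, j))) \<in> borel_measurable ?N"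
        by (intro borel_measurable_add measurable_compose[OF dm[OF j] \<eta>0m]
            measurable_compose[OF xm[OF j] fm(1)] measurable_compose[OF xm[OF j] fm(2)])
    qed
    moreover have "(\<lambda>z. \<eta> t + fst (fst (snd z) (i, t))) \<in> borel_measurable ?N"
      by (intro borel_measurable_add borel_measurable_const measurable_compose[OF pm fm(1)])
    ultimately have "(\<lambda>z. if A (\<lambda>j. fst z (i, j)) then
       ennreal ((lpk p K (h n) (m n i) (\<lambda>j. fst z (i, j))
        (\<lambda>j. \<eta>0 (fst z (i, j)) + fst (snd (snd z) (i, j)) + snd (snd (snd z) (i, j))) t
         - (\<eta> t + fst (fst (snd z) (i, t))))\<^sup>2) else 0) \<in> borel_measurable ?N"
      by (intro measurable_If measurable_compose[OF _ measurable_ennreal] borel_measurable_power borel_measurable_diff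
          borel_measurable_const)
    then show ?thesis by (simp add: g_def case_prod_beta')
  qed
  have des: "des \<omega> (i, j) = T n i j \<omega>" if "j < m n i" for \<omega> j using that i by (simp add: des_def)
  have g_eval: "g (des \<omega>', pth \<omega>, processes_at ?J v e (des \<omega>') \<omega>) =
      (if A (\<lambda>j. T n i j \<omega>') then
        ennreal ((lpk p K (h n) (m n i) (\<lambda>j. T n i j \<omega>')
          (\<lambda>j. indicator {a<..<b} (T n i j \<omega>') * \<eta> (T n i j \<omega>') + v i (T n i j \<omega>') \<omega> + e i (T n i j \<omega>') \<omega>) t
          - indiv i t \<omega>)\<^sup>2) else 0)" for \<omega> \<omega>'
  proof -
    have 1: "A (\<lambda>j. des \<omega>' (i, j)) = A (\<lambda>j. T n i j \<omega>')"
      unfolding A by (rule good_design_cong) (simp add: des)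
    have 2: "lpk p K (h n) (m n i) (\<lambda>j. des \<omega>' (i, j)) (\<lambda>j. \<eta>0 (des \<omega>' (i, j)) +
         fst (processes_at ?J v e (des \<omega>') \<omega> (i, j)) + snd (processes_at ?J v e (des \<omega>') \<omega> (i, j))) t =
      lpk p K (h n) (m n i) (\<lambda>j. T n i j \<omega>')
          (\<lambda>j. indicator {a<..<b} (T n i j \<omega>') * \<eta> (T n i j \<omega>') + v i (T n i j \<omega>') \<omega> + e i (T n i j \<omega>') \<omega>) t"
      by (rule lpk_cong) (use i in \<open>simp_all add: des processes_at_def \<eta>0_def\<close>)
    have 3: "\<eta> t + fst (pth \<omega> (i, t)) = indiv i t \<omega>" using t by (simp add: pth_def indiv_def)
    show ?thesis unfolding g_def prod.case 1 2 3 ..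
  qed
  have key: "(\<integral>\<^sup>+ \<omega>. g (des \<omega>, pth \<omega>, processes_at ?J v e (des \<omega>) \<omega>) \<partial>M) =
      (\<integral>\<^sup>+ \<omega>'. (\<integral>\<^sup>+ \<omega>. g (des \<omega>', pth \<omega>, processes_at ?J v e (des \<omega>') \<omega>) \<partial>M) \<partial>M)"
    using design_indep[of n] gm unfolding design_independent_def Let_def des_def pth_def by blast
  have "(\<integral>\<^sup>+\<omega>. (if A (\<lambda>j. T n i j \<omega>) then ennreal ((recon n i t \<omega> - indiv i t \<omega>)\<^sup>2) else 0) \<partial>M) =
     (\<integral>\<^sup>+ \<omega>. g (des \<omega>, pth \<omega>, processes_at ?J v e (des \<omega>) \<omega>) \<partial>M)"
  proof (rule nn_integral_cong_AE)
    have "AE \<omega> in M. \<forall>j\<in>{..<m n i}. T n i j \<omega> \<in> {a<..<b}"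
      by (intro AE_finite_allI T_interior) (use i in auto)
    then show "AE \<omega> in M. (if A (\<lambda>j. T n i j \<omega>) then ennreal ((recon n i t \<omega> - indiv i t \<omega>)\<^sup>2) else 0) =
       g (des \<omega>, pth \<omega>, processes_at ?J v e (des \<omega>) \<omega>)"
    proof eventually_elim
      case (elim \<omega>)
      have "recon n i t \<omega> = lpk p K (h n) (m n i) (\<lambda>j. T n i j \<omega>)
          (\<lambda>j. indicator {a<..<b} (T n i j \<omega>) * \<eta> (T n i j \<omega>) + v i (T n i j \<omega>) \<omega> + e i (T n i j \<omega>) \<omega>) t"
        unfolding recon_def by (rule lpk_cong) (use elim in auto)
      then show ?case unfolding g_eval by simp
    qed
  qed
  also have "\<dots> = (\<integral>\<^sup>+ \<omega>'. (\<integral>\<^sup>+ \<omega>. g (des \<omega>', pth \<omega>, processes_at ?J v e (des \<omega>') \<omega>) \<partial>M) \<partial>M)"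
    by (rule key)
  finally show ?thesis unfolding g_eval .
qed

end

section \<open>Uniform mean squared error\<close>

text \<open>Uniform bounds on an interval \<open>(l, u)\<close> that contains every interior point within \<open>h0\<close> of \<open>S\<close>, and also a full
  half window at each point of \<open>S\<close>. Both kinds of sets in the theorem fit: for a compact set, \<open>(l, u)\<close> is a slightly
  larger interval; for bounds valid up to the end points, it is the whole interval.\<close>

locale lpk_region = lpk_model +
  fixes S :: "real set" and l u h0 c C\<eta> C\<gamma> C\<sigma> Cv :: real and D :: "nat \<Rightarrow> real \<Rightarrow> real"
    and G :: "nat \<Rightarrow> nat \<Rightarrow> real \<Rightarrow> real \<Rightarrow> real"
  assumes S_sub: "S \<subseteq> {l<..<u}" and lu: "a \<le> l" "u \<le> b" and h0: "0 < h0"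
    and near: "\<And>t x. t \<in> S \<Longrightarrow> x \<in> {a<..<b} \<Longrightarrow> \<bar>x - t\<bar> \<le> h0 \<Longrightarrow> x \<in> {l<..<u}"
    and side: "\<And>t. t \<in> S \<Longrightarrow> {t<..t + h0} \<subseteq> {l<..<u} \<or> {t - h0..<t} \<subseteq> {l<..<u}"
    and c: "0 < c" "\<And>x. x \<in> {l<..<u} \<Longrightarrow> c \<le> \<pi> x"
    and D0: "\<And>x. x \<in> {l<..<u} \<Longrightarrow> D 0 x = \<eta> x"
    and D: "\<And>j x. j < p + 1 \<Longrightarrow> x \<in> {l<..<u} \<Longrightarrow> (D j has_real_derivative D (Suc j) x) (at x)"
    and C\<eta>: "\<And>x. x \<in> {l<..<u} \<Longrightarrow> \<bar>D (p + 1) x\<bar> \<le> C\<eta>"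
    and G0: "\<And>x y. x \<in> {l<..<u} \<Longrightarrow> y \<in> {l<..<u} \<Longrightarrow> G 0 0 x y = \<gamma> x y"
    and G1: "\<And>j x y. j < p + 1 \<Longrightarrow> x \<in> {l<..<u} \<Longrightarrow> y \<in> {l<..<u} \<Longrightarrow>
      ((\<lambda>x. G j 0 x y) has_real_derivative G (Suc j) 0 x y) (at x)"
    and G2: "\<And>k x y. k < p + 1 \<Longrightarrow> x \<in> {l<..<u} \<Longrightarrow> y \<in> {l<..<u} \<Longrightarrow>
      (G (p + 1) k x has_real_derivative G (p + 1) (Suc k) x y) (at y)"
    and C\<gamma>: "\<And>x y. x \<in> {l<..<u} \<Longrightarrow> y \<in> {l<..<u} \<Longrightarrow> \<bar>G (p + 1) (p + 1) x y\<bar> \<le> C\<gamma>"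
    and C\<sigma>: "\<And>x. x \<in> {l<..<u} \<Longrightarrow> (\<sigma> x)\<^sup>2 \<le> C\<sigma>" "0 \<le> C\<sigma>"
    and Cv: "\<And>x. x \<in> {l<..<u} \<Longrightarrow> \<gamma> x x \<le> Cv" "0 \<le> Cv"
begin

lemma region_sub: "{l<..<u} \<subseteq> {a<..<b}" "{l<..<u} \<subseteq> {a..b}" "S \<subseteq> {a..b}"
  using lu S_sub by auto

definition lam :: real where
  "lam = (SOME lam. 0 < lam \<and> (\<forall>a A. A = {0<..} \<or> A = {..<0::real} \<longrightarrow> lam * (\<Sum>r<p + 1. (a r)\<^sup>2) \<le>
    (\<integral>u. indicator A u * (K u * (\<Sum>r<p + 1. a r * u ^ r)\<^sup>2) \<partial>lborel)))"

lemma lam: "0 < lam" "\<And>a A. A = {0<..} \<or> A = {..<0::real} \<Longrightarrow> lam * (\<Sum>r<p + 1. (a r)\<^sup>2) \<le>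
    (\<integral>u. indicator A u * (K u * (\<Sum>r<p + 1. a r * u ^ r)\<^sup>2) \<partial>lborel)"
proof -
  have "\<exists>lam. 0 < lam \<and> (\<forall>a A. A = {0<..} \<or> A = {..<0::real} \<longrightarrow> lam * (\<Sum>r<p + 1. (a r)\<^sup>2) \<le>
    (\<integral>u. indicator A u * (K u * (\<Sum>r<p + 1. a r * u ^ r)\<^sup>2) \<partial>lborel))"
    by (rule half_kernel_form[of "p + 1", OF _ kernel]) (simp, blast)
  from someI_ex[OF this] show "0 < lam" "\<And>a A. A = {0<..} \<or> A = {..<0::real} \<Longrightarrow> lam * (\<Sum>r<p + 1. (a r)\<^sup>2) \<le>
    (\<integral>u. indicator A u * (K u * (\<Sum>r<p + 1. a r * u ^ r)\<^sup>2) \<partial>lborel)"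
    unfolding lam_def by blast+
qed

definition P\<pi> :: real where "P\<pi> = (SOME P. \<forall>x. \<pi> x \<le> P)"

lemma P\<pi>: "\<pi> x \<le> P\<pi>"
  using someI_ex[OF design_density_bounded[OF density ab]] unfolding P\<pi>_def by blast

definition BK :: real where "BK = (SOME B. 0 < B \<and> (\<forall>u. K u \<le> B))"

lemma BK: "0 < BK" "K x \<le> BK"
proof -
  have "\<exists>B. 0 < B \<and> (\<forall>u. K u \<le> B)" using K_bound by metis
  from someI_ex[OF this] show "0 < BK" "K x \<le> BK" unfolding BK_def by blast+
qed

definition \<kappa> :: real where "\<kappa> = c * lam / (2 * (real p + 1))"

lemma \<kappa>: "0 < \<kappa>" "\<kappa> * (real p + 1) = c * lam / 2"
proof -
  have "0 < 2 * (real p + 1)" by simp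
  then show "0 < \<kappa>" unfolding \<kappa>_def using c(1) lam(1) by (intro divide_pos_pos mult_pos_pos add_nonneg_pos) auto
  show "\<kappa> * (real p + 1) = c * lam / 2" unfolding \<kappa>_def by (simp add: field_simps)
qed

definition good :: "nat \<Rightarrow> nat \<Rightarrow> real \<Rightarrow> 'a \<Rightarrow> bool" where
  "good n i t \<omega> \<longleftrightarrow> good_design K (p + 1) \<kappa> (h n) (local_moment \<pi> K (h n) t) (m n i) (\<lambda>j. T n i j \<omega>) t"

lemma good_meas: "i < n \<Longrightarrow> {\<omega>\<in>space M. good n i t \<omega>} \<in> sets M"
  unfolding good_def by (rule measurable_good_design[OF K_meas T_meas])

lemma m_pos: "i < n \<Longrightarrow> 0 < m n i"
proof -
  assume i: "i < n"
  then have "0 < C * real n powr \<delta>" using C_pos by simp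
  with m_ge[OF i] show ?thesis by (metis less_le_trans of_nat_0_less_iff)
qed

lemma bad_prob:
  assumes "i < n"
  shows "prob {\<omega>\<in>space M. \<not> good n i t \<omega>} \<le>
    real (2 * (p + 1)) * (2 * exp (- (\<kappa>\<^sup>2 / (2 * BK\<^sup>2) * (real (m n i) * (h n)\<^sup>2))))"
  unfolding good_def
  by (rule bad_design_prob[OF prob_space_axioms T_indep[OF assms] T_distr[OF assms] \<pi>_nonneg \<pi>_meas kernel BK(2,1) h_pos m_pos[OF assms] \<kappa>(1)])

definition A1 :: real where "A1 = (real p + 1) * (P\<pi> + \<kappa>) / (c * lam / 2)"
definition A2 :: real where "A2 = BK / (c * lam / 2)"

lemma A2_pos: "0 < A2"
  unfolding A2_def using BK(1) c(1) lam(1) by simp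

text \<open>Conditionally on a good design with distinct points the weights are available and the fixed design bound
  applies. Averaging over the design keeps the bound because it is uniform.\<close>

lemma mse_bound:
  assumes i: "i < n" and t: "t \<in> S" and hn: "h n \<le> h0"
  shows "(\<integral>\<^sup>+\<omega>. (if good n i t \<omega> then ennreal ((recon n i t \<omega> - indiv i t \<omega>)\<^sup>2) else 0) \<partial>M) \<le>
    ennreal (3 * ((A1 * h n ^ (p + 1))\<^sup>2 * (C\<eta>\<^sup>2 + C\<gamma>) + C\<sigma> * (A2 / (real (m n i) * h n))))"
    (is "_ \<le> ennreal ?B")
proof -
  have tl: "t \<in> {l<..<u}" and tab: "t \<in> {a..b}" using t S_sub region_sub by auto
  have C\<gamma>0: "0 \<le> C\<gamma>" using C\<gamma>[OF tl tl] by linarith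
  have mh: "0 < real (m n i) * h n" using m_pos[OF i] h_pos by simp
  have "(\<integral>\<^sup>+\<omega>. (if good n i t \<omega> then ennreal ((recon n i t \<omega> - indiv i t \<omega>)\<^sup>2) else 0) \<partial>M) =
    (\<integral>\<^sup>+\<omega>'. (\<integral>\<^sup>+\<omega>. (if good n i t \<omega>' then
        ennreal ((lpk p K (h n) (m n i) (\<lambda>j. T n i j \<omega>')
          (\<lambda>j. indicator {a<..<b} (T n i j \<omega>') * \<eta> (T n i j \<omega>') + v i (T n i j \<omega>') \<omega> + e i (T n i j \<omega>') \<omega>) t
          - indiv i t \<omega>)\<^sup>2) else 0) \<partial>M) \<partial>M)"
    unfolding good_def by (rule condition_on_design[OF i tab refl])
  also have "\<dots> \<le> (\<integral>\<^sup>+\<omega>'. ennreal ?B \<partial>M)"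
  proof (rule nn_integral_mono_AE)
    have "AE \<omega> in M. \<forall>j\<in>{..<m n i}. T n i j \<omega> \<in> {a<..<b}"
      by (intro AE_finite_allI T_interior) (use i in auto)
    with T_distinct[OF i]
    show "AE \<omega>' in M. (\<integral>\<^sup>+\<omega>. (if good n i t \<omega>' then
        ennreal ((lpk p K (h n) (m n i) (\<lambda>j. T n i j \<omega>')
          (\<lambda>j. indicator {a<..<b} (T n i j \<omega>') * \<eta> (T n i j \<omega>') + v i (T n i j \<omega>') \<omega> + e i (T n i j \<omega>') \<omega>) t
          - indiv i t \<omega>)\<^sup>2) else 0) \<partial>M) \<le> ennreal ?B"
    proof eventually_elim
      case (elim \<omega>')
      show ?case
      proof (cases "good n i t \<omega>'")
        case False then show ?thesis by simp
      next
        case True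
        define \<tau> where "\<tau> j = T n i j \<omega>'" for j
        have \<tau>: "\<tau> j \<in> {a<..<b}" if "j < m n i" for j using elim that by (simp add: \<tau>_def)
        have "\<exists>w. (\<forall>y. lpk p K (h n) (m n i) \<tau> y t = (\<Sum>j<m n i. w j * y j)) \<and>
          (\<forall>r<p + 1. (\<Sum>j<m n i. w j * (\<tau> j - t) ^ r) = (if r = 0 then 1 else 0)) \<and>
          (\<forall>j<m n i. h n < \<bar>\<tau> j - t\<bar> \<longrightarrow> w j = 0) \<and>
          (\<Sum>j<m n i. \<bar>w j\<bar>) \<le> (real p + 1) * (P\<pi> + \<kappa>) / (c * lam / 2) \<and>
          (\<Sum>j<m n i. (w j)\<^sup>2) \<le> BK / (c * lam / 2) / (real (m n i) * h n)"
        proof (rule good_design_weights[OF h_pos m_pos[OF i] _ \<kappa>(2) K_nonneg BK(2) K_support])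
          show "0 < c * lam" using c(1) lam(1) by simp
          show "local_moment \<pi> K (h n) t 0 \<le> P\<pi> * h n"
            by (rule local_moment_0[OF kernel h_pos \<pi>_meas \<pi>_nonneg P\<pi>])
          show "good_design K (p + 1) \<kappa> (h n) (local_moment \<pi> K (h n) t) (m n i) \<tau> t"
            using True unfolding good_def \<tau>_def .
          fix a :: "nat \<Rightarrow> real"
          have "{t<..t + h n} \<subseteq> {l<..<u} \<or> {t - h n..<t} \<subseteq> {l<..<u}"
          proof -
            have "{t<..t + h n} \<subseteq> {t<..t + h0}" "{t - h n..<t} \<subseteq> {t - h0..<t}" using hn by auto
            then show ?thesis using side[OF t] by blast
          qed
          from local_moment_lower[OF kernel h_pos \<pi>_meas \<pi>_nonneg P\<pi> c(2) c(1) this lam(2)]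
          show "c * lam * h n * (\<Sum>r<p + 1. (a r)\<^sup>2) \<le>
             (\<Sum>r<p + 1. \<Sum>s<p + 1. a r * a s * local_moment \<pi> K (h n) t (r + s))"
            by (simp only: mult.commute mult.left_commute mult.assoc)
        qed
        then obtain w where w: "\<And>y. lpk p K (h n) (m n i) \<tau> y t = (\<Sum>j<m n i. w j * y j)"
            and rep: "\<And>r. r < p + 1 \<Longrightarrow> (\<Sum>j<m n i. w j * (\<tau> j - t) ^ r) = (if r = 0 then 1 else 0)"
            and supp: "\<And>j. j < m n i \<Longrightarrow> h n < \<bar>\<tau> j - t\<bar> \<Longrightarrow> w j = 0"
            and w1: "(\<Sum>j<m n i. \<bar>w j\<bar>) \<le> A1" and w2: "(\<Sum>j<m n i. (w j)\<^sup>2) \<le> A2 / (real (m n i) * h n)"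
          unfolding A1_def A2_def by blast
        (* Only points with nonzero weight are known to lie in the window, hence in (l, u). *)
        define J where "J = {j\<in>{..<m n i}. w j \<noteq> 0}"
        have J: "finite J" "J \<subseteq> {..<m n i}" "\<And>j. j \<in> {..<m n i} - J \<Longrightarrow> w j = 0" by (auto simp: J_def)
        have restr: "(\<Sum>j<m n i. w j * y j) = (\<Sum>j\<in>J. w j * y j)" for y
          by (rule sum.mono_neutral_right) (use J in auto)
        have Jh: "\<bar>\<tau> j - t\<bar> \<le> h n" if "j \<in> J" for j using supp[of j] that by (auto simp: J_def not_less[symmetric])
        have Jlu: "\<tau> j \<in> {l<..<u}" if "j \<in> J" for j
          using near[OF t \<tau>[of j]] Jh[OF that] hn J(2) that by auto
        have "(\<integral>\<^sup>+\<omega>. ennreal (((\<Sum>j\<in>J. w j * (D 0 (\<tau> j) + v i (\<tau> j) \<omega> + e i (\<tau> j) \<omega>)) - D 0 t - v i t \<omega>)\<^sup>2) \<partial>M) \<le>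
          ennreal (3 * (((\<Sum>j\<in>J. \<bar>w j\<bar>) * h n ^ (p + 1))\<^sup>2 * (C\<eta>\<^sup>2 + C\<gamma>) + C\<sigma> * (\<Sum>j\<in>J. (w j)\<^sup>2)))"
        proof (rule fixed_design_mse[where G=G and S="\<lambda>x. (\<sigma> x)\<^sup>2", OF J(1) Jlu Jh _ tl _ _ D C\<eta> G1 G2 C\<gamma> _ _ C\<sigma>(1) prob_space_axioms])
          show "inj_on \<tau> J" using elim J(2) unfolding \<tau>_def by (meson inj_on_subset)
          show "(\<Sum>j\<in>J. w j * (\<tau> j - t) ^ r) = (if r = 0 then 1 else 0)" if "r < p + 1" for r
            using rep[OF that] unfolding restr .
          show "has_bochner_integral M (\<lambda>\<omega>. v i x \<omega> * v i y \<omega>) (G 0 0 x y)" if "x \<in> {l<..<u}" "y \<in> {l<..<u}" for x y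
            unfolding G0[OF that] using that region_sub by (intro v_cov) auto
          show "has_bochner_integral M (\<lambda>\<omega>. e i x \<omega> * e i y \<omega>) (if x = y then (\<sigma> x)\<^sup>2 else 0)"
            if "x \<in> {l<..<u}" "y \<in> {l<..<u}" for x y
          proof -
            have "x \<in> {a..b}" "y \<in> {a..b}" using that region_sub by blast+
            moreover have "(if x = y then (\<sigma> x)\<^sup>2 else 0) = (if x = y then (\<sigma> y)\<^sup>2 else 0)" by simp
            ultimately show ?thesis using e_cov[of x y i] by (simp only:)
          qed
        qed auto
        also have "\<dots> \<le> ennreal ?B"
        proof (rule ennreal_leI)
          have "(\<Sum>j\<in>J. \<bar>w j\<bar>) \<le> A1"
            using w1 sum_mono2[OF finite_lessThan J(2), of "\<lambda>j. \<bar>w j\<bar>"] by simp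
          then have "((\<Sum>j\<in>J. \<bar>w j\<bar>) * h n ^ (p + 1))\<^sup>2 \<le> (A1 * h n ^ (p + 1))\<^sup>2"
            using h_pos[of n] by (intro power_mono mult_right_mono mult_nonneg_nonneg sum_nonneg) auto
          then have "((\<Sum>j\<in>J. \<bar>w j\<bar>) * h n ^ (p + 1))\<^sup>2 * (C\<eta>\<^sup>2 + C\<gamma>) \<le> (A1 * h n ^ (p + 1))\<^sup>2 * (C\<eta>\<^sup>2 + C\<gamma>)"
            using C\<gamma>0 by (intro mult_right_mono) auto
          moreover have "(\<Sum>j\<in>J. (w j)\<^sup>2) \<le> A2 / (real (m n i) * h n)"
            using w2 sum_mono2[OF finite_lessThan J(2), of "\<lambda>j. (w j)\<^sup>2"] by simp
          then have "C\<sigma> * (\<Sum>j\<in>J. (w j)\<^sup>2) \<le> C\<sigma> * (A2 / (real (m n i) * h n))"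
            by (intro mult_left_mono C\<sigma>(2))
          ultimately show "3 * (((\<Sum>j\<in>J. \<bar>w j\<bar>) * h n ^ (p + 1))\<^sup>2 * (C\<eta>\<^sup>2 + C\<gamma>) + C\<sigma> * (\<Sum>j\<in>J. (w j)\<^sup>2)) \<le> ?B"
            by (rule mult_left_mono[OF add_mono]) simp
        qed
        finally have 1: "(\<integral>\<^sup>+\<omega>. ennreal (((\<Sum>j\<in>J. w j * (D 0 (\<tau> j) + v i (\<tau> j) \<omega> + e i (\<tau> j) \<omega>)) - D 0 t - v i t \<omega>)\<^sup>2) \<partial>M) \<le> ennreal ?B" .
        have 2: "lpk p K (h n) (m n i) (\<lambda>j. T n i j \<omega>')
          (\<lambda>j. indicator {a<..<b} (T n i j \<omega>') * \<eta> (T n i j \<omega>') + v i (T n i j \<omega>') \<omega> + e i (T n i j \<omega>') \<omega>) t =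
          (\<Sum>j\<in>J. w j * (D 0 (\<tau> j) + v i (\<tau> j) \<omega> + e i (\<tau> j) \<omega>))" for \<omega>
          unfolding \<tau>_def[symmetric] w restr
        proof (rule sum.cong[OF refl])
          fix j assume j: "j \<in> J"
          then have "\<tau> j \<in> {a<..<b}" using Jlu region_sub by blast
          then show "w j * (indicator {a<..<b} (\<tau> j) * \<eta> (\<tau> j) + v i (\<tau> j) \<omega> + e i (\<tau> j) \<omega>) =
            w j * (D 0 (\<tau> j) + v i (\<tau> j) \<omega> + e i (\<tau> j) \<omega>)" using D0[OF Jlu[OF j]] by simp
        qed
        have 3: "indiv i t \<omega> = D 0 t + v i t \<omega>" for \<omega> using D0[OF tl] by (simp add: indiv_def)
        show ?thesis using True 1 unfolding 2 3 by (simp add: diff_diff_eq)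
      qed
    qed
  qed
  also have "\<dots> = ennreal ?B" by (simp add: emeasure_space_1)
  finally show ?thesis .
qed

end

context lpk_model
begin

definition \<beta> :: real where "\<beta> = \<delta> / (2 * real p + 3)"

lemma \<beta>_pos: "0 < \<beta>" unfolding \<beta>_def using \<delta>_pos by simp

lemma rate_eq: "rate n = real n powr (- ((real p + 1) * \<beta>))"
  by (simp add: rate_def \<beta>_def)

lemma rate_pos: "0 < n \<Longrightarrow> 0 < rate n" by (simp add: rate_def)

lemma rate_le_1: "0 < n \<Longrightarrow> rate n \<le> 1"
proof -
  assume "0 < n"
  then have "real n powr (- ((real p + 1) * \<beta>)) \<le> real n powr 0"
    using \<beta>_pos by (intro powr_mono) auto
  then show ?thesis using \<open>0 < n\<close> by (simp add: rate_eq)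
qed

lemma rate_sq: "0 < n \<Longrightarrow> (rate n)\<^sup>2 = real n powr (- (2 * (real p + 1) * \<beta>))"
  by (simp add: rate_eq power2_eq_square powr_add[symmetric] algebra_simps)

text \<open>These exponents balance the errors: \<open>n\<^sup>\<delta> h\<close> is of the order of the inverse squared rate, and \<open>n\<^sup>\<delta> h\<^sup>2\<close> is
  still a positive power of \<open>n\<close>.\<close>

lemma \<delta>_minus_\<beta>: "\<delta> + - \<beta> = 2 * (real p + 1) * \<beta>" "\<delta> + (- \<beta> + - \<beta>) = (2 * real p + 1) * \<beta>"
proof -
  have "\<beta> * (2 * real p + 3) = \<delta>" unfolding \<beta>_def by (simp add: add_nonneg_eq_0_iff)
  then show "\<delta> + - \<beta> = 2 * (real p + 1) * \<beta>" "\<delta> + (- \<beta> + - \<beta>) = (2 * real p + 1) * \<beta>"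
    by (auto simp: algebra_simps)
qed

lemma bandwidth_bounds:
  obtains c1 c2 where "0 < c1" "0 < c2"
    "\<forall>\<^sub>F n in sequentially. c1 * real n powr (- \<beta>) \<le> h n \<and> h n \<le> c2 * real n powr (- \<beta>)"
proof -
  have bw: "h \<in> \<Theta>(\<lambda>n. real n powr (- \<beta>))" using bandwidth by (simp add: \<beta>_def)
  obtain c2 where c2: "0 < c2" "\<forall>\<^sub>F n in sequentially. norm (h n) \<le> c2 * norm (real n powr (- \<beta>))"
    using bigthetaD1[OF bw] by (elim landau_o.bigE)
  obtain c1 where c1: "0 < c1" "\<forall>\<^sub>F n in sequentially. norm (h n) \<ge> c1 * norm (real n powr (- \<beta>))"
    using bigthetaD2[OF bw] by (elim landau_omega.bigE)
  show ?thesis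
  proof (rule that[OF c1(1) c2(1)])
    show "\<forall>\<^sub>F n in sequentially. c1 * real n powr (- \<beta>) \<le> h n \<and> h n \<le> c2 * real n powr (- \<beta>)"
      using c1(2) c2(2) by eventually_elim (use h_pos in \<open>auto simp: abs_of_pos\<close>)
  qed
qed

end

context lpk_region
begin

lemma mse_rate:
  "\<exists>A\<ge>0. \<forall>\<^sub>F n in sequentially. \<forall>i<n. \<forall>t\<in>S.
     (\<integral>\<^sup>+\<omega>. (if good n i t \<omega> then ennreal ((recon n i t \<omega> - indiv i t \<omega>)\<^sup>2) else 0) \<partial>M) \<le> ennreal (A * (rate n)\<^sup>2)"
proof -
  obtain c1 c2 where c12: "0 < c1" "0 < c2"
    and ev: "\<forall>\<^sub>F n in sequentially. c1 * real n powr (- \<beta>) \<le> h n \<and> h n \<le> c2 * real n powr (- \<beta>)"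
    by (rule bandwidth_bounds)
  define A where "A = 3 * ((A1 * c2 ^ (p + 1))\<^sup>2 * (C\<eta>\<^sup>2 + \<bar>C\<gamma>\<bar>) + C\<sigma> * (A2 / (C * c1)))"
  have "0 \<le> A" unfolding A_def using C\<sigma>(2) A2_pos C_pos c12 by (intro mult_nonneg_nonneg add_nonneg_nonneg) auto
  moreover have "\<forall>\<^sub>F n in sequentially. h n < h0" using order_tendstoD(2)[OF h_lim h0] .
  with ev have "\<forall>\<^sub>F n in sequentially. \<forall>i<n. \<forall>t\<in>S.
     (\<integral>\<^sup>+\<omega>. (if good n i t \<omega> then ennreal ((recon n i t \<omega> - indiv i t \<omega>)\<^sup>2) else 0) \<partial>M) \<le> ennreal (A * (rate n)\<^sup>2)"
    using eventually_gt_at_top[of 0]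
  proof eventually_elim
    case (elim n)
    then have n: "0 < n" and hn: "h n \<le> h0" by auto
    show ?case
    proof (intro allI impI ballI)
      fix i t assume i: "i < n" and t: "t \<in> S"
      have hp: "h n ^ (p + 1) \<le> c2 ^ (p + 1) * rate n"
      proof -
        have "h n ^ (p + 1) \<le> (c2 * real n powr (- \<beta>)) ^ (p + 1)"
          using elim h_pos[of n] by (intro power_mono) auto
        also have "\<dots> = c2 ^ (p + 1) * (real n powr (- \<beta>)) ^ (p + 1)" by (rule power_mult_distrib)
        also have "(real n powr (- \<beta>)) ^ (p + 1) = (real n powr (- \<beta>)) powr real (p + 1)"
          using n by (intro powr_realpow[symmetric]) simp
        also have "\<dots> = rate n" by (simp add: rate_eq powr_powr algebra_simps)
        finally show ?thesis .
      qed
      have A1_0: "0 \<le> A1"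
      proof -
        have "0 \<le> P\<pi>" using P\<pi>[of a] \<pi>_nonneg[of a] by linarith
        then show ?thesis unfolding A1_def using \<kappa>(1) c(1) lam(1) by simp
      qed
      have 1: "(A1 * h n ^ (p + 1))\<^sup>2 \<le> (A1 * c2 ^ (p + 1))\<^sup>2 * (rate n)\<^sup>2"
      proof -
        have "(A1 * h n ^ (p + 1))\<^sup>2 \<le> (A1 * (c2 ^ (p + 1) * rate n))\<^sup>2"
          using hp A1_0 h_pos[of n] by (intro power_mono mult_left_mono mult_nonneg_nonneg) auto
        then show ?thesis by (simp only: power_mult_distrib mult.assoc)
      qed
      have 2: "A2 / (real (m n i) * h n) \<le> A2 / (C * c1) * (rate n)\<^sup>2"
      proof -
        have "(C * real n powr \<delta>) * (c1 * real n powr (- \<beta>)) \<le> real (m n i) * h n"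
          using m_ge[OF i] elim C_pos c12 h_pos[of n] by (intro mult_mono) auto
        moreover have "real n powr \<delta> * real n powr (- \<beta>) = real n powr (2 * (real p + 1) * \<beta>)"
          unfolding powr_add[symmetric] \<delta>_minus_\<beta>(1) ..
        ultimately have "(C * c1) * real n powr (2 * (real p + 1) * \<beta>) \<le> real (m n i) * h n"
          by (simp add: mult_ac)
        moreover have "0 < (C * c1) * real n powr (2 * (real p + 1) * \<beta>)" using C_pos c12 n by simp
        ultimately have "A2 / (real (m n i) * h n) \<le> A2 / ((C * c1) * real n powr (2 * (real p + 1) * \<beta>))"
          using A2_pos by (intro frac_le) auto
        also have "\<dots> = A2 / (C * c1) * (rate n)\<^sup>2"
          unfolding rate_sq[OF n] powr_minus by (simp add: divide_inverse)
        finally show ?thesis .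
      qed
      have "(\<integral>\<^sup>+\<omega>. (if good n i t \<omega> then ennreal ((recon n i t \<omega> - indiv i t \<omega>)\<^sup>2) else 0) \<partial>M) \<le>
        ennreal (3 * ((A1 * h n ^ (p + 1))\<^sup>2 * (C\<eta>\<^sup>2 + C\<gamma>) + C\<sigma> * (A2 / (real (m n i) * h n))))"
        by (rule mse_bound[OF i t hn])
      also have "\<dots> \<le> ennreal (A * (rate n)\<^sup>2)"
      proof (rule ennreal_leI)
        have "(A1 * h n ^ (p + 1))\<^sup>2 * (C\<eta>\<^sup>2 + C\<gamma>) \<le> (A1 * h n ^ (p + 1))\<^sup>2 * (C\<eta>\<^sup>2 + \<bar>C\<gamma>\<bar>)"
          by (intro mult_left_mono) auto
        also have "\<dots> \<le> (A1 * c2 ^ (p + 1))\<^sup>2 * (rate n)\<^sup>2 * (C\<eta>\<^sup>2 + \<bar>C\<gamma>\<bar>)"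
          by (intro mult_right_mono 1) auto
        finally have e1: "(A1 * h n ^ (p + 1))\<^sup>2 * (C\<eta>\<^sup>2 + C\<gamma>) \<le> (A1 * c2 ^ (p + 1))\<^sup>2 * (rate n)\<^sup>2 * (C\<eta>\<^sup>2 + \<bar>C\<gamma>\<bar>)" .
        have e2: "C\<sigma> * (A2 / (real (m n i) * h n)) \<le> C\<sigma> * (A2 / (C * c1) * (rate n)\<^sup>2)"
          by (intro mult_left_mono 2 C\<sigma>(2))
        have e3: "A * (rate n)\<^sup>2 = 3 * ((A1 * c2 ^ (p + 1))\<^sup>2 * (rate n)\<^sup>2 * (C\<eta>\<^sup>2 + \<bar>C\<gamma>\<bar>) + C\<sigma> * (A2 / (C * c1) * (rate n)\<^sup>2))"
        proof -
          have "3 * (x * z + s * w) * r = 3 * (x * r * z + s * (w * r))" for x z s w r :: real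
            by (simp add: algebra_simps)
          then show ?thesis unfolding A_def .
        qed
        show "3 * ((A1 * h n ^ (p + 1))\<^sup>2 * (C\<eta>\<^sup>2 + C\<gamma>) + C\<sigma> * (A2 / (real (m n i) * h n))) \<le> A * (rate n)\<^sup>2"
          unfolding e3 by (rule mult_left_mono[OF add_mono[OF e1 e2]]) simp
      qed
      finally show "(\<integral>\<^sup>+\<omega>. (if good n i t \<omega> then ennreal ((recon n i t \<omega> - indiv i t \<omega>)\<^sup>2) else 0) \<partial>M) \<le> ennreal (A * (rate n)\<^sup>2)" .
    qed
  qed
  ultimately show ?thesis by blast
qed

text \<open>The union bound over \<open>n\<close> subjects costs a factor \<open>n\<close>, which the stretched exponential absorbs.\<close>

lemma bad_rate:
  "\<exists>bd. bd \<longlonglongrightarrow> 0 \<and> (\<forall>\<^sub>F n in sequentially. \<forall>t. (\<Sum>i<n. prob {\<omega>\<in>space M. \<not> good n i t \<omega>}) \<le> bd n)"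
proof -
  obtain c1 c2 where c12: "0 < c1" "0 < c2"
    and ev: "\<forall>\<^sub>F n in sequentially. c1 * real n powr (- \<beta>) \<le> h n \<and> h n \<le> c2 * real n powr (- \<beta>)"
    by (rule bandwidth_bounds)
  define \<epsilon> where "\<epsilon> = (2 * real p + 1) * \<beta>"
  define k where "k = \<kappa>\<^sup>2 / (2 * BK\<^sup>2) * (C * c1\<^sup>2)"
  have \<epsilon>: "0 < \<epsilon>" unfolding \<epsilon>_def using \<beta>_pos by simp
  have k0: "0 < \<kappa>\<^sup>2 / (2 * BK\<^sup>2)" using \<kappa>(1) BK(1) by simp
  have k: "0 < k" unfolding k_def by (rule mult_pos_pos[OF k0]) (use C_pos c12 in simp)
  define bd where "bd n = 2 * real (2 * (p + 1)) * (real n * exp (- (k * real n powr \<epsilon>)))" for n :: nat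
  have "bd \<longlonglongrightarrow> 2 * real (2 * (p + 1)) * 0"
    unfolding bd_def by (intro tendsto_mult_left exp_power_decay \<epsilon> k)
  then have "bd \<longlonglongrightarrow> 0" by simp
  moreover have "\<forall>\<^sub>F n in sequentially. \<forall>t. (\<Sum>i<n. prob {\<omega>\<in>space M. \<not> good n i t \<omega>}) \<le> bd n"
    using ev eventually_gt_at_top[of 0]
  proof eventually_elim
    case (elim n)
    show ?case
    proof
      fix t
      have "(\<Sum>i<n. prob {\<omega>\<in>space M. \<not> good n i t \<omega>}) \<le> (\<Sum>i<n. real (2 * (p + 1)) * (2 * exp (- (k * real n powr \<epsilon>))))"
      proof (rule sum_mono)
        fix i assume "i \<in> {..<n}"
        then have i: "i < n" by simp
        have "C * c1\<^sup>2 * real n powr \<epsilon> \<le> real (m n i) * (h n)\<^sup>2"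
        proof -
          have "real n powr \<epsilon> = real n powr \<delta> * (real n powr (- \<beta>))\<^sup>2"
            unfolding power2_eq_square powr_add[symmetric] \<delta>_minus_\<beta>(2) \<epsilon>_def ..
          then have "C * c1\<^sup>2 * real n powr \<epsilon> = (C * real n powr \<delta>) * (c1 * real n powr (- \<beta>))\<^sup>2"
            by (simp add: power_mult_distrib)
          also have "\<dots> \<le> real (m n i) * (h n)\<^sup>2"
            using m_ge[OF i] elim C_pos c12 h_pos[of n] by (intro mult_mono power_mono) auto
          finally show ?thesis .
        qed
        then have "\<kappa>\<^sup>2 / (2 * BK\<^sup>2) * (C * c1\<^sup>2 * real n powr \<epsilon>) \<le> \<kappa>\<^sup>2 / (2 * BK\<^sup>2) * (real (m n i) * (h n)\<^sup>2)"
          using k0 by (intro mult_left_mono) auto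
        then have "k * real n powr \<epsilon> \<le> \<kappa>\<^sup>2 / (2 * BK\<^sup>2) * (real (m n i) * (h n)\<^sup>2)"
          by (simp add: k_def mult_ac)
        then have "real (2 * (p + 1)) * (2 * exp (- (\<kappa>\<^sup>2 / (2 * BK\<^sup>2) * (real (m n i) * (h n)\<^sup>2)))) \<le>
           real (2 * (p + 1)) * (2 * exp (- (k * real n powr \<epsilon>)))"
          by (intro mult_left_mono) auto
        with bad_prob[OF i, of t]
        show "prob {\<omega>\<in>space M. \<not> good n i t \<omega>} \<le> real (2 * (p + 1)) * (2 * exp (- (k * real n powr \<epsilon>)))"
          by linarith
      qed
      also have "\<dots> = bd n" by (simp add: bd_def)
      finally show "(\<Sum>i<n. prob {\<omega>\<in>space M. \<not> good n i t \<omega>}) \<le> bd n" .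
    qed
  qed
  ultimately show ?thesis by blast
qed

end

section \<open>Closeness of the sample moments\<close>

lemma centered_sum_le:
  fixes x :: "nat \<Rightarrow> real"
  assumes "0 < n"
  shows "(\<Sum>i<n. (x i - (\<Sum>j<n. x j) / real n)\<^sup>2) \<le> (\<Sum>i<n. (x i - k)\<^sup>2)"
proof -
  define xb where "xb = (\<Sum>j<n. x j) / real n"
  have s: "(\<Sum>i<n. x i - xb) = 0" using assms by (simp add: sum_subtractf xb_def)
  have "(x i - k)\<^sup>2 = (x i - xb)\<^sup>2 + (2 * (xb - k) * (x i - xb) + (xb - k)\<^sup>2)" for i
    by (simp add: power2_eq_square algebra_simps)
  then have "(\<Sum>i<n. (x i - k)\<^sup>2) = (\<Sum>i<n. (x i - xb)\<^sup>2) + ((\<Sum>i<n. 2 * (xb - k) * (x i - xb)) + (\<Sum>i<n. (xb - k)\<^sup>2))"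
    by (simp only: sum.distrib)
  also have "(\<Sum>i<n. 2 * (xb - k) * (x i - xb)) = 0" by (simp only: sum_distrib_left[symmetric] s mult_zero_right)
  finally have "(\<Sum>i<n. (x i - k)\<^sup>2) = (\<Sum>i<n. (x i - xb)\<^sup>2) + (\<Sum>i<n. (xb - k)\<^sup>2)" by simp
  moreover have "0 \<le> (\<Sum>i<n. (xb - k)\<^sup>2)" by (intro sum_nonneg) simp
  ultimately show ?thesis unfolding xb_def by linarith
qed

lemma abs_mean_le:
  fixes x :: "nat \<Rightarrow> real"
  assumes "(\<Sum>i<n. (x i)\<^sup>2) / real n \<le> B\<^sup>2" "0 \<le> B"
  shows "\<bar>(\<Sum>i<n. x i) / real n\<bar> \<le> B"
proof (cases "n = 0")
  case False
  have "(\<Sum>i<n. x i)\<^sup>2 \<le> (\<Sum>i<n. (x i)\<^sup>2) * real n"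
    using sum_squared_le_sum_of_squares[of x "{..<n}"] by simp
  also have "\<dots> \<le> (B\<^sup>2 * real n) * real n"
    using assms(1) False by (intro mult_right_mono) (simp_all add: pos_divide_le_eq)
  finally have "((\<Sum>i<n. x i) / real n)\<^sup>2 \<le> B\<^sup>2"
    using False by (simp add: power_divide pos_divide_le_eq power2_eq_square mult_ac)
  then show ?thesis using assms(2) abs_le_square_iff[of "(\<Sum>i<n. x i) / real n" B] by simp
qed (use assms in simp)

lemma centered_product_le:
  fixes x y :: "nat \<Rightarrow> real"
  assumes n: "0 < n" and X: "(\<Sum>i<n. (x i - k)\<^sup>2) / real n \<le> X\<^sup>2" "0 \<le> X"
    and Y: "(\<Sum>i<n. (y i - l)\<^sup>2) / real n \<le> Y\<^sup>2" "0 \<le> Y"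
  shows "\<bar>\<Sum>i<n. (x i - (\<Sum>j<n. x j) / real n) * (y i - (\<Sum>j<n. y j) / real n)\<bar> \<le> real n * (X * Y)"
proof -
  define xc yc where "xc i = x i - (\<Sum>j<n. x j) / real n" and "yc i = y i - (\<Sum>j<n. y j) / real n" for i
  have x: "(\<Sum>i<n. (xc i)\<^sup>2) \<le> real n * X\<^sup>2"
    using centered_sum_le[OF n, of x k] X(1) n unfolding xc_def by (simp add: pos_divide_le_eq mult.commute)
  have y: "(\<Sum>i<n. (yc i)\<^sup>2) \<le> real n * Y\<^sup>2"
    using centered_sum_le[OF n, of y l] Y(1) n unfolding yc_def by (simp add: pos_divide_le_eq mult.commute)
  have "(\<Sum>i<n. xc i * yc i)\<^sup>2 \<le> (\<Sum>i<n. (xc i)\<^sup>2) * (\<Sum>i<n. (yc i)\<^sup>2)"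
    by (rule Cauchy_Schwarz_ineq_sum)
  also have "\<dots> \<le> (real n * X\<^sup>2) * (real n * Y\<^sup>2)"
    by (intro mult_mono x y sum_nonneg mult_nonneg_nonneg) auto
  finally have "(\<Sum>i<n. xc i * yc i)\<^sup>2 \<le> (real n * (X * Y))\<^sup>2" by (simp add: power_mult_distrib power2_eq_square mult_ac)
  then have "\<bar>\<Sum>i<n. xc i * yc i\<bar> \<le> \<bar>real n * (X * Y)\<bar>" by (simp only: abs_le_square_iff)
  then show ?thesis using X(2) Y(2) unfolding xc_def yc_def by simp
qed

text \<open>Centered sums of products are bilinear, so the difference consists of two products of an effect and
  an error and one product of two errors. The factor \<open>2\<close> bounds \<open>n / (n - 1)\<close>.\<close>

lemma sample_cov_perturbation:
  fixes F H :: "nat \<Rightarrow> real \<Rightarrow> 'a \<Rightarrow> real"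
  assumes n: "2 \<le> n" and V: "0 \<le> V" and R: "0 \<le> R"
    and Vs: "(\<Sum>i<n. (F i s \<omega> - k)\<^sup>2) / real n \<le> V\<^sup>2" and Vt: "(\<Sum>i<n. (F i t \<omega> - l)\<^sup>2) / real n \<le> V\<^sup>2"
    and Rs: "(\<Sum>i<n. (H i s \<omega> - F i s \<omega>)\<^sup>2) / real n \<le> R\<^sup>2"
    and Rt: "(\<Sum>i<n. (H i t \<omega> - F i t \<omega>)\<^sup>2) / real n \<le> R\<^sup>2"
  shows "\<bar>sample_cov n H s t \<omega> - sample_cov n F s t \<omega>\<bar> \<le> 2 * (2 * (V * R) + R * R)"
proof -
  define d where "d i r = H i r \<omega> - F i r \<omega>" for i r
  let ?c = "\<lambda>x i. x i - (\<Sum>j<n. x j) / real n"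
  have np: "0 < n" using n by simp
  have H: "?c (\<lambda>i. H i r \<omega>) i = ?c (\<lambda>i. F i r \<omega>) i + ?c (\<lambda>i. d i r) i" for r i
    by (simp add: d_def sum_subtractf diff_divide_distrib)
  let ?P = "\<lambda>x y. \<Sum>i<n. ?c x i * ?c y i"
  have eq: "?P (\<lambda>i. H i s \<omega>) (\<lambda>i. H i t \<omega>) - ?P (\<lambda>i. F i s \<omega>) (\<lambda>i. F i t \<omega>) =
      ?P (\<lambda>i. F i s \<omega>) (\<lambda>i. d i t) + ?P (\<lambda>i. d i s) (\<lambda>i. F i t \<omega>) + ?P (\<lambda>i. d i s) (\<lambda>i. d i t)"
    unfolding H by (simp only: distrib_left distrib_right sum.distrib)
  have b1: "\<bar>?P (\<lambda>i. F i s \<omega>) (\<lambda>i. d i t)\<bar> \<le> real n * (V * R)"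
    by (rule centered_product_le[OF np Vs V _ R, where l=0]) (use Rt in \<open>simp add: d_def\<close>)
  have b2: "\<bar>?P (\<lambda>i. d i s) (\<lambda>i. F i t \<omega>)\<bar> \<le> real n * (R * V)"
    by (rule centered_product_le[OF np _ R Vt V, where k=0]) (use Rs in \<open>simp add: d_def\<close>)
  have b3: "\<bar>?P (\<lambda>i. d i s) (\<lambda>i. d i t)\<bar> \<le> real n * (R * R)"
    by (rule centered_product_le[OF np _ R _ R, where k=0 and l=0]) (use Rs Rt in \<open>simp_all add: d_def\<close>)
  have "\<bar>sample_cov n H s t \<omega> - sample_cov n F s t \<omega>\<bar> =
      \<bar>?P (\<lambda>i. H i s \<omega>) (\<lambda>i. H i t \<omega>) - ?P (\<lambda>i. F i s \<omega>) (\<lambda>i. F i t \<omega>)\<bar> / (real n - 1)"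
    using n by (simp add: sample_cov_def sample_mean_def diff_divide_distrib[symmetric])
  also have "\<dots> \<le> (real n * (V * R) + real n * (R * V) + real n * (R * R)) / (real n - 1)"
    unfolding eq using b1 b2 b3 n by (intro divide_right_mono) linarith+
  also have "\<dots> = (real n / (real n - 1)) * (2 * (V * R) + R * R)" by (simp add: algebra_simps add_divide_distrib)
  also have "\<dots> \<le> 2 * (2 * (V * R) + R * R)"
  proof (rule mult_right_mono)
    show "real n / (real n - 1) \<le> 2" using n by (simp add: pos_divide_le_eq)
  qed (use V R in simp)
  finally show ?thesis .
qed

context lpk_region
begin

definition mean_sq_err :: "nat \<Rightarrow> real \<Rightarrow> 'a \<Rightarrow> real" where
  "mean_sq_err n t \<omega> = (\<Sum>i<n. (recon n i t \<omega> - indiv i t \<omega>)\<^sup>2) / real n"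

definition mean_sq_effect :: "nat \<Rightarrow> real \<Rightarrow> 'a \<Rightarrow> real" where
  "mean_sq_effect n t \<omega> = (\<Sum>i<n. (indiv i t \<omega> - \<eta> t)\<^sup>2) / real n"

lemma S_interval: "t \<in> S \<Longrightarrow> t \<in> {a..b}" using region_sub by blast

lemma mean_sq_err_meas: "t \<in> S \<Longrightarrow> mean_sq_err n t \<in> borel_measurable M"
  unfolding mean_sq_err_def[abs_def]
  by (intro borel_measurable_divide borel_measurable_sum borel_measurable_power borel_measurable_diff
      borel_measurable_const recon_meas indiv_meas S_interval) auto

lemma mean_sq_effect_meas: "t \<in> S \<Longrightarrow> mean_sq_effect n t \<in> borel_measurable M"
  unfolding mean_sq_effect_def[abs_def]
  by (intro borel_measurable_divide borel_measurable_sum borel_measurable_power borel_measurable_diff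
      borel_measurable_const indiv_meas S_interval)

text \<open>Errors are truncated to the event of a good design, where they have finite second moments, and
  Markov's inequality is applied to their average. The truncation matters with probability
  tending to \<open>0\<close>, uniformly in \<open>t\<close>.\<close>

lemma mean_sq_err_bound:
  assumes \<epsilon>: "0 < \<epsilon>"
  shows "\<exists>B\<ge>0. \<exists>N. \<forall>n\<ge>N. \<forall>t\<in>S. prob {\<omega>\<in>space M. mean_sq_err n t \<omega> > (B * rate n)\<^sup>2} < \<epsilon>"
proof -
  obtain A where A: "0 \<le> A" and mse: "\<forall>\<^sub>F n in sequentially. \<forall>i<n. \<forall>t\<in>S.
     (\<integral>\<^sup>+\<omega>. (if good n i t \<omega> then ennreal ((recon n i t \<omega> - indiv i t \<omega>)\<^sup>2) else 0) \<partial>M) \<le> ennreal (A * (rate n)\<^sup>2)"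
    using mse_rate by blast
  obtain bd where bd: "bd \<longlonglongrightarrow> 0" "\<forall>\<^sub>F n in sequentially. \<forall>t. (\<Sum>i<n. prob {\<omega>\<in>space M. \<not> good n i t \<omega>}) \<le> bd n"
    using bad_rate by blast
  (* Markov then gives probability A / B^2 < \<epsilon> / 2; adding 1 keeps B positive when A = 0. *)
  define B where "B = sqrt (2 * (A + 1) / \<epsilon>)"
  have B: "0 < B" "B\<^sup>2 = 2 * (A + 1) / \<epsilon>" unfolding B_def using A \<epsilon> by simp_all
  have "\<forall>\<^sub>F n in sequentially. bd n < \<epsilon> / 2" using order_tendstoD(2)[OF bd(1), of "\<epsilon> / 2"] \<epsilon> by simp
  with mse bd(2) have "\<forall>\<^sub>F n in sequentially. \<forall>t\<in>S. prob {\<omega>\<in>space M. mean_sq_err n t \<omega> > (B * rate n)\<^sup>2} < \<epsilon>"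
    using eventually_gt_at_top[of 0]
  proof eventually_elim
    case (elim n)
    then have n: "0 < n" by simp
    show ?case
    proof
      fix t assume t: "t \<in> S"
      define Z where "Z i \<omega> = (if good n i t \<omega> then (recon n i t \<omega> - indiv i t \<omega>)\<^sup>2 else 0)" for i \<omega>
      have Zm: "Z i \<in> borel_measurable M" if "i < n" for i
        unfolding Z_def[abs_def] using good_meas[OF that, of t] recon_meas[OF that] indiv_meas[OF S_interval[OF t]]
        by (intro measurable_If borel_measurable_power borel_measurable_diff) auto
      have Zi: "integrable M (Z i)" "(\<integral>\<omega>. Z i \<omega> \<partial>M) \<le> A * (rate n)\<^sup>2" if "i < n" for i
      proof -
        have le: "(\<integral>\<^sup>+\<omega>. ennreal (Z i \<omega>) \<partial>M) \<le> ennreal (A * (rate n)\<^sup>2)"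
          using elim(1) that t unfolding Z_def by (auto simp: if_distrib[of ennreal] cong: if_cong)
        show I: "integrable M (Z i)"
          by (rule integrableI_bounded[OF Zm[OF that]])
            (use le in \<open>auto simp: Z_def[abs_def] if_distrib[of norm] abs_of_nonneg cong: if_cong intro: le_less_trans\<close>)
        have "ennreal (\<integral>\<omega>. Z i \<omega> \<partial>M) = (\<integral>\<^sup>+\<omega>. ennreal (Z i \<omega>) \<partial>M)"
          by (rule nn_integral_eq_integral[symmetric, OF I]) (auto simp: Z_def)
        with le have "ennreal (\<integral>\<omega>. Z i \<omega> \<partial>M) \<le> ennreal (A * (rate n)\<^sup>2)" by simp
        then show "(\<integral>\<omega>. Z i \<omega> \<partial>M) \<le> A * (rate n)\<^sup>2" using A by (subst (asm) ennreal_le_iff) auto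
      qed
      define U where "U \<omega> = (\<Sum>i<n. Z i \<omega>) / real n" for \<omega>
      have Ui: "integrable M U" unfolding U_def[abs_def]
        by (intro integrable_divide Bochner_Integration.integrable_sum Zi) simp
      have "(\<integral>\<omega>. U \<omega> \<partial>M) = (\<Sum>i<n. \<integral>\<omega>. Z i \<omega> \<partial>M) / real n"
        unfolding U_def by (simp add: Bochner_Integration.integral_sum Zi)
      also have "\<dots> \<le> (\<Sum>i<n. A * (rate n)\<^sup>2) / real n" by (intro divide_right_mono sum_mono Zi) auto
      also have "\<dots> = A * (rate n)\<^sup>2" using n by simp
      finally have EU: "(\<integral>\<omega>. U \<omega> \<partial>M) \<le> A * (rate n)\<^sup>2" .
      have U0: "0 \<le> U \<omega>" for \<omega> unfolding U_def Z_def by (intro divide_nonneg_nonneg sum_nonneg) auto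
      let ?b = "(B * rate n)\<^sup>2"
      have b: "0 < ?b" using B rate_pos[OF n] by simp
      have "prob {\<omega>\<in>space M. U \<omega> \<ge> ?b} \<le> (\<integral>\<omega>. U \<omega> \<partial>M) / ?b"
        by (rule integral_Markov_inequality_measure[OF Ui sets.top _ b]) (use U0 in simp)
      also have "\<dots> \<le> A * (rate n)\<^sup>2 / ?b" using EU b by (intro divide_right_mono) auto
      also have "\<dots> = A / B\<^sup>2" using rate_pos[OF n] by (simp add: power_mult_distrib)
      also have "\<dots> < \<epsilon> / 2"
        unfolding B(2) using A \<epsilon> by (simp add: field_simps)
      finally have pU: "prob {\<omega>\<in>space M. U \<omega> \<ge> ?b} < \<epsilon> / 2" .
      have bs: "{\<omega>\<in>space M. \<not> good n i t \<omega>} \<in> sets M" if "i < n" for i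
      proof -
        have "{\<omega>\<in>space M. \<not> good n i t \<omega>} = space M - {\<omega>\<in>space M. good n i t \<omega>}" by auto
        then show ?thesis using good_meas[OF that] by simp
      qed
      have Us: "{\<omega>\<in>space M. U \<omega> \<ge> ?b} \<in> sets M" using Ui by measurable
      have "{\<omega>\<in>space M. mean_sq_err n t \<omega> > ?b} \<subseteq> (\<Union>i<n. {\<omega>\<in>space M. \<not> good n i t \<omega>}) \<union> {\<omega>\<in>space M. U \<omega> \<ge> ?b}"
      proof
        fix \<omega> assume \<omega>: "\<omega> \<in> {\<omega>\<in>space M. mean_sq_err n t \<omega> > ?b}"
        show "\<omega> \<in> (\<Union>i<n. {\<omega>\<in>space M. \<not> good n i t \<omega>}) \<union> {\<omega>\<in>space M. U \<omega> \<ge> ?b}"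
        proof (cases "\<forall>i<n. good n i t \<omega>")
          case True
          then have "U \<omega> = mean_sq_err n t \<omega>" by (simp add: U_def Z_def mean_sq_err_def)
          then show ?thesis using \<omega> by simp
        qed (use \<omega> in auto)
      qed
      then have "prob {\<omega>\<in>space M. mean_sq_err n t \<omega> > ?b} \<le> prob ((\<Union>i<n. {\<omega>\<in>space M. \<not> good n i t \<omega>}) \<union> {\<omega>\<in>space M. U \<omega> \<ge> ?b})"
        using bs Us by (intro finite_measure_mono) auto
      also have "\<dots> \<le> prob (\<Union>i<n. {\<omega>\<in>space M. \<not> good n i t \<omega>}) + prob {\<omega>\<in>space M. U \<omega> \<ge> ?b}"
        using bs Us by (intro measure_Un_le) auto
      also have "prob (\<Union>i<n. {\<omega>\<in>space M. \<not> good n i t \<omega>}) \<le> (\<Sum>i<n. prob {\<omega>\<in>space M. \<not> good n i t \<omega>})"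
        using bs by (intro finite_measure_subadditive_finite) auto
      also have "\<dots> \<le> bd n" using elim(2) by blast
      finally show "prob {\<omega>\<in>space M. mean_sq_err n t \<omega> > ?b} < \<epsilon>" using elim(3) pU by linarith
    qed
  qed
  then show ?thesis using B(1) by (auto simp: eventually_sequentially intro!: exI[of _ B])
qed

lemma mean_sq_effect_bound:
  assumes \<epsilon>: "0 < \<epsilon>"
  shows "\<exists>B\<ge>0. \<forall>n>0. \<forall>t\<in>S. prob {\<omega>\<in>space M. mean_sq_effect n t \<omega> > B\<^sup>2} < \<epsilon>"
proof -
  define B where "B = sqrt ((Cv + 1) / \<epsilon>)"
  have B: "0 < B" "B\<^sup>2 = (Cv + 1) / \<epsilon>" unfolding B_def using Cv(2) \<epsilon> by simp_all
  have "prob {\<omega>\<in>space M. mean_sq_effect n t \<omega> > B\<^sup>2} < \<epsilon>" if n: "0 < n" and t: "t \<in> S" for n t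
  proof -
    have v2: "has_bochner_integral M (\<lambda>\<omega>. (indiv i t \<omega> - \<eta> t)\<^sup>2) (\<gamma> t t)" for i
      using v_cov[OF S_interval[OF t] S_interval[OF t], of i] by (simp add: indiv_def power2_eq_square)
    have "has_bochner_integral M (mean_sq_effect n t) ((\<Sum>i<n. \<gamma> t t) / real n)"
      unfolding mean_sq_effect_def[abs_def] by (intro has_bochner_integral_divide has_bochner_integral_sum v2)
    then have E: "has_bochner_integral M (mean_sq_effect n t) (\<gamma> t t)" using n by simp
    have b: "0 < B\<^sup>2" using B(1) by (rule zero_less_power)
    have "prob {\<omega>\<in>space M. mean_sq_effect n t \<omega> > B\<^sup>2} \<le> prob {\<omega>\<in>space M. mean_sq_effect n t \<omega> \<ge> B\<^sup>2}"
      using mean_sq_effect_meas[OF t, of n] by (intro finite_measure_mono) auto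
    also have "\<dots> \<le> (\<integral>\<omega>. mean_sq_effect n t \<omega> \<partial>M) / B\<^sup>2"
    proof (rule integral_Markov_inequality_measure[OF _ sets.top _ b])
      show "integrable M (mean_sq_effect n t)" using E by (simp add: has_bochner_integral_iff)
      show "AE x in M. 0 \<le> mean_sq_effect n t x"
        by (auto simp: mean_sq_effect_def intro!: divide_nonneg_nonneg sum_nonneg)
    qed
    also have "\<dots> = \<gamma> t t / B\<^sup>2" using E by (simp add: has_bochner_integral_iff)
    also have "\<dots> \<le> Cv / B\<^sup>2" using Cv(1)[of t] t S_sub b by (intro divide_right_mono) auto
    also have "\<dots> < \<epsilon>" unfolding B(2) using Cv(2) \<epsilon> by (simp add: field_simps)
    finally show ?thesis .
  qed
  then show ?thesis using B(1) by (intro exI[of _ B]) auto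
qed

lemma O_UP_mean:
  "O_UP M S (\<lambda>n t \<omega>. (sample_mean n (recon n) t \<omega> - sample_mean n indiv t \<omega>) / rate n)"
  unfolding O_UP_def
proof (intro allI impI)
  fix \<epsilon> :: real assume "0 < \<epsilon>"
  then obtain B N where B: "0 \<le> B" and N: "\<And>n t. n \<ge> N \<Longrightarrow> t \<in> S \<Longrightarrow> prob {\<omega>\<in>space M. mean_sq_err n t \<omega> > (B * rate n)\<^sup>2} < \<epsilon>"
    using mean_sq_err_bound by metis
  have "prob {\<omega>\<in>space M. \<bar>(sample_mean n (recon n) t \<omega> - sample_mean n indiv t \<omega>) / rate n\<bar> > B} < \<epsilon>"
    if n: "n \<ge> max N 1" and t: "t \<in> S" for n t
  proof -
    have np: "0 < n" using n by simp
    have "{\<omega>\<in>space M. \<bar>(sample_mean n (recon n) t \<omega> - sample_mean n indiv t \<omega>) / rate n\<bar> > B} \<subseteq>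
        {\<omega>\<in>space M. mean_sq_err n t \<omega> > (B * rate n)\<^sup>2}"
    proof (safe, rule ccontr)
      fix \<omega> assume gt: "\<bar>(sample_mean n (recon n) t \<omega> - sample_mean n indiv t \<omega>) / rate n\<bar> > B"
        and "\<not> (B * rate n)\<^sup>2 < mean_sq_err n t \<omega>"
      then have "(\<Sum>i<n. (recon n i t \<omega> - indiv i t \<omega>)\<^sup>2) / real n \<le> (B * rate n)\<^sup>2"
        by (simp add: mean_sq_err_def)
      from abs_mean_le[OF this] have "\<bar>sample_mean n (recon n) t \<omega> - sample_mean n indiv t \<omega>\<bar> \<le> B * rate n"
        using B rate_pos[OF np] by (simp add: sample_mean_def sum_subtractf diff_divide_distrib)
      then have "\<bar>(sample_mean n (recon n) t \<omega> - sample_mean n indiv t \<omega>) / rate n\<bar> \<le> B"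
        using rate_pos[OF np] by (simp add: abs_divide pos_divide_le_eq)
      then show False using gt by linarith
    qed
    then have "prob {\<omega>\<in>space M. \<bar>(sample_mean n (recon n) t \<omega> - sample_mean n indiv t \<omega>) / rate n\<bar> > B} \<le>
        prob {\<omega>\<in>space M. mean_sq_err n t \<omega> > (B * rate n)\<^sup>2}"
      using mean_sq_err_meas[OF t, of n] by (intro finite_measure_mono) auto
    then show ?thesis using N[of n t] n t by simp
  qed
  then show "\<exists>B N. \<forall>n\<ge>N. \<forall>t\<in>S. prob {\<omega>\<in>space M. \<bar>(sample_mean n (recon n) t \<omega> - sample_mean n indiv t \<omega>) / rate n\<bar> > B} < \<epsilon>"
    by blast
qed

lemma O_UP_cov:
  "O_UP M (S \<times> S) (\<lambda>n (s, t) \<omega>. (sample_cov n (recon n) s t \<omega> - sample_cov n indiv s t \<omega>) / rate n)"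
  unfolding O_UP_def
proof (intro allI impI)
  fix \<epsilon> :: real assume \<epsilon>: "0 < \<epsilon>"
  obtain B N where B: "0 \<le> B" and N: "\<And>n t. n \<ge> N \<Longrightarrow> t \<in> S \<Longrightarrow> prob {\<omega>\<in>space M. mean_sq_err n t \<omega> > (B * rate n)\<^sup>2} < \<epsilon> / 4"
    using mean_sq_err_bound[of "\<epsilon> / 4"] \<epsilon> by auto
  obtain V where V: "0 \<le> V" and VN: "\<And>n t. 0 < n \<Longrightarrow> t \<in> S \<Longrightarrow> prob {\<omega>\<in>space M. mean_sq_effect n t \<omega> > V\<^sup>2} < \<epsilon> / 4"
    using mean_sq_effect_bound[of "\<epsilon> / 4"] \<epsilon> by auto
  define L where "L = 2 * (2 * (V * B) + B * B)"
  have "prob {\<omega>\<in>space M. \<bar>(sample_cov n (recon n) s t \<omega> - sample_cov n indiv s t \<omega>) / rate n\<bar> > L} < \<epsilon>"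
    if n: "n \<ge> max N 2" and s: "s \<in> S" and t: "t \<in> S" for n s t
  proof -
    have np: "0 < n" "2 \<le> n" using n by auto
    define E where "E r = {\<omega>\<in>space M. mean_sq_err n r \<omega> > (B * rate n)\<^sup>2}" for r
    define W where "W r = {\<omega>\<in>space M. mean_sq_effect n r \<omega> > V\<^sup>2}" for r
    have Em: "E r \<in> sets M" "W r \<in> sets M" if "r \<in> S" for r
      unfolding E_def W_def using mean_sq_err_meas[OF that, of n] mean_sq_effect_meas[OF that, of n] by auto
    have Ep: "prob (E r) < \<epsilon> / 4" "prob (W r) < \<epsilon> / 4" if "r \<in> S" for r
      unfolding E_def W_def using N[of n r] VN[of n r] n that by auto
    have sub: "{\<omega>\<in>space M. \<bar>(sample_cov n (recon n) s t \<omega> - sample_cov n indiv s t \<omega>) / rate n\<bar> > L} \<subseteq>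
        (E s \<union> E t) \<union> (W s \<union> W t)"
    proof (rule subsetI, rule ccontr)
      fix \<omega> assume \<omega>: "\<omega> \<in> {\<omega>\<in>space M. \<bar>(sample_cov n (recon n) s t \<omega> - sample_cov n indiv s t \<omega>) / rate n\<bar> > L}"
        and "\<omega> \<notin> (E s \<union> E t) \<union> (W s \<union> W t)"
      then have le: "mean_sq_err n s \<omega> \<le> (B * rate n)\<^sup>2" "mean_sq_err n t \<omega> \<le> (B * rate n)\<^sup>2"
        "mean_sq_effect n s \<omega> \<le> V\<^sup>2" "mean_sq_effect n t \<omega> \<le> V\<^sup>2"
        by (auto simp: E_def W_def not_less)
      have r: "0 < rate n" "rate n \<le> 1" using rate_pos rate_le_1 np by auto
      have "\<bar>sample_cov n (recon n) s t \<omega> - sample_cov n indiv s t \<omega>\<bar> \<le> 2 * (2 * (V * (B * rate n)) + (B * rate n) * (B * rate n))"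
        by (rule sample_cov_perturbation[OF np(2) V, where k="\<eta> s" and l="\<eta> t"])
          (use le B r in \<open>simp_all add: mean_sq_err_def mean_sq_effect_def\<close>)
      also have "\<dots> \<le> L * rate n"
      proof -
        have "B * rate n * (B * rate n) \<le> B * B * rate n"
        proof -
          have "(B * B * rate n) * rate n \<le> (B * B * rate n) * 1"
            using B r by (intro mult_left_mono) auto
          then show ?thesis by (simp add: mult_ac)
        qed
        then show ?thesis unfolding L_def by (simp add: algebra_simps)
      qed
      finally have "\<bar>(sample_cov n (recon n) s t \<omega> - sample_cov n indiv s t \<omega>) / rate n\<bar> \<le> L"
        using r by (simp add: abs_divide pos_divide_le_eq)
      then show False using \<omega> by simp
    qed
    have "prob {\<omega>\<in>space M. \<bar>(sample_cov n (recon n) s t \<omega> - sample_cov n indiv s t \<omega>) / rate n\<bar> > L} \<le>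
        prob ((E s \<union> E t) \<union> (W s \<union> W t))"
      using sub Em s t by (intro finite_measure_mono) auto
    also have "\<dots> \<le> (prob (E s) + prob (E t)) + (prob (W s) + prob (W t))"
      using Em s t by (intro order_trans[OF measure_Un_le] add_mono measure_Un_le) auto
    also have "\<dots> < \<epsilon>" using Ep[OF s] Ep[OF t] by linarith
    finally show ?thesis .
  qed
  then show "\<exists>B N. \<forall>n\<ge>N. \<forall>x\<in>S \<times> S. prob {\<omega>\<in>space M.
      \<bar>(case x of (s, t) \<Rightarrow> \<lambda>\<omega>. (sample_cov n (recon n) s t \<omega> - sample_cov n indiv s t \<omega>) / rate n) \<omega>\<bar> > B} < \<epsilon>"
    by (intro exI[of _ L] exI[of _ "max N 2"]) auto
qed

end

lemma divide_sqrt_eq: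
  assumes "0 < (x::real)"
  shows "y / sqrt x = sqrt x * (y / x)"
proof -
  have "y / sqrt x = (sqrt x * y) / (sqrt x * sqrt x)"
    by (rule mult_divide_mult_cancel_left[symmetric]) (use assms in simp)
  also have "sqrt x * sqrt x = x" using assms by simp
  finally show ?thesis by simp
qed

section \<open>Uniformity up to the boundary or on compact sets\<close>

lemma bounded_continuous_Icc:
  fixes f :: "real \<Rightarrow> real"
  assumes "continuous_on {a<..<b} f" "a < l" "u < b"
  shows "bounded (f ` {l<..<u})"
proof -
  have "compact (f ` {l..u})"
    by (intro compact_continuous_image continuous_on_subset[OF assms(1)]) (use assms in auto)
  then have "bounded (f ` {l..u})" by (rule compact_imp_bounded)
  then show ?thesis by (rule bounded_subset) auto
qed

context lpk_model
begin

lemma O_UP_on_region: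
  assumes S: "S \<subseteq> {l<..<u}" "a \<le> l" "u \<le> b" "0 < h0"
    and near: "\<And>t x. t \<in> S \<Longrightarrow> x \<in> {a<..<b} \<Longrightarrow> \<bar>x - t\<bar> \<le> h0 \<Longrightarrow> x \<in> {l<..<u}"
    and side: "\<And>t. t \<in> S \<Longrightarrow> {t<..t + h0} \<subseteq> {l<..<u} \<or> {t - h0..<t} \<subseteq> {l<..<u}"
    and c: "0 < c" "\<And>x. x \<in> {l<..<u} \<Longrightarrow> c \<le> \<pi> x"
    and D: "has_derivs_upto (p + 1) {a<..<b} \<eta> D" and bD: "bounded (D (p + 1) ` {l<..<u})"
    and G: "has_mixed_derivs_upto (p + 1) {a<..<b} \<gamma> G"
    and bG: "bounded ((\<lambda>(s, t). G (p + 1) (p + 1) s t) ` ({l<..<u} \<times> {l<..<u}))"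
    and bv: "bounded ((\<lambda>x. G 0 0 x x) ` {l<..<u})" and b\<sigma>: "bounded ((\<lambda>x. (\<sigma> x)\<^sup>2) ` {l<..<u})"
  shows "O_UP M S (\<lambda>n t \<omega>. (sample_mean n (recon n) t \<omega> - sample_mean n indiv t \<omega>) / rate n) \<and>
    O_UP M (S \<times> S) (\<lambda>n (s, t) \<omega>. (sample_cov n (recon n) s t \<omega> - sample_cov n indiv s t \<omega>) / rate n)"
proof -
  have sub: "x \<in> {a<..<b}" if "x \<in> {l<..<u}" for x using that S by auto
  obtain C\<eta> where C\<eta>: "\<And>x. x \<in> {l<..<u} \<Longrightarrow> \<bar>D (p + 1) x\<bar> \<le> C\<eta>"
    using bD unfolding bounded_iff by (metis imageI real_norm_def)
  obtain C\<gamma> where "\<forall>z\<in>(\<lambda>(s, t). G (p + 1) (p + 1) s t) ` ({l<..<u} \<times> {l<..<u}). norm z \<le> C\<gamma>"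
    using bG unfolding bounded_iff by blast
  then have C\<gamma>: "\<bar>G (p + 1) (p + 1) x y\<bar> \<le> C\<gamma>" if "x \<in> {l<..<u}" "y \<in> {l<..<u}" for x y using that by force
  obtain Cv where Cv: "\<And>x. x \<in> {l<..<u} \<Longrightarrow> \<bar>G 0 0 x x\<bar> \<le> Cv"
    using bv unfolding bounded_iff by (metis (no_types, lifting) imageI real_norm_def)
  obtain C\<sigma> where C\<sigma>: "\<And>x. x \<in> {l<..<u} \<Longrightarrow> \<bar>(\<sigma> x)\<^sup>2\<bar> \<le> C\<sigma>"
    using b\<sigma> unfolding bounded_iff by (metis (no_types, lifting) imageI real_norm_def)
  interpret R: lpk_region M a b C \<delta> p v e \<eta> \<sigma> \<pi> K \<gamma> m T h S l u h0 c C\<eta> C\<gamma> "max 0 C\<sigma>" "max 0 Cv" D G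
  proof unfold_locales
    fix x assume x: "x \<in> {l<..<u}"
    note x' = sub[OF x]
    show "D 0 x = \<eta> x" using D x' unfolding has_derivs_upto_def by blast
    show "\<And>j. j < p + 1 \<Longrightarrow> (D j has_real_derivative D (Suc j) x) (at x)"
      using D x' unfolding has_derivs_upto_def by blast
    show "(\<sigma> x)\<^sup>2 \<le> max 0 C\<sigma>" using C\<sigma>[OF x] by simp
    have "\<gamma> x x = G 0 0 x x" using G x' unfolding has_mixed_derivs_upto_def by simp
    then show "\<gamma> x x \<le> max 0 Cv" using Cv[OF x] by simp
    fix y assume y: "y \<in> {l<..<u}"
    note y' = sub[OF y]
    show "G 0 0 x y = \<gamma> x y" using G x' y' unfolding has_mixed_derivs_upto_def by blast
    show "\<And>j. j < p + 1 \<Longrightarrow> ((\<lambda>x. G j 0 x y) has_real_derivative G (Suc j) 0 x y) (at x)"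
      using G x' y' unfolding has_mixed_derivs_upto_def by blast
    show "\<And>k. k < p + 1 \<Longrightarrow> (G (p + 1) k x has_real_derivative G (p + 1) (Suc k) x y) (at y)"
      using G x' y' unfolding has_mixed_derivs_upto_def by blast
  qed (use S near side c C\<eta> C\<gamma> in auto)
  show ?thesis using R.O_UP_mean R.O_UP_cov by blast
qed

text \<open>Interior smoothness gives uniform bounds on any compact subinterval. The interval \<open>(l, u)\<close> reaches half way
  from the extreme points of \<open>S\<close> to the end points, and \<open>h0\<close> keeps windows inside it.\<close>

lemma O_UP_compact:
  assumes S: "compact S" "S \<subseteq> {a<..<b}"
    and D: "has_derivs_upto (p + 1) {a<..<b} \<eta> D" and G: "has_mixed_derivs_upto (p + 1) {a<..<b} \<gamma> G"
    and \<sigma>: "continuous_on {a<..<b} (\<lambda>t. (\<sigma> t)\<^sup>2)"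
  shows "O_UP M S (\<lambda>n t \<omega>. (sample_mean n (recon n) t \<omega> - sample_mean n indiv t \<omega>) / rate n) \<and>
    O_UP M (S \<times> S) (\<lambda>n (s, t) \<omega>. (sample_cov n (recon n) s t \<omega> - sample_cov n indiv s t \<omega>) / rate n)"
proof (cases "S = {}")
  case True
  then show ?thesis by (simp add: O_UP_def)
next
  case False
  obtain s1 where s1: "s1 \<in> S" "\<And>t. t \<in> S \<Longrightarrow> s1 \<le> t" using compact_attains_inf[OF S(1) False] by blast
  obtain s2 where s2: "s2 \<in> S" "\<And>t. t \<in> S \<Longrightarrow> t \<le> s2" using compact_attains_sup[OF S(1) False] by blast
  have as: "a < s1" "s2 < b" "s1 \<le> s2" using s1 s2 S(2) by auto
  define l u h0 where "l = (a + s1) / 2" and "u = (b + s2) / 2" and "h0 = min (s1 - l) (u - s2) / 2"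
  have lu: "a < l" "l < s1" "s2 < u" "u < b" using as by (auto simp: l_def u_def)
  have h0: "0 < h0" "h0 < s1 - l" "h0 < u - s2" using lu by (auto simp: h0_def min_def)
  have sub: "{l..u} \<subseteq> {a<..<b}" using lu by auto
  have cont\<pi>: "continuous_on {l..u} \<pi>"
  proof (rule continuous_at_imp_continuous_on, rule ballI)
    fix x assume "x \<in> {l..u}"
    then have "x \<in> {a<..<b}" using sub by blast
    then show "isCont \<pi> x" using density unfolding design_density_def by (meson DERIV_isCont)
  qed
  have "{l..u} \<noteq> {}" using lu as by auto
  then obtain x0 where x0: "x0 \<in> {l..u}" "\<And>x. x \<in> {l..u} \<Longrightarrow> \<pi> x0 \<le> \<pi> x"
    using continuous_attains_inf[OF compact_Icc _ cont\<pi>] by blast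
  have \<pi>0: "0 < \<pi> x0" using density x0(1) sub unfolding design_density_def by blast
  show ?thesis
  proof (rule O_UP_on_region[OF _ _ _ h0(1) _ _ \<pi>0 _ D _ G])
    show "S \<subseteq> {l<..<u}" using s1(2) s2(2) lu by fastforce
    show "a \<le> l" "u \<le> b" using lu by auto
    show "x \<in> {l<..<u}" if "t \<in> S" "\<bar>x - t\<bar> \<le> h0" for t x
      using s1(2)[OF that(1)] s2(2)[OF that(1)] that(2) h0 by (auto simp: abs_le_iff)
    show "{t<..t + h0} \<subseteq> {l<..<u} \<or> {t - h0..<t} \<subseteq> {l<..<u}" if "t \<in> S" for t
      using s1(2)[OF that] s2(2)[OF that] h0 lu by auto
    show "\<pi> x0 \<le> \<pi> x" if "x \<in> {l<..<u}" for x using x0(2) that by auto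
    show "bounded (D (p + 1) ` {l<..<u})"
      by (rule bounded_continuous_Icc[OF _ lu(1,4)]) (use D in \<open>simp add: has_derivs_upto_def\<close>)
    show "bounded ((\<lambda>x. (\<sigma> x)\<^sup>2) ` {l<..<u})" by (rule bounded_continuous_Icc[OF \<sigma> lu(1,4)])
    have contG: "continuous_on ({a<..<b} \<times> {a<..<b}) (\<lambda>(s, t). G j k s t)" if "j \<le> p + 1" "k \<le> p + 1" for j k
      using G that unfolding has_mixed_derivs_upto_def by blast
    have "compact ((\<lambda>(s, t). G (p + 1) (p + 1) s t) ` ({l..u} \<times> {l..u}))"
      by (intro compact_continuous_image continuous_on_subset[OF contG] compact_Times) (use sub in auto)
    then show "bounded ((\<lambda>(s, t). G (p + 1) (p + 1) s t) ` ({l<..<u} \<times> {l<..<u}))"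
      by (rule bounded_subset[OF compact_imp_bounded]) auto
    have "continuous_on {a<..<b} (\<lambda>x. (\<lambda>(s, t). G 0 0 s t) (x, x))"
      by (rule continuous_on_compose2[OF contG[of 0 0]]) (auto intro!: continuous_on_Pair continuous_on_id)
    then show "bounded ((\<lambda>x. G 0 0 x x) ` {l<..<u})"
      by (intro bounded_continuous_Icc[OF _ lu(1,4)]) simp
  qed
qed

text \<open>With half windows of a quarter of the length of the interval, a point in the left half has its right half
  window inside, and vice versa.\<close>

lemma O_UP_regular:
  assumes S: "S \<subseteq> {a<..<b}" and reg: "regular_at_boundary (p + 1) a b \<pi> \<eta> \<gamma> \<sigma>"
  shows "O_UP M S (\<lambda>n t \<omega>. (sample_mean n (recon n) t \<omega> - sample_mean n indiv t \<omega>) / rate n) \<and>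
    O_UP M (S \<times> S) (\<lambda>n (s, t) \<omega>. (sample_cov n (recon n) s t \<omega> - sample_cov n indiv s t \<omega>) / rate n)"
proof -
  obtain c where c: "0 < c" "\<And>x. x \<in> {a<..<b} \<Longrightarrow> c \<le> \<pi> x"
    using reg unfolding regular_at_boundary_def by blast
  obtain D where D: "has_derivs_upto (p + 1) {a<..<b} \<eta> D" "\<And>j. j \<le> p + 1 \<Longrightarrow> bounded (D j ` {a<..<b})"
    using reg unfolding regular_at_boundary_def by blast
  obtain G where G: "has_mixed_derivs_upto (p + 1) {a<..<b} \<gamma> G"
    "\<And>j k. j \<le> p + 1 \<Longrightarrow> k \<le> p + 1 \<Longrightarrow> bounded ((\<lambda>(s, t). G j k s t) ` ({a<..<b} \<times> {a<..<b}))"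
    using reg unfolding regular_at_boundary_def by blast
  show ?thesis
  proof (rule O_UP_on_region[where ?h0.0="(b - a) / 4", OF S order_refl order_refl _ _ _ c D(1) _ G(1)])
    show "0 < (b - a) / 4" using ab by simp
    show "{t<..t + (b - a) / 4} \<subseteq> {a<..<b} \<or> {t - (b - a) / 4..<t} \<subseteq> {a<..<b}" if "t \<in> S" for t
    proof (cases "t \<le> (a + b) / 2")
      case True
      then have "t + (b - a) / 4 < b" using ab by (simp add: field_simps)
      moreover have "a < t" using that S by auto
      ultimately have "{t<..t + (b - a) / 4} \<subseteq> {a<..<b}" by auto
      then show ?thesis ..
    next
      case False
      then have "a < t - (b - a) / 4" using ab by (simp add: field_simps)
      moreover have "t < b" using that S by auto
      ultimately have "{t - (b - a) / 4..<t} \<subseteq> {a<..<b}" by auto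
      then show ?thesis ..
    qed
    show "bounded (D (p + 1) ` {a<..<b})" by (rule D(2)) simp
    show "bounded ((\<lambda>(s, t). G (p + 1) (p + 1) s t) ` ({a<..<b} \<times> {a<..<b}))" by (rule G(2)) simp_all
    show "bounded ((\<lambda>x. G 0 0 x x) ` {a<..<b})"
      by (rule bounded_subset[OF G(2)[of 0 0]]) force+
    have "bounded (\<sigma> ` {a<..<b})" using reg unfolding regular_at_boundary_def by (elim conjE)
    then obtain B where "\<forall>z\<in>\<sigma> ` {a<..<b}. norm z \<le> B"
      unfolding bounded_iff by (elim exE)
    then have B: "\<bar>\<sigma> x\<bar> \<le> B" if "x \<in> {a<..<b}" for x using that by auto
    have "norm ((\<sigma> x)\<^sup>2) \<le> B\<^sup>2" if "x \<in> {a<..<b}" for x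
      using power_mono[OF B[OF that], of 2] by simp
    then show "bounded ((\<lambda>x. (\<sigma> x)\<^sup>2) ` {a<..<b})" unfolding bounded_iff by blast
  qed
qed

section \<open>Asymptotic normality\<close>

lemma O_UP_vanishing:
  assumes O: "O_UP M {x} X" and Xm: "\<And>n. X n x \<in> borel_measurable M" and r: "r \<longlonglongrightarrow> 0" and \<epsilon>: "0 < \<epsilon>"
  shows "(\<lambda>n. prob {\<omega>\<in>space M. \<bar>r n * X n x \<omega>\<bar> > \<epsilon>}) \<longlonglongrightarrow> 0"
proof (rule LIMSEQ_I)
  fix d :: real assume "0 < d"
  then have "\<exists>B N. \<forall>n\<ge>N. \<forall>x\<in>{x}. prob {\<omega>\<in>space M. \<bar>X n x \<omega>\<bar> > B} < d"
    using O unfolding O_UP_def by blast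
  then obtain B N where N: "prob {\<omega>\<in>space M. \<bar>X n x \<omega>\<bar> > B} < d" if "n \<ge> N" for n by blast
  have "(\<lambda>n. r n * max 0 B) \<longlonglongrightarrow> 0 * max 0 B" by (intro tendsto_mult r tendsto_const)
  then have "(\<lambda>n. \<bar>r n\<bar> * max 0 B) \<longlonglongrightarrow> 0" using tendsto_rabs by (fastforce simp: abs_mult)
  then have "\<forall>\<^sub>F n in sequentially. \<bar>r n\<bar> * max 0 B < \<epsilon>" by (rule order_tendstoD(2)) (rule \<epsilon>)
  then obtain N' where N': "\<And>n. n \<ge> N' \<Longrightarrow> \<bar>r n\<bar> * max 0 B < \<epsilon>" by (auto simp: eventually_sequentially)
  have "norm (prob {\<omega>\<in>space M. \<bar>r n * X n x \<omega>\<bar> > \<epsilon>} - 0) < d" if n: "n \<ge> max N N'" for n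
  proof -
    have "{\<omega>\<in>space M. \<bar>r n * X n x \<omega>\<bar> > \<epsilon>} \<subseteq> {\<omega>\<in>space M. \<bar>X n x \<omega>\<bar> > B}"
    proof (safe, rule ccontr)
      fix \<omega> assume "\<bar>r n * X n x \<omega>\<bar> > \<epsilon>" "\<not> B < \<bar>X n x \<omega>\<bar>"
      moreover have "\<bar>r n\<bar> * \<bar>X n x \<omega>\<bar> \<le> \<bar>r n\<bar> * max 0 B" using calculation by (intro mult_left_mono) auto
      ultimately show False using N'[of n] n by (simp add: abs_mult)
    qed
    then have "prob {\<omega>\<in>space M. \<bar>r n * X n x \<omega>\<bar> > \<epsilon>} \<le> prob {\<omega>\<in>space M. \<bar>X n x \<omega>\<bar> > B}"
      using Xm[of n] by (intro finite_measure_mono) auto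
    then show ?thesis using N[of n] n by simp
  qed
  then show "\<exists>no. \<forall>n\<ge>no. norm (prob {\<omega>\<in>space M. \<bar>r n * X n x \<omega>\<bar> > \<epsilon>} - 0) < d" by blast
qed

text \<open>The condition on \<open>\<delta>\<close> says exactly that the rate exponent \<open>(p + 1) \<delta> / (2 p + 3)\<close> exceeds \<open>1/2\<close>.\<close>

lemma sqrt_rate:
  assumes "\<delta> > 1 + 1 / (2 * (real p + 1))"
  shows "(\<lambda>n. sqrt (real n) * rate n) \<longlonglongrightarrow> 0"
proof -
  define x where "x = (real p + 1) * \<delta> / (2 * real p + 3) - 1 / 2"
  have p: "0 < real p + 1" "0 < 2 * real p + 3" by auto
  have e1: "(1 + 1 / (2 * (real p + 1))) * (real p + 1) < \<delta> * (real p + 1)"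
    using assms p(1) by (rule mult_strict_right_mono)
  have e2: "(1 + 1 / (2 * (real p + 1))) * (real p + 1) = (2 * real p + 3) / 2"
    using p by (simp add: field_simps)
  have "(2 * real p + 3) / 2 < (real p + 1) * \<delta>" using e1[unfolded e2] by (simp only: mult.commute)
  then have x: "0 < x" unfolding x_def using p by (simp add: field_simps)
  have lim: "(\<lambda>n::nat. real n powr (- x)) \<longlonglongrightarrow> 0" using x by real_asymp
  have eq: "real n powr (- x) = sqrt (real n) * rate n" if "0 < n" for n
  proof -
    have "sqrt (real n) = real n powr (1 / 2)" using that by (simp add: powr_half_sqrt)
    then show ?thesis by (simp add: rate_def powr_add[symmetric] x_def)
  qed
  have "\<forall>\<^sub>F n in sequentially. real n powr (- x) = sqrt (real n) * rate n"
    using eventually_gt_at_top[of 0] by eventually_elim (rule eq)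
  with lim show ?thesis by (rule Lim_transform_eventually)
qed

lemma mean_meas: "t \<in> {a..b} \<Longrightarrow> sample_mean n (recon n) t \<in> borel_measurable M"
  "t \<in> {a..b} \<Longrightarrow> sample_mean n indiv t \<in> borel_measurable M"
  unfolding sample_mean_def[abs_def]
  by (intro borel_measurable_divide borel_measurable_sum borel_measurable_const recon_meas indiv_meas; simp)+

lemma cov_meas: "s \<in> {a..b} \<Longrightarrow> t \<in> {a..b} \<Longrightarrow> sample_cov n (recon n) s t \<in> borel_measurable M"
  "s \<in> {a..b} \<Longrightarrow> t \<in> {a..b} \<Longrightarrow> sample_cov n indiv s t \<in> borel_measurable M"
  unfolding sample_cov_def[abs_def]
  by (intro borel_measurable_divide borel_measurable_sum borel_measurable_times borel_measurable_diff
      borel_measurable_const recon_meas indiv_meas mean_meas; simp)+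

lemma AGP_mean:
  assumes \<delta>: "\<delta> > 1 + 1 / (2 * (real p + 1))"
    and O: "\<And>t. t \<in> {a<..<b} \<Longrightarrow>
      O_UP M {t} (\<lambda>n t \<omega>. (sample_mean n (recon n) t \<omega> - sample_mean n indiv t \<omega>) / rate n)"
  shows "AGP M {a<..<b} (\<lambda>n t \<omega>. sqrt (real n) * (sample_mean n (recon n) t \<omega> - \<eta> t)) (\<lambda>_. 0) \<gamma>"
proof (rule AGP_iid_approx[where F="\<lambda>t x. x t", OF prob_space_axioms effects_indep path_distr(1)])
  fix s assume s: "s \<in> {a<..<b}"
  then have s': "s \<in> {a..b}" by auto
  show "(\<lambda>x. x s) \<in> borel_measurable (path_space {a..b})" by (rule coord_meas[OF s'])
  show "has_bochner_integral M (\<lambda>\<omega>. sample_path {a..b} (v 0) \<omega> s) 0"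
    using v_mean[OF s'] s' by (simp add: sample_path_apply)
  show "(\<lambda>\<omega>. sqrt (real n) * (sample_mean n (recon n) s \<omega> - \<eta> s)) \<in> borel_measurable M" for n
    by (intro borel_measurable_times borel_measurable_diff borel_measurable_const mean_meas s')
  fix \<epsilon> :: real assume \<epsilon>: "0 < \<epsilon>"
  have eq: "sqrt (real n) * (sample_mean n (recon n) s \<omega> - \<eta> s) - (\<Sum>i<n. sample_path {a..b} (v i) \<omega> s) / sqrt (real n) =
      (sqrt (real n) * rate n) * ((sample_mean n (recon n) s \<omega> - sample_mean n indiv s \<omega>) / rate n)" for n \<omega>
  proof (cases "n = 0")
    case False
    then have n: "0 < real n" by simp
    have "(\<Sum>i<n. v i s \<omega>) / sqrt (real n) = sqrt (real n) * ((\<Sum>i<n. v i s \<omega>) / real n)"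
      by (rule divide_sqrt_eq[OF n])
    also have "(\<Sum>i<n. v i s \<omega>) / real n = sample_mean n indiv s \<omega> - \<eta> s"
      using n by (simp add: sample_mean_def indiv_def sum.distrib add_divide_distrib)
    finally have 1: "(\<Sum>i<n. sample_path {a..b} (v i) \<omega> s) / sqrt (real n) = sqrt (real n) * (sample_mean n indiv s \<omega> - \<eta> s)"
      using s' by (simp only: sample_path_apply)
    have 2: "(sqrt (real n) * rate n) * (d / rate n) = sqrt (real n) * d" for d
      using rate_pos[of n] False by simp
    show ?thesis unfolding 1 2 by (simp only: right_diff_distrib)
  qed simp
  show "(\<lambda>n. prob {\<omega>\<in>space M. \<bar>sqrt (real n) * (sample_mean n (recon n) s \<omega> - \<eta> s) -
      (\<Sum>i<n. sample_path {a..b} (v i) \<omega> s) / sqrt (real n)\<bar> > \<epsilon>}) \<longlonglongrightarrow> 0"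
    unfolding eq
    by (rule O_UP_vanishing[OF O[OF s] _ sqrt_rate[OF \<delta>] \<epsilon>])
      (intro borel_measurable_divide borel_measurable_diff borel_measurable_const mean_meas s')
next
  fix s t assume "s \<in> {a<..<b}" "t \<in> {a<..<b}"
  then have st: "s \<in> {a..b}" "t \<in> {a..b}" by auto
  show "has_bochner_integral M (\<lambda>\<omega>. sample_path {a..b} (v 0) \<omega> s * sample_path {a..b} (v 0) \<omega> t) (\<gamma> s t)"
    using v_cov[OF st, of 0] st by (simp add: sample_path_apply)
qed

lemma v_uncorrelated:
  assumes t: "t \<in> {a..b}" and ij: "i \<noteq> j"
  shows "has_bochner_integral M (\<lambda>\<omega>. v i t \<omega> * v j t \<omega>) 0"
proof -
  have ind: "indep_var borel (v i t) borel (v j t)"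
  proof -
    have "indep_vars (\<lambda>_. path_space {a..b}) (\<lambda>q. sample_path {a..b} (v (case_bool i j q))) UNIV"
      by (rule indep_vars_reindex[where X="\<lambda>i. sample_path {a..b} (v i)"])
        (use ij in \<open>auto simp: inj_on_def split: bool.split intro: indep_vars_subset[OF effects_indep]\<close>)
    from indep_vars_compose2[OF this, of "\<lambda>_ x. x t" "\<lambda>_. borel"] coord_meas[OF t]
    have "indep_vars (\<lambda>_. borel) (\<lambda>q. v (case_bool i j q) t) UNIV" using t by (simp add: sample_path_apply)
    then show ?thesis unfolding indep_var_def
      by (rule indep_vars_cong[THEN iffD1, rotated 3]) (auto split: bool.split)
  qed
  have mean: "has_bochner_integral M (v i t) 0" for i
  proof -
    have "has_bochner_integral M (\<lambda>\<omega>. sample_path {a..b} (v i) \<omega> t) 0"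
      by (rule same_law_integral[where F="\<lambda>x. x t", OF coord_meas[OF t] v_path v_path path_distr(1)])
        (use v_mean[OF t] t in \<open>simp add: sample_path_apply\<close>)
    then show ?thesis using t by (simp add: sample_path_apply)
  qed
  have i: "integrable M (v i t)" "integrable M (v j t)" and z: "expectation (v i t) = 0"
    using mean by (auto simp: has_bochner_integral_iff)
  show ?thesis
    using indep_var_lebesgue_integral[OF ind i] indep_var_integrable[OF ind i] z
    by (simp add: has_bochner_integral_iff)
qed

lemma v_sum_sq:
  assumes t: "t \<in> {a..b}"
  shows "has_bochner_integral M (\<lambda>\<omega>. (\<Sum>i<n. v i t \<omega>)\<^sup>2) (real n * \<gamma> t t)"
proof -
  have "has_bochner_integral M (\<lambda>\<omega>. \<Sum>i<n. \<Sum>j<n. v i t \<omega> * v j t \<omega>) (\<Sum>i<n. \<Sum>j<n. if j = i then \<gamma> t t else 0)"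
  proof (intro has_bochner_integral_sum)
    fix i j
    show "has_bochner_integral M (\<lambda>\<omega>. v i t \<omega> * v j t \<omega>) (if j = i then \<gamma> t t else 0)"
      using v_cov[OF t t, of i] v_uncorrelated[OF t, of i j] by (cases "j = i") auto
  qed
  moreover have "(\<Sum>i<n. \<Sum>j<n. if j = i then \<gamma> t t else 0) = real n * \<gamma> t t" by simp
  moreover have "(\<Sum>i<n. \<Sum>j<n. v i t \<omega> * v j t \<omega>) = (\<Sum>i<n. v i t \<omega>)\<^sup>2" for \<omega>
    by (simp add: power2_eq_square sum_product)
  ultimately show ?thesis by simp
qed

text \<open>Centering by the sample mean and dividing by \<open>n - 1\<close> instead of \<open>n\<close> perturb the normalized sum by
  \<open>\<surd>n / (n - 1)\<close> times a mean of squares; that mean has bounded expectation because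
  \<open>(\<Sum>\<^sub>i v\<^sub>i)\<^sup>2\<close> has expectation of order \<open>n\<close>.\<close>

lemma cov_linearization:
  assumes n: "2 \<le> n"
  shows "\<bar>sqrt (real n) * (sample_cov n indiv s t \<omega> - g) - (\<Sum>i<n. v i s \<omega> * v i t \<omega> - g) / sqrt (real n)\<bar> \<le>
    sqrt (real n) / (real n - 1) * (((\<Sum>i<n. (v i s \<omega>)\<^sup>2) + (\<Sum>i<n. (v i t \<omega>)\<^sup>2)
      + (\<Sum>i<n. v i s \<omega>)\<^sup>2 + (\<Sum>i<n. v i t \<omega>)\<^sup>2) / (2 * real n))"
proof -
  define N where "N = real n"
  have N: "2 \<le> N" using n by (simp add: N_def)
  define A x y where "A = (\<Sum>i<n. v i s \<omega> * v i t \<omega>)" and "x = (\<Sum>i<n. v i s \<omega>)" and "y = (\<Sum>i<n. v i t \<omega>)"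
  have cov: "sample_cov n indiv s t \<omega> = (A - x * y / N) / (N - 1)"
  proof -
    have m: "indiv i r \<omega> - sample_mean n indiv r \<omega> = v i r \<omega> - (\<Sum>j<n. v j r \<omega>) / N" for i r
      using n by (simp add: sample_mean_def indiv_def sum.distrib add_divide_distrib N_def)
    have "(\<Sum>i<n. (v i s \<omega> - x / N) * (v i t \<omega> - y / N)) =
        (\<Sum>i<n. v i s \<omega> * v i t \<omega> - (y / N) * v i s \<omega> - (x / N) * v i t \<omega> + x / N * (y / N))"
      by (intro sum.cong refl) (simp add: algebra_simps)
    also have "\<dots> = A - (y / N) * x - (x / N) * y + N * (x / N * (y / N))"
      unfolding sum.distrib sum_subtractf sum_distrib_left[symmetric] A_def[symmetric] x_def[symmetric] y_def[symmetric]
      by (simp add: N_def)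
    also have "\<dots> = A - x * y / N" using N by (simp add: field_simps)
    finally show ?thesis unfolding sample_cov_def m x_def[symmetric] y_def[symmetric] by (simp add: N_def)
  qed
  have sq: "sqrt N * sqrt N = N" using N by simp
  have "(\<Sum>i<n. v i s \<omega> * v i t \<omega> - g) = A - N * g"
    by (simp add: sum_subtractf A_def N_def)
  then have "(\<Sum>i<n. v i s \<omega> * v i t \<omega> - g) / sqrt N = sqrt N * ((A - N * g) / N)"
    using N by (simp only: divide_sqrt_eq)
  then have "sqrt N * (sample_cov n indiv s t \<omega> - g) - (\<Sum>i<n. v i s \<omega> * v i t \<omega> - g) / sqrt N =
      sqrt N * (((A - x * y / N) / (N - 1) - g) - (A - N * g) / N)"
    unfolding cov by (simp add: right_diff_distrib)
  also have "((A - x * y / N) / (N - 1) - g) - (A - N * g) / N = (A - x * y) / (N * (N - 1))"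
    using N by (simp add: field_simps)
  also have "sqrt N * ((A - x * y) / (N * (N - 1))) = sqrt N / (N - 1) * ((A - x * y) / N)" by simp
  finally have eq: "sqrt N * (sample_cov n indiv s t \<omega> - g) - (\<Sum>i<n. v i s \<omega> * v i t \<omega> - g) / sqrt N =
      sqrt N / (N - 1) * ((A - x * y) / N)" .
  have ab: "\<bar>x * y\<bar> \<le> (x\<^sup>2 + y\<^sup>2) / 2" for x y :: real
  proof -
    have "0 \<le> (\<bar>x\<bar> - \<bar>y\<bar>)\<^sup>2" by simp
    then show ?thesis by (simp add: power2_diff abs_mult)
  qed
  have "\<bar>A\<bar> \<le> (\<Sum>i<n. ((v i s \<omega>)\<^sup>2 + (v i t \<omega>)\<^sup>2) / 2)"
    unfolding A_def by (intro order_trans[OF sum_abs] sum_mono ab)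
  also have "\<dots> = ((\<Sum>i<n. (v i s \<omega>)\<^sup>2) + (\<Sum>i<n. (v i t \<omega>)\<^sup>2)) / 2"
    by (simp add: sum.distrib sum_divide_distrib[symmetric])
  finally have "\<bar>A\<bar> + \<bar>x * y\<bar> \<le> ((\<Sum>i<n. (v i s \<omega>)\<^sup>2) + (\<Sum>i<n. (v i t \<omega>)\<^sup>2)) / 2 + (x\<^sup>2 + y\<^sup>2) / 2"
    using ab[of x y] by (rule add_mono)
  with abs_triangle_ineq4[of A "x * y"]
  have "\<bar>A - x * y\<bar> \<le> ((\<Sum>i<n. (v i s \<omega>)\<^sup>2) + (\<Sum>i<n. (v i t \<omega>)\<^sup>2)) / 2 + (x\<^sup>2 + y\<^sup>2) / 2"
    by (rule order_trans)
  then have "\<bar>A - x * y\<bar> \<le> ((\<Sum>i<n. (v i s \<omega>)\<^sup>2) + (\<Sum>i<n. (v i t \<omega>)\<^sup>2) + x\<^sup>2 + y\<^sup>2) / 2"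
    by (simp add: add_divide_distrib)
  then have "\<bar>(A - x * y) / N\<bar> \<le> ((\<Sum>i<n. (v i s \<omega>)\<^sup>2) + (\<Sum>i<n. (v i t \<omega>)\<^sup>2) + x\<^sup>2 + y\<^sup>2) / (2 * N)"
    using N by (simp add: abs_divide field_simps)
  then have "\<bar>sqrt N / (N - 1) * ((A - x * y) / N)\<bar> \<le>
      sqrt N / (N - 1) * (((\<Sum>i<n. (v i s \<omega>)\<^sup>2) + (\<Sum>i<n. (v i t \<omega>)\<^sup>2) + x\<^sup>2 + y\<^sup>2) / (2 * N))"
    unfolding abs_mult using N by (simp only: abs_of_nonneg divide_nonneg_nonneg real_sqrt_ge_zero diff_ge_0_iff_ge)
      (intro mult_left_mono, auto)
  then show ?thesis using eq unfolding N_def x_def y_def by simp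
qed

lemma cov_linearization_prob:
  assumes s: "s \<in> {a..b}" and t: "t \<in> {a..b}" and \<epsilon>: "0 < \<epsilon>"
  shows "(\<lambda>n. prob {\<omega>\<in>space M. \<bar>sqrt (real n) * (sample_cov n indiv s t \<omega> - g) -
     (\<Sum>i<n. v i s \<omega> * v i t \<omega> - g) / sqrt (real n)\<bar> > \<epsilon>}) \<longlonglongrightarrow> 0"
proof -
  define Y where "Y n \<omega> = ((\<Sum>i<n. (v i s \<omega>)\<^sup>2) + (\<Sum>i<n. (v i t \<omega>)\<^sup>2)
      + (\<Sum>i<n. v i s \<omega>)\<^sup>2 + (\<Sum>i<n. v i t \<omega>)\<^sup>2) / (2 * real n)" for n \<omega>
  have EY: "has_bochner_integral M (Y n) (\<gamma> s s + \<gamma> t t)" if "0 < n" for n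
  proof -
    have v2: "has_bochner_integral M (\<lambda>\<omega>. (v i r \<omega>)\<^sup>2) (\<gamma> r r)" if "r \<in> {a..b}" for i r
      using v_cov[OF that that, of i] by (simp add: power2_eq_square)
    have "has_bochner_integral M (Y n) (((\<Sum>i<n. \<gamma> s s) + (\<Sum>i<n. \<gamma> t t) + real n * \<gamma> s s + real n * \<gamma> t t) / (2 * real n))"
      unfolding Y_def[abs_def]
      by (intro has_bochner_integral_divide has_bochner_integral_add has_bochner_integral_sum v2 v_sum_sq s t)
    moreover have "((\<Sum>i<n. \<gamma> s s) + (\<Sum>i<n. \<gamma> t t) + real n * \<gamma> s s + real n * \<gamma> t t) / (2 * real n) = \<gamma> s s + \<gamma> t t"
      using that by (simp add: field_simps)
    ultimately show ?thesis by simp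
  qed
  have Y0: "0 \<le> Y n \<omega>" for n \<omega> unfolding Y_def by (intro divide_nonneg_nonneg add_nonneg_nonneg sum_nonneg) auto
  define q where "q n = sqrt (real n) / (real n - 1)" for n
  have lim: "(\<lambda>n. (\<gamma> s s + \<gamma> t t) / \<epsilon> * q n) \<longlonglongrightarrow> (\<gamma> s s + \<gamma> t t) / \<epsilon> * 0"
  proof (rule tendsto_mult_left)
    show "q \<longlonglongrightarrow> 0" unfolding q_def by real_asymp
  qed
  let ?A = "\<lambda>n. {\<omega>\<in>space M. \<bar>sqrt (real n) * (sample_cov n indiv s t \<omega> - g) -
     (\<Sum>i<n. v i s \<omega> * v i t \<omega> - g) / sqrt (real n)\<bar> > \<epsilon>}"
  have le: "prob (?A n) \<le> (\<gamma> s s + \<gamma> t t) / \<epsilon> * q n" if n: "2 \<le> n" for n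
  proof -
    have q: "0 < q n" unfolding q_def using n by simp
    have iY: "integrable M (Y n)" and eY: "(\<integral>\<omega>. Y n \<omega> \<partial>M) = \<gamma> s s + \<gamma> t t"
      using EY[of n] n by (auto simp: has_bochner_integral_iff)
    have "?A n \<subseteq> {\<omega>\<in>space M. Y n \<omega> \<ge> \<epsilon> / q n}"
    proof safe
      fix \<omega> assume "\<bar>sqrt (real n) * (sample_cov n indiv s t \<omega> - g) -
         (\<Sum>i<n. v i s \<omega> * v i t \<omega> - g) / sqrt (real n)\<bar> > \<epsilon>"
      with cov_linearization[OF n, of s t \<omega> g] have "\<epsilon> \<le> q n * Y n \<omega>" unfolding q_def Y_def by linarith
      then show "\<epsilon> / q n \<le> Y n \<omega>" using q by (simp add: pos_divide_le_eq mult.commute)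
    qed
    then have "prob (?A n) \<le> prob {\<omega>\<in>space M. Y n \<omega> \<ge> \<epsilon> / q n}"
      using iY by (intro finite_measure_mono) auto
    also have "\<dots> \<le> (\<integral>\<omega>. Y n \<omega> \<partial>M) / (\<epsilon> / q n)"
      by (rule integral_Markov_inequality_measure[OF iY sets.top]) (use Y0 \<epsilon> q in auto)
    also have "\<dots> = (\<gamma> s s + \<gamma> t t) / \<epsilon> * q n" unfolding eY by simp
    finally show ?thesis .
  qed
  have lim': "(\<lambda>n. (\<gamma> s s + \<gamma> t t) / \<epsilon> * q n) \<longlonglongrightarrow> 0" using lim by simp
  show ?thesis
  proof (rule tendsto_sandwich[OF _ _ tendsto_const lim'])
    show "\<forall>\<^sub>F n in sequentially. prob (?A n) \<le> (\<gamma> s s + \<gamma> t t) / \<epsilon> * q n"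
      using eventually_ge_at_top[of 2] by eventually_elim (rule le)
    show "\<forall>\<^sub>F n in sequentially. 0 \<le> prob (?A n)" by simp
  qed
qed

lemma v_fourth_product:
  assumes m4: "\<And>t. t \<in> I \<Longrightarrow> integrable M (\<lambda>\<omega>. v 0 t \<omega> ^ 4)" and I: "I \<subseteq> {a..b}"
    and r: "s1 \<in> I" "t1 \<in> I" "s2 \<in> I" "t2 \<in> I"
  shows "integrable M (\<lambda>\<omega>. v 0 s1 \<omega> * v 0 t1 \<omega> * v 0 s2 \<omega> * v 0 t2 \<omega>)"
proof (rule Bochner_Integration.integrable_bound)
  show "integrable M (\<lambda>\<omega>. v 0 s1 \<omega> ^ 4 + v 0 t1 \<omega> ^ 4 + v 0 s2 \<omega> ^ 4 + v 0 t2 \<omega> ^ 4)"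
    by (intro Bochner_Integration.integrable_add m4 r)
  show "(\<lambda>\<omega>. v 0 s1 \<omega> * v 0 t1 \<omega> * v 0 s2 \<omega> * v 0 t2 \<omega>) \<in> borel_measurable M"
    by (intro borel_measurable_times v_meas) (use r I in auto)
  (* The arithmetic-geometric mean inequality is applied to the pairs and then to their squares. *)
  have two: "\<bar>x * y\<bar> \<le> (x\<^sup>2 + y\<^sup>2) / 2" for x y :: real
  proof -
    have "0 \<le> (\<bar>x\<bar> - \<bar>y\<bar>)\<^sup>2" by simp
    then show ?thesis by (simp add: power2_diff abs_mult)
  qed
  have "\<bar>w * x * y * z\<bar> \<le> \<bar>w ^ 4 + x ^ 4 + y ^ 4 + z ^ 4\<bar>" for w x y z :: real
  proof -
    have p4: "(u * u')\<^sup>2 \<le> (u ^ 4 + u' ^ 4) / 2" for u u' :: real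
      using two[of "u\<^sup>2" "u'\<^sup>2"] by (simp add: power_mult_distrib)
    have pos: "0 \<le> u ^ 4" for u :: real by simp
    have "\<bar>w * x * y * z\<bar> \<le> ((w * x)\<^sup>2 + (y * z)\<^sup>2) / 2" using two[of "w * x" "y * z"] by (simp add: mult.assoc)
    also have "\<dots> \<le> w ^ 4 + x ^ 4 + y ^ 4 + z ^ 4"
    proof -
      have "(A + B) / 2 \<le> k + l + r + q"
        if "A \<le> (k + l) / 2" "B \<le> (r + q) / 2" "0 \<le> k" "0 \<le> l" "0 \<le> r" "0 \<le> q" for A B k l r q :: real
        using that by (simp add: field_simps)
      from this[OF p4 p4 pos pos pos pos] show ?thesis .
    qed
    also have "\<dots> \<le> \<bar>w ^ 4 + x ^ 4 + y ^ 4 + z ^ 4\<bar>" by (rule abs_ge_self)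
    finally show ?thesis .
  qed
  then show "AE \<omega> in M. norm (v 0 s1 \<omega> * v 0 t1 \<omega> * v 0 s2 \<omega> * v 0 t2 \<omega>) \<le>
      norm (v 0 s1 \<omega> ^ 4 + v 0 t1 \<omega> ^ 4 + v 0 s2 \<omega> ^ 4 + v 0 t2 \<omega> ^ 4)" by simp
qed

lemma AGP_cov:
  assumes \<delta>: "\<delta> > 1 + 1 / (2 * (real p + 1))"
    and O: "\<And>s t. s \<in> {a<..<b} \<Longrightarrow> t \<in> {a<..<b} \<Longrightarrow>
      O_UP M {(s, t)} (\<lambda>n (s, t) \<omega>. (sample_cov n (recon n) s t \<omega> - sample_cov n indiv s t \<omega>) / rate n)"
    and m4: "\<And>t. t \<in> {a<..<b} \<Longrightarrow> integrable M (\<lambda>\<omega>. v 0 t \<omega> ^ 4)"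
    and \<gamma>star: "\<And>s1 t1 s2 t2. \<gamma>star (s1, t1) (s2, t2) =
      (\<integral>\<omega>. v 0 s1 \<omega> * v 0 t1 \<omega> * v 0 s2 \<omega> * v 0 t2 \<omega> \<partial>M) - \<gamma> s1 t1 * \<gamma> s2 t2"
  shows "AGP M ({a<..<b} \<times> {a<..<b})
    (\<lambda>n (s, t) \<omega>. sqrt (real n) * (sample_cov n (recon n) s t \<omega> - \<gamma> s t)) (\<lambda>_. 0) \<gamma>star"
proof (rule AGP_iid_approx[where F="\<lambda>(s, t) x. x s * x t - \<gamma> s t", OF prob_space_axioms effects_indep path_distr(1)])
  fix z assume z: "z \<in> {a<..<b} \<times> {a<..<b}"
  obtain s t where st: "z = (s, t)" "s \<in> {a<..<b}" "t \<in> {a<..<b}" using z by auto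
  then have s': "s \<in> {a..b}" "t \<in> {a..b}" by auto
  have one: "has_bochner_integral M (\<lambda>\<omega>. k) k" for k :: real by (simp add: has_bochner_integral_iff prob_space)
  show "(case z of (s, t) \<Rightarrow> \<lambda>x. x s * x t - \<gamma> s t) \<in> borel_measurable (path_space {a..b})"
    unfolding st(1) prod.case
    by (intro borel_measurable_diff borel_measurable_times borel_measurable_const coord_meas s')
  show "has_bochner_integral M (\<lambda>\<omega>. (case z of (s, t) \<Rightarrow> \<lambda>x. x s * x t - \<gamma> s t) (sample_path {a..b} (v 0) \<omega>)) 0"
    using has_bochner_integral_diff[OF v_cov[OF s', of 0] one[of "\<gamma> s t"]] s' by (simp add: st(1) sample_path_apply)
  show "(case z of (s, t) \<Rightarrow> \<lambda>\<omega>. sqrt (real n) * (sample_cov n (recon n) s t \<omega> - \<gamma> s t)) \<in> borel_measurable M" for n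
    unfolding st(1) prod.case
    by (intro borel_measurable_times borel_measurable_diff borel_measurable_const cov_meas s')
  fix \<epsilon> :: real assume \<epsilon>: "0 < \<epsilon>"
  define U where "U n \<omega> = (sqrt (real n) * rate n) * ((sample_cov n (recon n) s t \<omega> - sample_cov n indiv s t \<omega>) / rate n)" for n \<omega>
  define V where "V n \<omega> = sqrt (real n) * (sample_cov n indiv s t \<omega> - \<gamma> s t) -
     (\<Sum>i<n. v i s \<omega> * v i t \<omega> - \<gamma> s t) / sqrt (real n)" for n \<omega>
  have Um: "U n \<in> borel_measurable M" for n
    unfolding U_def[abs_def] by (intro borel_measurable_times borel_measurable_divide borel_measurable_diff borel_measurable_const cov_meas s')
  have Vm: "V n \<in> borel_measurable M" for n
    unfolding V_def[abs_def] by (intro borel_measurable_times borel_measurable_divide borel_measurable_sum borel_measurable_diff borel_measurable_const cov_meas v_meas s')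
  have limU: "(\<lambda>n. prob {\<omega>\<in>space M. \<bar>U n \<omega>\<bar> > \<epsilon> / 2}) \<longlonglongrightarrow> 0"
  proof -
    have "(\<lambda>n. prob {\<omega>\<in>space M. \<bar>(sqrt (real n) * rate n) * (case (s, t) of (s, t) \<Rightarrow>
        \<lambda>\<omega>. (sample_cov n (recon n) s t \<omega> - sample_cov n indiv s t \<omega>) / rate n) \<omega>\<bar> > \<epsilon> / 2}) \<longlonglongrightarrow> 0"
      by (rule O_UP_vanishing[OF O[OF st(2,3)] _ sqrt_rate[OF \<delta>]])
        (use \<epsilon> cov_meas s' in \<open>auto intro!: borel_measurable_divide borel_measurable_diff\<close>)
    then show ?thesis by (simp add: U_def)
  qed
  have limV: "(\<lambda>n. prob {\<omega>\<in>space M. \<bar>V n \<omega>\<bar> > \<epsilon> / 2}) \<longlonglongrightarrow> 0"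
    unfolding V_def by (rule cov_linearization_prob[OF s']) (use \<epsilon> in simp)
  let ?A = "\<lambda>n. {\<omega>\<in>space M. \<bar>(case z of (s, t) \<Rightarrow> \<lambda>\<omega>. sqrt (real n) * (sample_cov n (recon n) s t \<omega> - \<gamma> s t)) \<omega> -
     (\<Sum>i<n. (case z of (s, t) \<Rightarrow> \<lambda>x. x s * x t - \<gamma> s t) (sample_path {a..b} (v i) \<omega>)) / sqrt (real n)\<bar> > \<epsilon>}"
  have le: "prob (?A n) \<le> prob {\<omega>\<in>space M. \<bar>U n \<omega>\<bar> > \<epsilon> / 2} + prob {\<omega>\<in>space M. \<bar>V n \<omega>\<bar> > \<epsilon> / 2}" if n: "0 < n" for n
  proof -
    have "(case z of (s, t) \<Rightarrow> \<lambda>\<omega>. sqrt (real n) * (sample_cov n (recon n) s t \<omega> - \<gamma> s t)) \<omega> -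
       (\<Sum>i<n. (case z of (s, t) \<Rightarrow> \<lambda>x. x s * x t - \<gamma> s t) (sample_path {a..b} (v i) \<omega>)) / sqrt (real n) = U n \<omega> + V n \<omega>" for \<omega>
    proof -
      have U: "U n \<omega> = sqrt (real n) * (sample_cov n (recon n) s t \<omega> - sample_cov n indiv s t \<omega>)"
        using rate_pos[OF n] by (simp add: U_def)
      show ?thesis unfolding U V_def st(1) prod.case using s' by (simp only: sample_path_apply right_diff_distrib)
    qed
    then have "?A n \<subseteq> {\<omega>\<in>space M. \<bar>U n \<omega>\<bar> > \<epsilon> / 2} \<union> {\<omega>\<in>space M. \<bar>V n \<omega>\<bar> > \<epsilon> / 2}"
      by (auto simp: not_less[symmetric] abs_le_iff)
    then have "prob (?A n) \<le> prob ({\<omega>\<in>space M. \<bar>U n \<omega>\<bar> > \<epsilon> / 2} \<union> {\<omega>\<in>space M. \<bar>V n \<omega>\<bar> > \<epsilon> / 2})"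
      using Um[of n] Vm[of n] by (intro finite_measure_mono) auto
    also have "\<dots> \<le> prob {\<omega>\<in>space M. \<bar>U n \<omega>\<bar> > \<epsilon> / 2} + prob {\<omega>\<in>space M. \<bar>V n \<omega>\<bar> > \<epsilon> / 2}"
      using Um[of n] Vm[of n] by (intro measure_Un_le) auto
    finally show ?thesis .
  qed
  have lim2: "(\<lambda>n. prob {\<omega>\<in>space M. \<bar>U n \<omega>\<bar> > \<epsilon> / 2} + prob {\<omega>\<in>space M. \<bar>V n \<omega>\<bar> > \<epsilon> / 2}) \<longlonglongrightarrow> 0"
    using tendsto_add[OF limU limV] by simp
  show "(\<lambda>n. prob (?A n)) \<longlonglongrightarrow> 0"
  proof (rule tendsto_sandwich[OF _ _ tendsto_const lim2])
    show "\<forall>\<^sub>F n in sequentially. prob (?A n) \<le> prob {\<omega>\<in>space M. \<bar>U n \<omega>\<bar> > \<epsilon> / 2} + prob {\<omega>\<in>space M. \<bar>V n \<omega>\<bar> > \<epsilon> / 2}"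
      using eventually_gt_at_top[of 0] by eventually_elim (rule le)
    show "\<forall>\<^sub>F n in sequentially. 0 \<le> prob (?A n)" by simp
  qed
next
  fix z z' assume z: "z \<in> {a<..<b} \<times> {a<..<b}" "z' \<in> {a<..<b} \<times> {a<..<b}"
  obtain s1 t1 s2 t2 where st: "z = (s1, t1)" "z' = (s2, t2)"
    "s1 \<in> {a<..<b}" "t1 \<in> {a<..<b}" "s2 \<in> {a<..<b}" "t2 \<in> {a<..<b}" using z by auto
  then have r: "s1 \<in> {a..b}" "t1 \<in> {a..b}" "s2 \<in> {a..b}" "t2 \<in> {a..b}" by auto
  have one: "has_bochner_integral M (\<lambda>\<omega>. k) k" for k :: real by (simp add: has_bochner_integral_iff prob_space)
  let ?E = "\<integral>\<omega>. v 0 s1 \<omega> * v 0 t1 \<omega> * v 0 s2 \<omega> * v 0 t2 \<omega> \<partial>M"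
  have four: "has_bochner_integral M (\<lambda>\<omega>. v 0 s1 \<omega> * v 0 t1 \<omega> * v 0 s2 \<omega> * v 0 t2 \<omega>) ?E"
    using v_fourth_product[OF m4 _ st(3-6)] by (simp add: has_bochner_integral_iff subset_eq)
  have "has_bochner_integral M (\<lambda>\<omega>. v 0 s1 \<omega> * v 0 t1 \<omega> * v 0 s2 \<omega> * v 0 t2 \<omega> - \<gamma> s2 t2 * (v 0 s1 \<omega> * v 0 t1 \<omega>)
      - \<gamma> s1 t1 * (v 0 s2 \<omega> * v 0 t2 \<omega>) + \<gamma> s1 t1 * \<gamma> s2 t2)
      (?E - \<gamma> s2 t2 * \<gamma> s1 t1 - \<gamma> s1 t1 * \<gamma> s2 t2 + \<gamma> s1 t1 * \<gamma> s2 t2)"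
    by (intro has_bochner_integral_add has_bochner_integral_diff has_bochner_integral_mult_right four one v_cov r)
  moreover have "?E - \<gamma> s2 t2 * \<gamma> s1 t1 - \<gamma> s1 t1 * \<gamma> s2 t2 + \<gamma> s1 t1 * \<gamma> s2 t2 = \<gamma>star z z'"
    by (simp add: st \<gamma>star)
  ultimately show "has_bochner_integral M (\<lambda>\<omega>. (case z of (s, t) \<Rightarrow> \<lambda>x. x s * x t - \<gamma> s t) (sample_path {a..b} (v 0) \<omega>) *
      (case z' of (s, t) \<Rightarrow> \<lambda>x. x s * x t - \<gamma> s t) (sample_path {a..b} (v 0) \<omega>)) (\<gamma>star z z')"
    using r by (simp add: st(1,2) sample_path_apply algebra_simps)
qed

section \<open>Gaussian subject effects\<close>

lemma gaussian_fourth_moment: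
  fixes k :: nat
  assumes g: "gaussian_process M {a..b} (v 0) (\<lambda>_. 0) \<gamma>" and \<tau>: "\<tau> \<in> {..<k} \<rightarrow> {a..b}"
  shows "has_bochner_integral M (\<lambda>\<omega>. (\<Sum>j<k. u j * v 0 (\<tau> j) \<omega>) ^ 4) (3 * (\<Sum>j<k. \<Sum>l<k. u j * u l * \<gamma> (\<tau> j) (\<tau> l))\<^sup>2)"
proof -
  define w where "w = (\<Sum>j<k. \<Sum>l<k. u j * u l * \<gamma> (\<tau> j) (\<tau> l))"
  have \<tau>': "\<tau> j \<in> {a..b}" if "j < k" for j using \<tau> that by auto
  define X where "X \<omega> = (\<Sum>j<k. u j * v 0 (\<tau> j) \<omega>)" for \<omega>
  have Xm: "X \<in> borel_measurable M" unfolding X_def[abs_def]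
    by (intro borel_measurable_sum borel_measurable_times borel_measurable_const v_meas) (use \<tau>' in simp)
  let ?Y = "\<lambda>\<omega>. \<lambda>j\<in>{..<k}. v 0 (\<tau> j) \<omega>"
  have Ym: "?Y \<in> measurable M (Pi\<^sub>M {..<k} (\<lambda>_. borel))" and
    mv: "multivariate_normal k (\<lambda>_. 0) (\<lambda>j l. \<gamma> (\<tau> j) (\<tau> l)) (distr M (Pi\<^sub>M {..<k} (\<lambda>_. borel)) ?Y)"
    using g \<tau> unfolding gaussian_process_def by auto
  have linm: "(\<lambda>x. \<Sum>j<k. u j * x j) \<in> borel_measurable (Pi\<^sub>M {..<k} (\<lambda>_. borel :: real measure))"
    by (intro borel_measurable_sum borel_measurable_times borel_measurable_const measurable_component_singleton)
  have "distr (distr M (Pi\<^sub>M {..<k} (\<lambda>_. borel)) ?Y) borel (\<lambda>x. \<Sum>j<k. u j * x j) = normal_law 0 w"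
    using mv unfolding multivariate_normal_def w_def by simp
  then have law: "distr M borel X = normal_law 0 w"
    by (subst (asm) distr_distr[OF linm Ym]) (simp add: comp_def X_def[abs_def])
  have "has_bochner_integral M (\<lambda>\<omega>. (X \<omega>)\<^sup>2) w"
  proof -
    have "has_bochner_integral M (\<lambda>\<omega>. \<Sum>j<k. \<Sum>l<k. u j * u l * (v 0 (\<tau> j) \<omega> * v 0 (\<tau> l) \<omega>)) w"
      unfolding w_def by (intro has_bochner_integral_sum has_bochner_integral_mult_right v_cov) (use \<tau>' in auto)
    moreover have "(\<Sum>j<k. \<Sum>l<k. u j * u l * (v 0 (\<tau> j) \<omega> * v 0 (\<tau> l) \<omega>)) = (X \<omega>)\<^sup>2" for \<omega>
      by (simp add: X_def power2_eq_square sum_product mult_ac)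
    ultimately show ?thesis by simp
  qed
  then have "w = (\<integral>\<omega>. (X \<omega>)\<^sup>2 \<partial>M)" by (simp add: has_bochner_integral_iff)
  then have w0: "0 \<le> w" by simp
  have "has_bochner_integral std_normal_distribution (\<lambda>x. x ^ 4) 3"
  proof -
    have "has_bochner_integral lborel (\<lambda>x. std_normal_density x * x ^ (2 * 2)) (fact (2 * 2) / (2 ^ 2 * fact 2))"
      by (rule std_normal_moment_even)
    moreover have "fact (2 * 2) / (2 ^ 2 * fact 2) = (3 :: real)" by (simp add: fact_numeral)
    ultimately have "has_bochner_integral lborel (\<lambda>x. std_normal_density x *\<^sub>R (x ^ 4)) 3" by simp
    then show ?thesis by (intro has_bochner_integral_density) auto
  qed
  from has_bochner_integral_mult_right[OF this, of "w\<^sup>2"]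
  have "has_bochner_integral std_normal_distribution (\<lambda>x. (sqrt w * x) ^ 4) (3 * w\<^sup>2)"
  proof -
    have "sqrt w ^ 4 = w\<^sup>2" using w0 by (simp add: power4_eq_xxxx power2_eq_square)
    then show ?thesis using \<open>has_bochner_integral std_normal_distribution (\<lambda>x. w\<^sup>2 * x ^ 4) (w\<^sup>2 * 3)\<close>
      by (simp add: power_mult_distrib mult.commute)
  qed
  then have "has_bochner_integral (normal_law 0 w) (\<lambda>x. x ^ 4) (3 * w\<^sup>2)"
    unfolding normal_law_eq_distr[OF w0] by (simp add: has_bochner_integral_iff integrable_distr_eq integral_distr)
  then have "has_bochner_integral (distr M borel X) (\<lambda>x. x ^ 4) (3 * w\<^sup>2)" unfolding law .
  then show ?thesis
    unfolding w_def[symmetric] X_def[symmetric]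
    by (simp add: has_bochner_integral_iff integrable_distr_eq[OF Xm] integral_distr[OF Xm])
qed

text \<open>The sum over signs picks the monomial in which every variable has odd degree; its coefficient is
  \<open>8 \<cdot> 24\<close>, eight sign patterns times \<open>4!\<close>.\<close>

lemma isserlis_polarization:
  fixes w x y z :: real
  shows "192 * (w * x * y * z) =
    (w + x + y + z) ^ 4 - (w + x + y - z) ^ 4 - (w + x - y + z) ^ 4 + (w + x - y - z) ^ 4
    - (w - x + y + z) ^ 4 + (w - x + y - z) ^ 4 + (w - x - y + z) ^ 4 - (w - x - y - z) ^ 4"
proof -
  have p4: "(k + z) ^ 4 - (k - z) ^ 4 = 8 * z * k ^ 3 + 8 * z ^ 3 * k" for k :: real
    by (simp add: power4_eq_xxxx power3_eq_cube algebra_simps)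
  have p3: "(k + y) ^ 3 - (k - y) ^ 3 = 6 * y * k\<^sup>2 + 2 * y ^ 3" for k :: real
    by (simp add: power2_eq_square power3_eq_cube algebra_simps)
  have "(w + x + y + z) ^ 4 - (w + x + y - z) ^ 4 - (w + x - y + z) ^ 4 + (w + x - y - z) ^ 4
    - (w - x + y + z) ^ 4 + (w - x + y - z) ^ 4 + (w - x - y + z) ^ 4 - (w - x - y - z) ^ 4 =
    ((w + x + y + z) ^ 4 - (w + x + y - z) ^ 4) - ((w + x - y + z) ^ 4 - (w + x - y - z) ^ 4)
    - ((w - x + y + z) ^ 4 - (w - x + y - z) ^ 4) + ((w - x - y + z) ^ 4 - (w - x - y - z) ^ 4)" by simp
  also have "\<dots> = 8 * z * (((w + x + y) ^ 3 - (w + x - y) ^ 3) - ((w - x + y) ^ 3 - (w - x - y) ^ 3))"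
    unfolding p4 by (simp add: right_diff_distrib distrib_left)
  also have "\<dots> = 8 * z * (6 * y * ((w + x)\<^sup>2 - (w - x)\<^sup>2))"
    unfolding p3 by (simp add: right_diff_distrib)
  also have "\<dots> = 192 * (w * x * y * z)" by (simp add: power2_eq_square algebra_simps)
  finally show ?thesis ..
qed

text \<open>The fourth moment of a centered normal variable is three times its squared variance. Polarizing both
  sides expresses the mixed moment through products of two covariances.\<close>

lemma isserlis:
  assumes g: "gaussian_process M {a..b} (v 0) (\<lambda>_. 0) \<gamma>"
    and r: "s1 \<in> {a..b}" "t1 \<in> {a..b}" "s2 \<in> {a..b}" "t2 \<in> {a..b}"
  shows "(\<integral>\<omega>. v 0 s1 \<omega> * v 0 t1 \<omega> * v 0 s2 \<omega> * v 0 t2 \<omega> \<partial>M) =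
    \<gamma> s1 t1 * \<gamma> s2 t2 + \<gamma> s1 s2 * \<gamma> t1 t2 + \<gamma> s1 t2 * \<gamma> s2 t1"
proof -
  have sym: "\<gamma> s t = \<gamma> t s" if "s \<in> {a..b}" "t \<in> {a..b}" for s t
    using v_cov[OF that, of 0] v_cov[OF that(2,1), of 0] by (simp add: has_bochner_integral_iff mult.commute)
  define Q where "Q x y z = \<gamma> s1 s1 + x\<^sup>2 * \<gamma> t1 t1 + y\<^sup>2 * \<gamma> s2 s2 + z\<^sup>2 * \<gamma> t2 t2
     + 2 * (x * \<gamma> s1 t1 + y * \<gamma> s1 s2 + z * \<gamma> s1 t2 + x * y * \<gamma> t1 s2 + x * z * \<gamma> t1 t2 + y * z * \<gamma> s2 t2)" for x y z
  have J: "has_bochner_integral M (\<lambda>\<omega>. (v 0 s1 \<omega> + x * v 0 t1 \<omega> + y * v 0 s2 \<omega> + z * v 0 t2 \<omega>) ^ 4) (3 * (Q x y z)\<^sup>2)" for x y z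
  proof -
    define u where "u j = [1, x, y, z] ! j" for j
    define \<tau> where "\<tau> j = [s1, t1, s2, t2] ! j" for j
    have four: "{..<4} = {0, 1, 2, 3 :: nat}" by auto
    have "\<tau> \<in> {..<4} \<rightarrow> {a..b}" unfolding four \<tau>_def using r by auto
    from gaussian_fourth_moment[OF g this, of u]
    have "has_bochner_integral M (\<lambda>\<omega>. (\<Sum>j<4. u j * v 0 (\<tau> j) \<omega>) ^ 4) (3 * (\<Sum>j<4. \<Sum>l<4. u j * u l * \<gamma> (\<tau> j) (\<tau> l))\<^sup>2)" .
    moreover have "(\<Sum>j<4. u j * v 0 (\<tau> j) \<omega>) = v 0 s1 \<omega> + x * v 0 t1 \<omega> + y * v 0 s2 \<omega> + z * v 0 t2 \<omega>" for \<omega>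
      unfolding four by (simp add: u_def \<tau>_def)
    moreover have "(\<Sum>j<4. \<Sum>l<4. u j * u l * \<gamma> (\<tau> j) (\<tau> l)) = Q x y z"
      unfolding four using sym[OF r(2,1)] sym[OF r(3,1)] sym[OF r(4,1)] sym[OF r(3,2)] sym[OF r(4,2)] sym[OF r(4,3)]
      by (simp add: u_def \<tau>_def Q_def power2_eq_square algebra_simps)
    ultimately show ?thesis by simp
  qed
  have "has_bochner_integral M (\<lambda>\<omega>. 192 * (v 0 s1 \<omega> * v 0 t1 \<omega> * v 0 s2 \<omega> * v 0 t2 \<omega>))
     (3 * (Q 1 1 1)\<^sup>2 - 3 * (Q 1 1 (-1))\<^sup>2 - 3 * (Q 1 (-1) 1)\<^sup>2 + 3 * (Q 1 (-1) (-1))\<^sup>2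
      - 3 * (Q (-1) 1 1)\<^sup>2 + 3 * (Q (-1) 1 (-1))\<^sup>2 + 3 * (Q (-1) (-1) 1)\<^sup>2 - 3 * (Q (-1) (-1) (-1))\<^sup>2)"
    unfolding isserlis_polarization
    using J[of 1 1 1] J[of 1 1 "-1"] J[of 1 "-1" 1] J[of 1 "-1" "-1"] J[of "-1" 1 1] J[of "-1" 1 "-1"]
      J[of "-1" "-1" 1] J[of "-1" "-1" "-1"]
    by (intro has_bochner_integral_add has_bochner_integral_diff) simp_all
  moreover have "3 * (Q 1 1 1)\<^sup>2 - 3 * (Q 1 1 (-1))\<^sup>2 - 3 * (Q 1 (-1) 1)\<^sup>2 + 3 * (Q 1 (-1) (-1))\<^sup>2
      - 3 * (Q (-1) 1 1)\<^sup>2 + 3 * (Q (-1) 1 (-1))\<^sup>2 + 3 * (Q (-1) (-1) 1)\<^sup>2 - 3 * (Q (-1) (-1) (-1))\<^sup>2 =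
      192 * (\<gamma> s1 t1 * \<gamma> s2 t2 + \<gamma> s1 s2 * \<gamma> t1 t2 + \<gamma> s1 t2 * \<gamma> t1 s2)"
  proof -
    define d where "d = \<gamma> s1 s1 + \<gamma> t1 t1 + \<gamma> s2 s2 + \<gamma> t2 t2"
    define P where "P y z = d + 2 * (y * \<gamma> s1 s2 + z * \<gamma> s1 t2 + y * z * \<gamma> s2 t2)" for y z
    define R where "R y z = 2 * (\<gamma> s1 t1 + y * \<gamma> t1 s2 + z * \<gamma> t1 t2)" for y z
    have Q: "Q 1 1 1 = P 1 1 + R 1 1" "Q (-1) 1 1 = P 1 1 - R 1 1"
      "Q 1 1 (-1) = P 1 (-1) + R 1 (-1)" "Q (-1) 1 (-1) = P 1 (-1) - R 1 (-1)"
      "Q 1 (-1) 1 = P (-1) 1 + R (-1) 1" "Q (-1) (-1) 1 = P (-1) 1 - R (-1) 1"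
      "Q 1 (-1) (-1) = P (-1) (-1) + R (-1) (-1)" "Q (-1) (-1) (-1) = P (-1) (-1) - R (-1) (-1)"
      by (simp_all add: Q_def P_def R_def d_def)
    have sq: "(x + y)\<^sup>2 - (x - y)\<^sup>2 = 4 * (x * y)" for x y :: real by (simp add: power2_eq_square algebra_simps)
    have "3 * (Q 1 1 1)\<^sup>2 - 3 * (Q 1 1 (-1))\<^sup>2 - 3 * (Q 1 (-1) 1)\<^sup>2 + 3 * (Q 1 (-1) (-1))\<^sup>2
      - 3 * (Q (-1) 1 1)\<^sup>2 + 3 * (Q (-1) 1 (-1))\<^sup>2 + 3 * (Q (-1) (-1) 1)\<^sup>2 - 3 * (Q (-1) (-1) (-1))\<^sup>2 =
      3 * (((Q 1 1 1)\<^sup>2 - (Q (-1) 1 1)\<^sup>2) - ((Q 1 1 (-1))\<^sup>2 - (Q (-1) 1 (-1))\<^sup>2)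
        - ((Q 1 (-1) 1)\<^sup>2 - (Q (-1) (-1) 1)\<^sup>2) + ((Q 1 (-1) (-1))\<^sup>2 - (Q (-1) (-1) (-1))\<^sup>2))" by simp
    also have "\<dots> = 12 * (P 1 1 * R 1 1 - P 1 (-1) * R 1 (-1) - P (-1) 1 * R (-1) 1 + P (-1) (-1) * R (-1) (-1))"
      unfolding Q sq by simp
    also have "\<dots> = 192 * (\<gamma> s1 t1 * \<gamma> s2 t2 + \<gamma> s1 s2 * \<gamma> t1 t2 + \<gamma> s1 t2 * \<gamma> t1 s2)"
      unfolding P_def R_def by (simp add: algebra_simps)
    finally show ?thesis .
  qed
  ultimately have "has_bochner_integral M (\<lambda>\<omega>. 192 * (v 0 s1 \<omega> * v 0 t1 \<omega> * v 0 s2 \<omega> * v 0 t2 \<omega>))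
      (192 * (\<gamma> s1 t1 * \<gamma> s2 t2 + \<gamma> s1 s2 * \<gamma> t1 t2 + \<gamma> s1 t2 * \<gamma> t1 s2))" by simp
  then have "(\<integral>\<omega>. 192 * (v 0 s1 \<omega> * v 0 t1 \<omega> * v 0 s2 \<omega> * v 0 t2 \<omega>) \<partial>M) =
      192 * (\<gamma> s1 t1 * \<gamma> s2 t2 + \<gamma> s1 s2 * \<gamma> t1 t2 + \<gamma> s1 t2 * \<gamma> t1 s2)"
    by (simp only: has_bochner_integral_iff)
  then show ?thesis using sym[OF r(3,2)] by simp
qed

end

lemma O_UP_subset:
  assumes "O_UP M S X" "S' \<subseteq> S"
  shows "O_UP M S' X"
  unfolding O_UP_def
proof (intro allI impI)
  fix \<epsilon> :: real assume "0 < \<epsilon>"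
  with assms(1) have "\<exists>B N. \<forall>n\<ge>N. \<forall>x\<in>S. measure M {\<omega>\<in>space M. \<bar>X n x \<omega>\<bar> > B} < \<epsilon>"
    unfolding O_UP_def by blast
  then obtain B N where "\<forall>n\<ge>N. \<forall>x\<in>S. measure M {\<omega>\<in>space M. \<bar>X n x \<omega>\<bar> > B} < \<epsilon>"
    by (elim exE)
  then have "\<forall>n\<ge>N. \<forall>x\<in>S'. measure M {\<omega>\<in>space M. \<bar>X n x \<omega>\<bar> > B} < \<epsilon>" using assms(2) by (meson subsetD)
  then show "\<exists>B N. \<forall>n\<ge>N. \<forall>x\<in>S'. measure M {\<omega>\<in>space M. \<bar>X n x \<omega>\<bar> > B} < \<epsilon>" by (intro exI)
qed

theorem theorem4:
  fixes M :: "'a measure"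
    and a b C \<delta> :: real
    and p :: nat
    and v e f :: "nat \<Rightarrow> real \<Rightarrow> 'a \<Rightarrow> real"
    and \<eta> \<sigma> \<pi> K :: "real \<Rightarrow> real"
    and \<gamma> :: "real \<Rightarrow> real \<Rightarrow> real"
    and \<gamma>star :: "real \<times> real \<Rightarrow> real \<times> real \<Rightarrow> real"
    and m :: "nat \<Rightarrow> nat \<Rightarrow> nat"
    and T y :: "nat \<Rightarrow> nat \<Rightarrow> nat \<Rightarrow> 'a \<Rightarrow> real"
    and h rate :: "nat \<Rightarrow> real"
    and fhat :: "nat \<Rightarrow> nat \<Rightarrow> real \<Rightarrow> 'a \<Rightarrow> real"
    and etahat etatilde :: "nat \<Rightarrow> real \<Rightarrow> 'a \<Rightarrow> real"
    and gammahat gammatilde :: "nat \<Rightarrow> real \<Rightarrow> real \<Rightarrow> 'a \<Rightarrow> real"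
  assumes "prob_space M" and "a < b" and "odd p"
    and model: "subject_effect_error_model M {a..b} v e \<gamma> \<sigma>"
    and f_def: "\<And>i t \<omega>. f i t \<omega> = \<eta> t + v i t \<omega>"
    and y_def: "\<And>n i j \<omega>. y n i j \<omega> = f i (T n i j \<omega>) \<omega> + e i (T n i j \<omega>) \<omega>"
    and obs_measurable:
      "\<And>n i j. i < n \<Longrightarrow> j < m n i \<Longrightarrow> y n i j \<in> borel_measurable M"
      "\<And>n i j. i < n \<Longrightarrow> j < m n i \<Longrightarrow> (\<lambda>\<omega>. v i (T n i j \<omega>) \<omega>) \<in> borel_measurable M"
      "\<And>n i j. i < n \<Longrightarrow> j < m n i \<Longrightarrow> (\<lambda>\<omega>. e i (T n i j \<omega>) \<omega>) \<in> borel_measurable M"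
    and design_indep:
      "\<And>n. design_independent M {a..b} v e {(i, j). i < n \<and> j < m n i} (T n)"
    and A1: "design_density a b \<pi>"
      "\<And>n. random_design M \<pi> {(i, j). i < n \<and> j < m n i} (T n)"
    and A2: "\<exists>D. has_derivs_upto (p + 1) {a<..<b} \<eta> D"
      "\<And>i. AE \<omega> in M. \<exists>D. has_derivs_upto (p + 1) {a<..<b} (\<lambda>t. f i t \<omega>) D"
      "\<exists>G. has_mixed_derivs_upto (p + 1) {a<..<b} \<gamma> G"
      "continuous_on {a<..<b} (\<lambda>t. (\<sigma> t)\<^sup>2)"
    and A3: "kernel_condition K"
    and A4: "C > 0" "\<delta> > 0"
      "\<And>n i. i < n \<Longrightarrow> real (m n i) \<ge> C * real n powr \<delta>"
      "\<And>n. h n > 0" "h \<longlonglongrightarrow> 0"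
      "filterlim (\<lambda>n. real n powr \<delta> * h n) at_top sequentially"
    and bandwidth: "h \<in> \<Theta>(\<lambda>n. real n powr (- \<delta> / (2 * real p + 3)))"
    and fhat_def: "\<And>n i t \<omega>. fhat n i t \<omega> =
      lpk p K (h n) (m n i) (\<lambda>j. T n i j \<omega>) (\<lambda>j. y n i j \<omega>) t"
    and etahat_def: "\<And>n. etahat n = sample_mean n (fhat n)"
    and gammahat_def: "\<And>n. gammahat n = sample_cov n (fhat n)"
    and etatilde_def: "\<And>n. etatilde n = sample_mean n f"
    and gammatilde_def: "\<And>n. gammatilde n = sample_cov n f"
    and rate_def: "\<And>n. rate n = real n powr (- ((real p + 1) * \<delta> / (2 * real p + 3)))"
    and \<gamma>star_def: "\<And>s1 t1 s2 t2. \<gamma>star (s1, t1) (s2, t2) =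
      (\<integral>\<omega>. v 0 s1 \<omega> * v 0 t1 \<omega> * v 0 s2 \<omega> * v 0 t2 \<omega> \<partial>M) - \<gamma> s1 t1 * \<gamma> s2 t2"
  shows
    "(\<forall>S \<subseteq> {a<..<b}. compact S \<or> regular_at_boundary (p + 1) a b \<pi> \<eta> \<gamma> \<sigma> \<longrightarrow>
        O_UP M S (\<lambda>n t \<omega>. (etahat n t \<omega> - etatilde n t \<omega>) / rate n) \<and>
        O_UP M (S \<times> S) (\<lambda>n (s, t) \<omega>. (gammahat n s t \<omega> - gammatilde n s t \<omega>) / rate n)) \<and>
     (\<delta> > 1 + 1 / (2 * (real p + 1)) \<longrightarrow>
        AGP M {a<..<b} (\<lambda>n t \<omega>. sqrt (real n) * (etahat n t \<omega> - \<eta> t)) (\<lambda>_. 0) \<gamma> \<and>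
        ((\<forall>t\<in>{a<..<b}. integrable M (\<lambda>\<omega>. v 0 t \<omega> ^ 4)) \<longrightarrow>
          AGP M ({a<..<b} \<times> {a<..<b})
            (\<lambda>n (s, t) \<omega>. sqrt (real n) * (gammahat n s t \<omega> - \<gamma> s t)) (\<lambda>_. 0) \<gamma>star)) \<and>
     (gaussian_process M {a..b} (v 0) (\<lambda>_. 0) \<gamma> \<longrightarrow>
        (\<forall>s1\<in>{a..b}. \<forall>t1\<in>{a..b}. \<forall>s2\<in>{a..b}. \<forall>t2\<in>{a..b}.
          \<gamma>star (s1, t1) (s2, t2) = \<gamma> s1 t2 * \<gamma> s2 t1 + \<gamma> s1 s2 * \<gamma> t1 t2))"
proof -
  have \<eta>_cont: "continuous_on {a<..<b} \<eta>"
  proof -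
    from A2(1) obtain D where D: "has_derivs_upto (p + 1) {a<..<b} \<eta> D" by blast
    then have "continuous_on {a<..<b} (D 0)" unfolding has_derivs_upto_def by blast
    moreover have "D 0 x = \<eta> x" if "x \<in> {a<..<b}" for x using D that unfolding has_derivs_upto_def by blast
    ultimately show ?thesis by (rule continuous_on_eq)
  qed
  interpret P: prob_space M by (rule assms(1))
  interpret L: lpk_model M a b C \<delta> p v e \<eta> \<sigma> \<pi> K \<gamma> m T h
  proof unfold_locales
    show "(\<lambda>\<omega>. \<eta> (T n i j \<omega>) + v i (T n i j \<omega>) \<omega> + e i (T n i j \<omega>) \<omega>) \<in> borel_measurable M"
      if "i < n" "j < m n i" for n i j
    proof -
      have "y n i j = (\<lambda>\<omega>. \<eta> (T n i j \<omega>) + v i (T n i j \<omega>) \<omega> + e i (T n i j \<omega>) \<omega>)"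
        by (rule ext) (simp add: y_def f_def)
      then show ?thesis using obs_measurable(1)[OF that] by simp
    qed
    show "\<And>n i. i < n \<Longrightarrow> C * real n powr \<delta> \<le> real (m n i)" by (rule A4(3))
  qed (rule \<open>a < b\<close> model design_indep A1 \<eta>_cont A3 A4(1,2,4,5) bandwidth)+
  have ind: "f = L.indiv" by (intro ext) (simp add: f_def L.indiv_def)
  have rec: "fhat n = L.recon n" for n by (intro ext) (simp add: fhat_def L.recon_def y_def f_def)
  have rt: "rate n = L.rate n" for n by (simp add: rate_def L.rate_def)
  note names = etahat_def etatilde_def gammahat_def gammatilde_def ind rec rt
  obtain D where D: "has_derivs_upto (p + 1) {a<..<b} \<eta> D" using A2(1) by blast
  obtain G where G: "has_mixed_derivs_upto (p + 1) {a<..<b} \<gamma> G" using A2(3) by blast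
  note compact_case = L.O_UP_compact[OF _ _ D G A2(4)]
  show ?thesis
  proof (intro conjI impI allI ballI)
    fix S assume S: "S \<subseteq> {a<..<b}" "compact S \<or> regular_at_boundary (p + 1) a b \<pi> \<eta> \<gamma> \<sigma>"
    have "O_UP M S (\<lambda>n t \<omega>. (sample_mean n (L.recon n) t \<omega> - sample_mean n L.indiv t \<omega>) / L.rate n) \<and>
      O_UP M (S \<times> S) (\<lambda>n (s, t) \<omega>. (sample_cov n (L.recon n) s t \<omega> - sample_cov n L.indiv s t \<omega>) / L.rate n)"
      using S(2) compact_case[OF _ S(1)] L.O_UP_regular[OF S(1)] by blast
    then show "O_UP M S (\<lambda>n t \<omega>. (etahat n t \<omega> - etatilde n t \<omega>) / rate n)"
      "O_UP M (S \<times> S) (\<lambda>n (s, t) \<omega>. (gammahat n s t \<omega> - gammatilde n s t \<omega>) / rate n)"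
      unfolding names by blast+
  next
    assume \<delta>: "\<delta> > 1 + 1 / (2 * (real p + 1))"
    show "AGP M {a<..<b} (\<lambda>n t \<omega>. sqrt (real n) * (etahat n t \<omega> - \<eta> t)) (\<lambda>_. 0) \<gamma>"
      unfolding names
      by (rule L.AGP_mean[OF \<delta>]) (use compact_case in simp)
  next
    assume \<delta>: "\<delta> > 1 + 1 / (2 * (real p + 1))" and m4: "\<forall>t\<in>{a<..<b}. integrable M (\<lambda>\<omega>. v 0 t \<omega> ^ 4)"
    show "AGP M ({a<..<b} \<times> {a<..<b})
        (\<lambda>n (s, t) \<omega>. sqrt (real n) * (gammahat n s t \<omega> - \<gamma> s t)) (\<lambda>_. 0) \<gamma>star"
      unfolding names
    proof (rule L.AGP_cov[OF \<delta> _ _ \<gamma>star_def])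
      fix s t assume st: "s \<in> {a<..<b}" "t \<in> {a<..<b}"
      have "O_UP M ({s, t} \<times> {s, t})
         (\<lambda>n (s, t) \<omega>. (sample_cov n (L.recon n) s t \<omega> - sample_cov n L.indiv s t \<omega>) / L.rate n)"
        using compact_case[of "{s, t}"] st by simp
      then show "O_UP M {(s, t)}
         (\<lambda>n (s, t) \<omega>. (sample_cov n (L.recon n) s t \<omega> - sample_cov n L.indiv s t \<omega>) / L.rate n)"
        by (rule O_UP_subset) simp
    qed (use m4 in blast)
  next
    fix s1 t1 s2 t2
    assume "gaussian_process M {a..b} (v 0) (\<lambda>_. 0) \<gamma>"
      "s1 \<in> {a..b}" "t1 \<in> {a..b}" "s2 \<in> {a..b}" "t2 \<in> {a..b}"
    then show "\<gamma>star (s1, t1) (s2, t2) = \<gamma> s1 t2 * \<gamma> s2 t1 + \<gamma> s1 s2 * \<gamma> t1 t2"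
      unfolding \<gamma>star_def by (simp add: L.isserlis)
  qed
qed

end
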